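(* Consider a nonlinear control system $\dot x=f(x,u)$ with $n$ states and $m$ inputs, together with a flat output $y=\varphi(x,u_{[0,Q]})$ with $m$ components. Suppose there exists a partitioning of the components of the flat output $y=(\varphi_1(x,u),\varphi_2(x,u_{[0,Q]}))$, with corresponding multi-indices $K=(K_1,K_2)$ (relative degrees) and $R=(R_1,R_2)$ (highest derivative orders in the flat parameterization), such that the $m_1$ components $\varphi_1$ satisfy $\operatorname{rank}(\partial_u\varphi_{1,[K_1]}(x,u))=m_1$, $R_1>K_1$ (componentwise), and $|R_1|-|K_1|=d_{\mathrm{diff}}(\varphi)$. Then the system is $\varphi$-SFL via minimal prolongations. More precisely, applying any invertible input transformation of the form $(\hat u_1,\hat u_2)=(\varphi_{1,[K_1]}(x,u),\Phi_{\hat u_2}(x,u))$ with a subsequent prolongation of $\hat u_1$ of order $D=R_1-K_1$ yields an extended system $$\dot x=\hat f(x,\hat u_1,\hat u_2),\quad \dot{\hat u}_1=\hat u_{1,[1]},\ \ldots,\ \dot{\hat u}_{1,[D-1]}=\hat u_{1,[D]}$$ that is SFL.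
   Context: All functions are smooth; all statements are local and at generic points. Consider $\dot x=f(x,u)$ with $x\in\mathbb R^n$, $u\in\mathbb R^m$. Subscripts in square brackets denote time derivatives along trajectories: $u_{[\alpha]}$ is the $\alpha$-th time derivative of $u$, and for a function $h(x,u,u_{[1]},\ldots)$, $h_{[\alpha]}=L_{f_u}^\alpha h$ with $f_u=f^i(x,u)\partial_{x^i}+\sum_{\alpha\ge 0}u^j_{[\alpha+1]}\partial_{u^j_{[\alpha]}}$. For multi-indices $A=(a^1,\ldots,a^m)$, $B$: $y_{[A]}=(y^1_{[a^1]},\ldots,y^m_{[a^m]})$; $y^j_{[a,b]}=(y^j_{[a]},\ldots,y^j_{[b]})$ (empty if $a>b$); $y_{[A,B]}=(y^1_{[a^1,b^1]},\ldots,y^m_{[a^m,b^m]})$; $y_{[0,A]}=(y^1_{[0,a^1]},\ldots,y^m_{[0,a^m]})$; sums, differences and inequalities are componentwise; $A\pm c=(a^1\pm c,\ldots,a^m\pm c)$ for an integer $c$; $|A|=\sum_j a^j$. Flatness: the system is flat with flat output $y=\varphi(x,u_{[0,Q]})$ ($m$ differentially independent functions) if locally $x=F_x(y_{[0,R-1]})$ and $u=F_u(y_{[0,R]})$ with smooth $F_x,F_u$ along trajectories, where the multi-index $R=(r^1,\ldots,r^m)$ denotes the highest derivative orders of $y$ appearing in this parameterization (unique for given $\varphi$). For every $\beta$ the differentials $d\varphi,d\varphi_{[1]},\ldots,d\varphi_{[\beta]}$ are linearly independent. The differential difference of $\varphi$ is $d_{\mathrm{diff}}(\varphi)=|R|-n$.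 Relative degree: for a component $\varphi^j(x,u)$, $k^j$ is the integer such that $\varphi^j_{[k^j-1]}$ depends only on $x$ and $\varphi^j_{[k^j]}=\varphi^j_{[k^j]}(x,u)$ depends explicitly on $u$; $k^j=0$ if $\varphi^j$ itself depends explicitly on $u$. In this theorem only the relative degrees $K_1$ of the components $\varphi_1(x,u)$ enter. SFL: a system is static feedback linearizable (SFL) with linearizing output $\varphi$ if a static state feedback $u=\alpha(x,w)$ and a state transformation turn it into $m$ integrator chains $y^j_{[l_j]}=w^j$ with $y=\varphi$; equivalently, the flat parameterization with respect to $\varphi$ is a local diffeomorphism between (state, input) and $y_{[0,R]}$, and between the state and $y_{[0,R-1]}$. $\varphi$-SFL via prolongations: there exist an invertible static input transformation $(\hat u_1,\hat u_2)=\Phi_{\hat u}(x,u)$ (invertible with respect to $u$), $\dim\hat u_1=m_1$, and a multi-index $D=(d^1,\ldots,d^{m_1})$ with each $d^j>0$, such that the extended system $\dot x=\hat f(x,\hat u_1,\hat u_2)$, $\dot{\hat u}_1=\hat u_{1,[1]}$, $\ldots$, $\dot{\hat u}_{1,[D-1]}=\hat u_{1,[D]}$, with state $(x,\hat u_{1,[0,D-1]})$ and input $(\hat u_{1,[D]},\hat u_2)$, is SFL with $\varphi$ as a linearizing output (this is called prolonging $\hat u_1$ to order $D$). If additionally $|D|=d_{\mathrm{diff}}(\varphi)$, the system is $\varphi$-SFL via minimal prolongations. *)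

theory Defs
  imports "HOL-Analysis.Analysis"
begin

section \<open>Smooth functions of finitely many named coordinates\<close>

text \<open>
  The number of variables (jet orders, dimension of a prolonged system) depends on parameters that
  are quantified inside the statements, so points are functions from coordinate names to
  reals, with the product topology, and a function of the coordinates in a finite set \<open>C\<close> is a
  function on this space that only looks at \<open>C\<close>.
\<close>

definition partial_deriv :: "'c \<Rightarrow> (('c \<Rightarrow> real) \<Rightarrow> real) \<Rightarrow> ('c \<Rightarrow> real) \<Rightarrow> real" where
  "partial_deriv c h p = deriv (\<lambda>t. h (p(c := t))) (p c)"

text \<open>\<open>k\<close> times continuously differentiable on (the open set) \<open>U\<close>.\<close>

primrec Ck_on :: "nat \<Rightarrow> ('c \<Rightarrow> real) set \<Rightarrow> (('c \<Rightarrow> real) \<Rightarrow> real) \<Rightarrow> bool" where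
  "Ck_on 0 U h \<longleftrightarrow> continuous_on U h"
| "Ck_on (Suc k) U h \<longleftrightarrow> continuous_on U h \<and>
     (\<forall>c. (\<forall>p\<in>U. (\<lambda>t. h (p(c := t))) differentiable (at (p c))) \<and> Ck_on k U (partial_deriv c h))"

definition depends_only :: "'c set \<Rightarrow> ('c \<Rightarrow> real) set \<Rightarrow> (('c \<Rightarrow> real) \<Rightarrow> real) \<Rightarrow> bool" where
  "depends_only C U h \<longleftrightarrow> (\<forall>p\<in>U. \<forall>q\<in>U. (\<forall>c\<in>C. p c = q c) \<longrightarrow> h p = h q)"

text \<open>
  \<open>h\<close> is a function of the coordinates \<open>C\<close> alone, smooth in a neighbourhood of \<open>p\<close>. Dependence on
  \<open>C\<close> alone is demanded everywhere, not only near \<open>p\<close>, so that \<open>h\<close> may be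
  evaluated at points whose coordinates outside \<open>C\<close> are arbitrary; a locally defined function of
  \<open>C\<close> can always be extended to one of this kind.
\<close>

definition smooth_fn :: "'c set \<Rightarrow> ('c \<Rightarrow> real) \<Rightarrow> (('c \<Rightarrow> real) \<Rightarrow> real) \<Rightarrow> bool" where
  "smooth_fn C p h \<longleftrightarrow> depends_only C UNIV h \<and> (\<exists>U. open U \<and> p \<in> U \<and> (\<forall>k. Ck_on k U h))"

definition locally_depends_only :: "'c set \<Rightarrow> ('c \<Rightarrow> real) \<Rightarrow> (('c \<Rightarrow> real) \<Rightarrow> real) \<Rightarrow> bool" where
  "locally_depends_only C p h \<longleftrightarrow> (\<exists>U. open U \<and> p \<in> U \<and> depends_only C U h)"

text \<open>
  The functions \<open>T b\<close> (\<open>b \<in> B\<close>) of the coordinates \<open>A\<close> are new coordinates in place of \<open>A\<close>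
  near \<open>p\<close>, with smooth inverse \<open>X\<close>. Values of \<open>T\<close> outside \<open>B\<close> and of \<open>X\<close> outside \<open>A\<close> are irrelevant.
\<close>

definition local_diffeo ::
  "'a set \<Rightarrow> 'b set \<Rightarrow> ('b \<Rightarrow> ('a \<Rightarrow> real) \<Rightarrow> real) \<Rightarrow> ('a \<Rightarrow> ('b \<Rightarrow> real) \<Rightarrow> real) \<Rightarrow> ('a \<Rightarrow> real) \<Rightarrow> bool"
where
  "local_diffeo A B T X p \<longleftrightarrow>
     (\<forall>b\<in>B. smooth_fn A p (T b)) \<and>
     (\<forall>a\<in>A. smooth_fn B (\<lambda>b. T b p) (X a)) \<and>
     (\<forall>\<^sub>F q in nhds p. \<forall>a\<in>A. X a (\<lambda>b. T b q) = q a) \<and>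
     (\<forall>\<^sub>F r in nhds (\<lambda>b. T b p). \<forall>b\<in>B. T b (\<lambda>a. X a r) = r b)"


section \<open>Control systems and time derivatives\<close>

text \<open>
  \<open>State s\<close> is a state variable, \<open>Input j \<alpha>\<close> the \<open>\<alpha>\<close>-th time derivative of the \<open>j\<close>-th input. A system
  is given by the finite set \<open>S\<close> of its state names and \<open>f\<close>, where \<open>f s\<close> is the
  time derivative of \<open>State s\<close>.
\<close>

datatype ('s, 'i) coord = State 's | Input 'i nat

type_synonym ('s, 'i) jet = "('s, 'i) coord \<Rightarrow> real"

definition state_coords :: "'s set \<Rightarrow> ('s, 'i) coord set" where
  "state_coords S = State ` S"

definition jet_coords :: "'s set \<Rightarrow> ('i \<Rightarrow> nat) \<Rightarrow> ('s, 'i) coord set" where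
  "jet_coords S Q = State ` S \<union> {Input j \<alpha> |j \<alpha>. \<alpha> \<le> Q j}"

abbreviation xu_coords :: "'s set \<Rightarrow> ('s, 'i) coord set" where
  "xu_coords S \<equiv> jet_coords S (\<lambda>_. 0)"

definition control_system ::
  "'s set \<Rightarrow> ('s \<Rightarrow> ('s, 'i) jet \<Rightarrow> real) \<Rightarrow> ('s, 'i) jet \<Rightarrow> bool"
where
  "control_system S f p \<longleftrightarrow> finite S \<and> (\<forall>s\<in>S. smooth_fn (xu_coords S) p (f s))"

text \<open>
  The derivation \<open>L\<close> along the vector field \<open>f\<^sub>u\<close>. For functions of finitely many coordinates the
  series has only finitely many nonzero terms.
\<close>

definition total_deriv ::
  "'s set \<Rightarrow> ('s \<Rightarrow> ('s, 'i::finite) jet \<Rightarrow> real) \<Rightarrow> (('s, 'i) jet \<Rightarrow> real) \<Rightarrow> ('s, 'i) jet \<Rightarrow> real"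
where
  "total_deriv S f h p =
     (\<Sum>s\<in>S. f s p * partial_deriv (State s) h p) +
     (\<Sum>\<alpha>. \<Sum>j\<in>UNIV. p (Input j (Suc \<alpha>)) * partial_deriv (Input j \<alpha>) h p)"

definition time_deriv ::
  "'s set \<Rightarrow> ('s \<Rightarrow> ('s, 'i::finite) jet \<Rightarrow> real) \<Rightarrow> nat \<Rightarrow> (('s, 'i) jet \<Rightarrow> real) \<Rightarrow> ('s, 'i) jet \<Rightarrow> real"
where
  "time_deriv S f \<alpha> h = (total_deriv S f ^^ \<alpha>) h"

definition relative_degree ::
  "'s set \<Rightarrow> ('s \<Rightarrow> ('s, 'i::finite) jet \<Rightarrow> real) \<Rightarrow> ('s, 'i) jet \<Rightarrow> (('s, 'i) jet \<Rightarrow> real) \<Rightarrow> nat \<Rightarrow> bool"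
where
  "relative_degree S f p h k \<longleftrightarrow>
     (k > 0 \<longrightarrow> locally_depends_only (state_coords S) p (time_deriv S f (k - 1) h)) \<and>
     locally_depends_only (xu_coords S) p (time_deriv S f k h) \<and>
     \<not> locally_depends_only (state_coords S) p (time_deriv S f k h)"


section \<open>Flat outputs\<close>

text \<open>The point with coordinates \<open>y\<^sup>j\<^sub>[\<^sub>\<alpha>\<^sub>]\<close>, named \<open>(j, \<alpha>)\<close>.\<close>

definition output_jet ::
  "'s set \<Rightarrow> ('s \<Rightarrow> ('s, 'i::finite) jet \<Rightarrow> real) \<Rightarrow> ('i \<Rightarrow> ('s, 'i) jet \<Rightarrow> real) \<Rightarrow>
   ('s, 'i) jet \<Rightarrow> ('i \<times> nat \<Rightarrow> real)"
where
  "output_jet S f \<phi> p = (\<lambda>(j, \<alpha>). time_deriv S f \<alpha> (\<phi> j) p)"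

definition differentially_independent ::
  "'s set \<Rightarrow> ('s \<Rightarrow> ('s, 'i::finite) jet \<Rightarrow> real) \<Rightarrow> ('s, 'i) jet \<Rightarrow> ('i \<Rightarrow> ('s, 'i) jet \<Rightarrow> real) \<Rightarrow> bool"
where
  "differentially_independent S f p \<phi> \<longleftrightarrow>
     (\<forall>\<beta>. \<forall>a :: 'i \<Rightarrow> nat \<Rightarrow> real.
        (\<forall>c. (\<Sum>j\<in>UNIV. \<Sum>\<alpha>\<le>\<beta>. a j \<alpha> * partial_deriv c (time_deriv S f \<alpha> (\<phi> j)) p) = 0)
        \<longrightarrow> (\<forall>j. \<forall>\<alpha>\<le>\<beta>. a j \<alpha> = 0))"

text \<open>
  Near \<open>p\<close>, \<open>\<phi>(x, u\<^sub>[\<^sub>0\<^sub>,\<^sub>Q\<^sub>])\<close> is a flat output, and \<open>R\<close> consists of the highest derivative orders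
  in \<open>x = Fx(y\<^sub>[\<^sub>0\<^sub>,\<^sub>R\<^sub>-\<^sub>1\<^sub>])\<close>, \<open>u = Fu(y\<^sub>[\<^sub>0\<^sub>,\<^sub>R\<^sub>])\<close>. The last conjunct says that each \<open>y\<^sup>j\<close> of order \<open>R j\<close>
  really occurs; together with the independence of the differentials it makes \<open>R\<close> unique.
\<close>

definition flat_output ::
  "'s set \<Rightarrow> ('s \<Rightarrow> ('s, 'i::finite) jet \<Rightarrow> real) \<Rightarrow> ('s, 'i) jet \<Rightarrow> ('i \<Rightarrow> nat) \<Rightarrow>
   ('i \<Rightarrow> ('s, 'i) jet \<Rightarrow> real) \<Rightarrow> ('i \<Rightarrow> nat) \<Rightarrow> bool"
where
  "flat_output S f p Q \<phi> R \<longleftrightarrow>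
     (\<forall>j. smooth_fn (jet_coords S Q) p (\<phi> j)) \<and>
     differentially_independent S f p \<phi> \<and>
     (\<exists>Fx Fu.
        (\<forall>s\<in>S. smooth_fn {(j, \<alpha>). \<alpha> < R j} (output_jet S f \<phi> p) (Fx s)) \<and>
        (\<forall>i. smooth_fn {(j, \<alpha>). \<alpha> \<le> R j} (output_jet S f \<phi> p) (Fu i)) \<and>
        (\<forall>\<^sub>F q in nhds p.
           (\<forall>s\<in>S. q (State s) = Fx s (output_jet S f \<phi> q)) \<and>
           (\<forall>i. q (Input i 0) = Fu i (output_jet S f \<phi> q))) \<and>
        (\<forall>j. \<exists>i. \<not> locally_depends_only ({(j', \<alpha>). \<alpha> \<le> R j'} - {(j, R j)})
                     (output_jet S f \<phi> p) (Fu i)))"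

definition diff_difference :: "'s set \<Rightarrow> ('i::finite \<Rightarrow> nat) \<Rightarrow> int" where
  "diff_difference S R = int (\<Sum>j\<in>UNIV. R j) - int (card S)"


section \<open>Static feedback\<close>

text \<open>
  \<open>with_inputs \<Phi> q\<close> keeps the state of \<open>q\<close> and has \<open>\<Phi> j q\<close> as \<open>j\<close>-th input; its remaining
  coordinates are never looked at.
\<close>

definition with_inputs :: "('i \<Rightarrow> ('s, 'i) jet \<Rightarrow> real) \<Rightarrow> ('s, 'i) coord \<Rightarrow> ('s, 'i) jet \<Rightarrow> real" where
  "with_inputs \<Phi> c q = (case c of State s \<Rightarrow> q (State s) | Input j \<alpha> \<Rightarrow> \<Phi> j q)"

text \<open>The new inputs are \<open>\<Phi>(x, u)\<close>; solving for \<open>u\<close> gives \<open>u = \<Psi>(x, \<Phi>(x, u))\<close>.\<close>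

definition input_transformation ::
  "'s set \<Rightarrow> ('s, 'i) jet \<Rightarrow> ('i \<Rightarrow> ('s, 'i) jet \<Rightarrow> real) \<Rightarrow> ('i \<Rightarrow> ('s, 'i) jet \<Rightarrow> real) \<Rightarrow> bool"
where
  "input_transformation S p \<Phi> \<Psi> \<longleftrightarrow>
     local_diffeo (xu_coords S) (xu_coords S) (with_inputs \<Phi>) (with_inputs \<Psi>) p"

text \<open>The right-hand side \<open>f(x, \<Psi>(x, w))\<close> after substituting \<open>u = \<Psi>(x, w)\<close>.\<close>

definition feedback ::
  "('s \<Rightarrow> ('s, 'i) jet \<Rightarrow> real) \<Rightarrow> ('i \<Rightarrow> ('s, 'i) jet \<Rightarrow> real) \<Rightarrow> 's \<Rightarrow> ('s, 'i) jet \<Rightarrow> real"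
where
  "feedback f \<Psi> s q = f s (\<lambda>c. with_inputs \<Psi> c q)"

text \<open>
  The state together with the functions \<open>\<Phi>\<close> and all their time derivatives along \<open>f\<close>. It
  translates jets of the original system into jets of the transformed one; the translation back
  is \<open>jet_map S (feedback f \<Psi>) \<Psi>\<close>.
\<close>

definition jet_map ::
  "'s set \<Rightarrow> ('s \<Rightarrow> ('s, 'i::finite) jet \<Rightarrow> real) \<Rightarrow> ('i \<Rightarrow> ('s, 'i) jet \<Rightarrow> real) \<Rightarrow>
   ('s, 'i) jet \<Rightarrow> ('s, 'i) jet"
where
  "jet_map S f \<Phi> q =
     (\<lambda>c. case c of State s \<Rightarrow> q (State s) | Input j \<alpha> \<Rightarrow> time_deriv S f \<alpha> (\<Phi> j) q)"

text \<open>
  Static feedback linearizability with linearizing output \<open>\<psi>\<close> near \<open>p\<close>: with \<open>\<zeta>\<^sup>j\<^sub>k = T (j, k)\<close>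
  (\<open>k < l j\<close>) as new state and \<open>w = \<Phi>(x, u)\<close>, i.e. \<open>u = \<Psi>(x, w)\<close>, as new input,
  the system consists of integrator chains of lengths \<open>l j\<close>, and \<open>\<psi>\<^sup>j\<close> is the head of the \<open>j\<close>-th
  chain. For \<open>l j = 0\<close> the chain is just \<open>\<psi>\<^sup>j = w\<^sup>j\<close>.
\<close>

definition SFL ::
  "'s set \<Rightarrow> ('s \<Rightarrow> ('s, 'i::finite) jet \<Rightarrow> real) \<Rightarrow> ('s, 'i) jet \<Rightarrow> ('i \<Rightarrow> ('s, 'i) jet \<Rightarrow> real) \<Rightarrow> bool"
where
  "SFL S f p \<psi> \<longleftrightarrow>
     (\<exists>l T X \<Phi> \<Psi>.
        local_diffeo (state_coords S) {(j, k). k < l j} T X p \<and>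
        input_transformation S p \<Phi> \<Psi> \<and>
        (\<forall>\<^sub>F q in nhds (jet_map S f \<Phi> p).
           (\<forall>j k. k < l j \<longrightarrow>
              total_deriv S (feedback f \<Psi>) (T (j, k)) q =
                (if Suc k < l j then T (j, Suc k) q else q (Input j 0))) \<and>
           (\<forall>j. \<psi> j (jet_map S (feedback f \<Psi>) \<Psi> q) =
                (if 0 < l j then T (j, 0) q else q (Input j 0)))))"


section \<open>Prolongation of inputs\<close>

text \<open>
  Prolonging the \<open>j\<close>-th input to order \<open>D j\<close> (not at all if \<open>D j = 0\<close>): \<open>Input j \<alpha>\<close> becomes a state
  for \<open>\<alpha> < D j\<close>, and \<open>Input j (D j)\<close> is the new input. Both systems have the same jets, up to
  renaming of coordinates.
\<close>

definition prolonged_states :: "'s set \<Rightarrow> ('i \<Rightarrow> nat) \<Rightarrow> ('s, 'i) coord set" where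
  "prolonged_states S D = State ` S \<union> {Input j \<alpha> |j \<alpha>. \<alpha> < D j}"

definition to_prolonged :: "('i \<Rightarrow> nat) \<Rightarrow> ('s, 'i) jet \<Rightarrow> (('s, 'i) coord, 'i) jet" where
  "to_prolonged D q = (\<lambda>c. case c of State c' \<Rightarrow> q c' | Input j \<alpha> \<Rightarrow> q (Input j (D j + \<alpha>)))"

definition from_prolonged :: "('i \<Rightarrow> nat) \<Rightarrow> (('s, 'i) coord, 'i) jet \<Rightarrow> ('s, 'i) jet" where
  "from_prolonged D e =
     (\<lambda>c. case c of
        State s \<Rightarrow> e (State (State s))
      | Input j \<alpha> \<Rightarrow> if \<alpha> < D j then e (State (Input j \<alpha>)) else e (Input j (\<alpha> - D j)))"

definition prolonged_dynamics ::
  "('s \<Rightarrow> ('s, 'i) jet \<Rightarrow> real) \<Rightarrow> ('i \<Rightarrow> nat) \<Rightarrow> ('s, 'i) coord \<Rightarrow> (('s, 'i) coord, 'i) jet \<Rightarrow> real"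
where
  "prolonged_dynamics f D c e =
     (case c of
        State s \<Rightarrow> f s (from_prolonged D e)
      | Input j \<alpha> \<Rightarrow> from_prolonged D e (Input j (Suc \<alpha>)))"

text \<open>
  After the input transformation \<open>\<Phi>\<close> (with inverse \<open>\<Psi>\<close>) and prolongation to order \<open>D\<close>, the system is
  SFL with the output \<open>\<phi>\<close>, expressed in the coordinates of the extended system.
\<close>

definition SFL_after_prolonging ::
  "'s set \<Rightarrow> ('s \<Rightarrow> ('s, 'i::finite) jet \<Rightarrow> real) \<Rightarrow> ('s, 'i) jet \<Rightarrow> ('i \<Rightarrow> ('s, 'i) jet \<Rightarrow> real) \<Rightarrow>
   ('i \<Rightarrow> ('s, 'i) jet \<Rightarrow> real) \<Rightarrow> ('i \<Rightarrow> ('s, 'i) jet \<Rightarrow> real) \<Rightarrow> ('i \<Rightarrow> nat) \<Rightarrow> bool"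
where
  "SFL_after_prolonging S f p \<phi> \<Phi> \<Psi> D \<longleftrightarrow>
     SFL (prolonged_states S D)
       (prolonged_dynamics (feedback f \<Psi>) D)
       (to_prolonged D (jet_map S f \<Phi> p))
       (\<lambda>j e. \<phi> j (jet_map S (feedback f \<Psi>) \<Psi> (from_prolonged D e)))"

text \<open>
  The prolonged inputs are those with \<open>D j > 0\<close>. \<open>R\<close>, and hence \<open>diff_difference S R\<close>, is
  determined by \<open>\<phi>\<close>.
\<close>

definition SFL_via_minimal_prolongations ::
  "'s set \<Rightarrow> ('s \<Rightarrow> ('s, 'i::finite) jet \<Rightarrow> real) \<Rightarrow> ('s, 'i) jet \<Rightarrow> ('i \<Rightarrow> ('s, 'i) jet \<Rightarrow> real) \<Rightarrow> bool"
where
  "SFL_via_minimal_prolongations S f p \<phi> \<longleftrightarrow>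
     (\<exists>Q R \<Phi> \<Psi> D.
        flat_output S f p Q \<phi> R \<and>
        input_transformation S p \<Phi> \<Psi> \<and>
        int (\<Sum>j\<in>UNIV. D j) = diff_difference S R \<and>
        SFL_after_prolonging S f p \<phi> \<Phi> \<Psi> D)"

end

theory Submission
  imports Defs
begin

text \<open>
  After the input transformation and prolongation to order \<open>D\<close>, let \<open>H\<close> send \<open>y\<^sub>[\<^sub>0\<^sub>,\<^sub>R\<^sub>-\<^sub>1\<^sub>]\<close> to the extended
  state by \<open>x = F\<^sub>x(y\<^sub>[\<^sub>0\<^sub>,\<^sub>R\<^sub>-\<^sub>1\<^sub>])\<close> and \<open>u\<^sub>1\<^sub>,\<^sub>[\<^sub>\<beta>\<^sub>] = y\<^sub>1\<^sub>,\<^sub>[\<^sub>K\<^sub>+\<^sub>\<beta>\<^sub>]\<close>. The hypothesis on the differential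
  difference says that this map is between spaces of equal dimension. Composed with the map that
  expresses \<open>y\<close> and its derivatives by the jets of the extended system, \<open>H\<close> becomes the projection to
  the extended state, so its Jacobian is invertible. By the inverse function theorem
  \<open>y\<^sub>[\<^sub>0\<^sub>,\<^sub>R\<^sub>-\<^sub>1\<^sub>]\<close> are coordinates on the extended state space, in which the system consists of
  integrator chains; the same argument one order higher turns \<open>y\<^sub>[\<^sub>R\<^sub>]\<close> into a static feedback.
\<close>

section \<open>Functions of named coordinates\<close>

text \<open>A point has infinitely many coordinates and lives in a product topology without a norm,
  so the calculus rests on continuous partial derivatives along coordinate lines, and inverses are
  found by exchanging one coordinate at a time. The main obstacle is that \<open>y\<close> and its
  derivatives, written in the extended system, a priori involve further input derivatives; they are
  not yet a map between the two spaces whose dimensions are compared. Therefore \<open>H\<close>,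
  which goes the other way and has a controlled domain, is the map that gets inverted. Applying its
  inverse to \<open>H\<close> after the jet expression of \<open>y\<close> then shows that this
  expression agrees near the base point with functions of the extended state, or of state and input
  at the next order. The rank condition enters through the existence of an admissible input
  transformation: it allows the given components to be completed by functions linear in the
  inputs.\<close>

text \<open>A basic open set of the product topology restricts only finitely many coordinates;
  taking the least of their radii turns every local statement into finitely many inequalities
  between reals.\<close>

lemma eventually_nhds_fun_iff:
  fixes x :: "'c \<Rightarrow> real"
  shows "eventually P (nhds x) \<longleftrightarrow>
    (\<exists>F e. finite F \<and> 0 < e \<and> (\<forall>y. (\<forall>c\<in>F. \<bar>y c - x c\<bar> < e) \<longrightarrow> P y))"
proof
  assume "eventually P (nhds x)"
  then obtain S where S: "open S" "x \<in> S" "\<forall>y\<in>S. P y"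
    unfolding eventually_nhds by blast
  then have "openin (product_topology (\<lambda>i. euclidean) UNIV) S"
    by (simp add: open_fun_def)
  from product_topology_open_contains_basis[OF this S(2)]
  obtain X where X: "x \<in> (\<Pi>\<^sub>E i\<in>UNIV. X i)" "\<And>i. open (X i)" "finite {i. X i \<noteq> UNIV}"
    "(\<Pi>\<^sub>E i\<in>UNIV. X i) \<subseteq> S" by auto
  define F where "F = {i. X i \<noteq> UNIV}"
  have "\<forall>i. \<exists>e>0. \<forall>t. \<bar>t - x i\<bar> < e \<longrightarrow> t \<in> X i"
    using X(1,2) by (fastforce simp: open_real PiE_iff)
  then obtain e where e: "\<And>i. e i > 0" "\<And>i t. \<bar>t - x i\<bar> < e i \<Longrightarrow> t \<in> X i" by metis
  define d where "d = Min (insert 1 (e ` F))"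
  have finF: "finite F" using X(3) by (simp add: F_def)
  have d: "d > 0" using finF e(1) by (auto simp: d_def)
  have d': "d \<le> e i" if "i \<in> F" for i using finF that by (auto simp: d_def)
  have "P y" if "\<forall>c\<in>F. \<bar>y c - x c\<bar> < d" for y
  proof -
    have "y i \<in> X i" for i
      using that d'[of i] e(2)[of "y i" i] by (cases "i \<in> F") (force simp: F_def)+
    then show ?thesis using X(4) S(3) by (auto simp: PiE_iff)
  qed
  then show "\<exists>F e. finite F \<and> 0 < e \<and> (\<forall>y. (\<forall>c\<in>F. \<bar>y c - x c\<bar> < e) \<longrightarrow> P y)"
    using finF d by blast
next
  assume "\<exists>F e. finite F \<and> 0 < e \<and> (\<forall>y. (\<forall>c\<in>F. \<bar>y c - x c\<bar> < e) \<longrightarrow> P y)"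
  then obtain F e where F: "finite F" "0 < e" "\<forall>y. (\<forall>c\<in>F. \<bar>y c - x c\<bar> < e) \<longrightarrow> P y" by blast
  have "\<forall>\<^sub>F y in nhds x. \<bar>y c - x c\<bar> < e" for c
  proof -
    have "continuous_on UNIV (\<lambda>y::'c \<Rightarrow> real. y c)"
      by (rule continuous_on_product_coordinates)
    then have "((\<lambda>y. y c) \<longlongrightarrow> x c) (nhds x)"
      unfolding continuous_on_def using tendsto_at_iff_tendsto_nhds[of "\<lambda>y. y c" x] by simp
    then show ?thesis using F(2) by (simp add: tendsto_iff dist_real_def)
  qed
  then have "\<forall>\<^sub>F y in nhds x. \<forall>c\<in>F. \<bar>y c - x c\<bar> < e"
    using F(1) by (simp add: eventually_ball_finite)
  then show "eventually P (nhds x)" by (rule eventually_mono) (use F(3) in blast)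
qed

lemma tendsto_fun_iff:
  fixes x :: "'c \<Rightarrow> real"
  shows "(g \<longlongrightarrow> x) F \<longleftrightarrow> (\<forall>c. ((\<lambda>t. g t c) \<longlongrightarrow> x c) F)"
proof
  assume g: "(g \<longlongrightarrow> x) F"
  show "\<forall>c. ((\<lambda>t. g t c) \<longlongrightarrow> x c) F"
  proof (intro allI tendstoI)
    fix c and e :: real assume "0 < e"
    then have "\<forall>\<^sub>F y in nhds x. \<bar>y c - x c\<bar> < e"
      by (auto simp: eventually_nhds_fun_iff intro!: exI[of _ "{c}"] exI[of _ e])
    then show "\<forall>\<^sub>F t in F. dist (g t c) (x c) < e"
      using filterlim_iff[THEN iffD1, OF g] by (auto simp: dist_real_def)
  qed
next
  assume g: "\<forall>c. ((\<lambda>t. g t c) \<longlongrightarrow> x c) F"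
  show "(g \<longlongrightarrow> x) F"
    unfolding filterlim_iff
  proof (intro allI impI)
    fix P assume "eventually P (nhds x)"
    then obtain A e where A: "finite A" "0 < e" "\<And>y. (\<forall>c\<in>A. \<bar>y c - x c\<bar> < e) \<Longrightarrow> P y"
      unfolding eventually_nhds_fun_iff by blast
    have "\<forall>\<^sub>F t in F. \<forall>c\<in>A. \<bar>g t c - x c\<bar> < e"
      using g A(1,2) by (intro eventually_ball_finite) (auto simp: tendsto_iff dist_real_def)
    then show "\<forall>\<^sub>F t in F. P (g t)" by (rule eventually_mono) (use A(3) in blast)
  qed
qed

lemma tendsto_fun_coord:
  "((\<lambda>q. q c) \<longlongrightarrow> p c) (nhds (p :: 'c \<Rightarrow> real))"
  using tendsto_fun_iff[of "\<lambda>q. q" p "nhds p"] by (simp add: filterlim_ident)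

lemma tendsto_fun_upd_line:
  "((\<lambda>t. p(c := t)) \<longlongrightarrow> p) (nhds ((p :: 'c \<Rightarrow> real) c))"
  unfolding tendsto_fun_iff
proof
  fix d
  show "((\<lambda>t. (p(c := t)) d) \<longlongrightarrow> p d) (nhds (p c))"
    by (cases "d = c") (simp_all add: filterlim_ident)
qed

lemma tendsto_fun_upd:
  fixes p :: "'c \<Rightarrow> real"
  assumes "(g \<longlongrightarrow> p) F" "(s \<longlongrightarrow> t) F"
  shows "((\<lambda>q. (g q)(c := s q)) \<longlongrightarrow> p(c := t)) F"
  using assms by (auto simp: tendsto_fun_iff)

lemma continuous_on_nhds_iff:
  assumes "open U"
  shows "continuous_on U h \<longleftrightarrow> (\<forall>p\<in>U. (h \<longlongrightarrow> h p) (nhds p))"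
  unfolding continuous_on_def tendsto_at_iff_tendsto_nhds[symmetric]
  by (auto simp: at_within_open[OF _ assms])

text \<open>Freezing the coordinates outside \<open>C\<close> at their values in \<open>p\<close> turns a local dependence on \<open>C\<close>
  alone into a global one.\<close>

definition freeze :: "'c set \<Rightarrow> ('c \<Rightarrow> real) \<Rightarrow> ('c \<Rightarrow> real) \<Rightarrow> 'c \<Rightarrow> real" where
  "freeze C p q = (\<lambda>c. if c \<in> C then q c else p c)"

lemma tendsto_freeze:
  "\<forall>c\<in>C. p c = q c \<Longrightarrow> (freeze C p \<longlongrightarrow> p) (nhds q)"
  unfolding tendsto_fun_iff freeze_def
proof
  fix c
  assume "\<forall>c\<in>C. p c = q c"
  then show "((\<lambda>q. if c \<in> C then q c else p c) \<longlongrightarrow> p c) (nhds q)"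
    using tendsto_fun_coord[of c q] by (cases "c \<in> C") simp_all
qed

lemma tendsto_freeze': "(freeze C p \<longlongrightarrow> freeze C p q) (nhds q)"
  unfolding tendsto_fun_iff freeze_def by (auto intro!: tendsto_fun_coord)

lemma depends_only_freeze: "depends_only C UNIV h \<Longrightarrow> h (freeze C p q) = h q"
  unfolding depends_only_def freeze_def by auto

lemma depends_onlyD: "depends_only C UNIV h \<Longrightarrow> (\<And>c. c \<in> C \<Longrightarrow> p c = q c) \<Longrightarrow> h p = h q"
  unfolding depends_only_def by blast

lemma depends_only_mono: "depends_only C U h \<Longrightarrow> C \<subseteq> C' \<Longrightarrow> depends_only C' U h"
  unfolding depends_only_def by blast

text \<open>Freezing the coordinates outside \<open>C\<close> at \<open>p\<close> tends to
  \<open>p\<close> near \<open>p'\<close>, and \<open>P\<close> cannot see the difference. This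
  moves local statements between base points that share only the relevant coordinates.\<close>

lemma eventually_nhds_agree:
  fixes p p' :: "'c \<Rightarrow> real"
  assumes "eventually P (nhds p)" "\<forall>c\<in>C. p c = p' c"
    "\<And>q q'. (\<And>c. c \<in> C \<Longrightarrow> q c = q' c) \<Longrightarrow> P q \<Longrightarrow> P q'"
  shows "eventually P (nhds p')"
  using eventually_compose_filterlim[OF assms(1) tendsto_freeze[OF assms(2)]]
  by (rule eventually_mono) (erule assms(3)[rotated], auto simp: freeze_def)

section \<open>Partial derivatives and dependence on coordinates\<close>

lemma partial_derivI:
  "((\<lambda>t. h (p(c := t))) has_real_derivative D) (at (p c)) \<Longrightarrow> partial_deriv c h p = D"
  unfolding partial_deriv_def by (rule DERIV_imp_deriv)

lemma partial_deriv_cong_ev: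
  assumes "\<forall>\<^sub>F q in nhds p. h q = h' q"
  shows "partial_deriv c h p = partial_deriv c h' p"
  unfolding partial_deriv_def
  by (rule deriv_cong_ev[OF eventually_compose_filterlim[OF assms tendsto_fun_upd_line] refl])

lemma partial_deriv_coord: "partial_deriv c (\<lambda>q. q d) p = (if c = d then 1 else 0)"
  by (rule partial_derivI) auto

lemma partial_deriv_indep:
  "depends_only C UNIV h \<Longrightarrow> c \<notin> C \<Longrightarrow> partial_deriv c h p = 0"
proof (rule partial_derivI)
  assume h: "depends_only C UNIV h" "c \<notin> C"
  have "(\<lambda>t. h (p(c := t))) = (\<lambda>t. h p)"
    by (rule ext, rule depends_onlyD[OF h(1)]) (use h(2) in auto)
  then show "((\<lambda>t. h (p(c := t))) has_real_derivative 0) (at (p c))" by simp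
qed

lemma depends_only_partial_deriv:
  assumes "depends_only C UNIV h"
  shows "depends_only C UNIV (partial_deriv c h)"
proof (cases "c \<in> C")
  case True
  show ?thesis
    unfolding depends_only_def partial_deriv_def
  proof (intro ballI impI)
    fix p q :: "'a \<Rightarrow> real"
    assume pq: "\<forall>c\<in>C. p c = q c"
    then have "(\<lambda>t. h (p(c := t))) = (\<lambda>t. h (q(c := t)))"
      by (intro ext depends_onlyD[OF assms]) auto
    with pq True show "deriv (\<lambda>t. h (p(c := t))) (p c) = deriv (\<lambda>t. h (q(c := t))) (q c)"
      by simp
  qed
next
  case False
  then show ?thesis
    by (auto simp: depends_only_def partial_deriv_indep[OF assms])
qed

section \<open>Calculus of k times continuously differentiable functions\<close>

lemma Ck_on_continuous: "Ck_on k U h \<Longrightarrow> continuous_on U h"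
  by (cases k) auto

lemma Ck_on_subset: "Ck_on k U h \<Longrightarrow> V \<subseteq> U \<Longrightarrow> Ck_on k V h"
proof (induction k arbitrary: h)
  case 0
  then show ?case using continuous_on_subset[of U h V] by simp
next
  case (Suc k)
  then show ?case using continuous_on_subset[of U h V] unfolding Ck_on.simps by blast
qed

lemma Ck_on_Suc_imp: "Ck_on (Suc k) U h \<Longrightarrow> Ck_on k U h"
  by (induction k arbitrary: h) auto

lemma Ck_on_SucD:
  assumes "Ck_on (Suc k) U h"
  shows "\<And>p. p \<in> U \<Longrightarrow> ((\<lambda>t. h (p(c := t))) has_real_derivative partial_deriv c h p) (at (p c))"
    and "Ck_on k U (partial_deriv c h)"
  using assms by (auto simp: partial_deriv_def DERIV_deriv_iff_real_differentiable)

lemma eventually_eq_open: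
  "open U \<Longrightarrow> p \<in> U \<Longrightarrow> (\<And>q. q \<in> U \<Longrightarrow> P q) \<Longrightarrow> eventually P (nhds p)"
  unfolding eventually_nhds by blast

lemma Ck_on_SucI':
  assumes "continuous_on U h"
    "\<And>c p. p \<in> U \<Longrightarrow> ((\<lambda>t. h (p(c := t))) has_real_derivative D c p) (at (p c))"
    "\<And>c. Ck_on k U (partial_deriv c h)"
  shows "Ck_on (Suc k) U h"
proof -
  have "(\<lambda>t. h (p(c := t))) differentiable (at (p c))" if "p \<in> U" for c p
    using assms(2)[OF that, of c] unfolding real_differentiable_def by (rule exI)
  then show ?thesis using assms(1,3) by simp
qed

lemma Ck_on_cong:
  assumes "open U" "\<And>q. q \<in> U \<Longrightarrow> h q = h' q" "Ck_on k U h"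
  shows "Ck_on k U h'"
  using assms(2,3)
proof (induction k arbitrary: h h')
  case 0
  show ?case unfolding Ck_on.simps
    by (rule continuous_on_eq[OF Ck_on_continuous[OF 0(2)] 0(1)])
next
  case (Suc k)
  have ev: "\<forall>\<^sub>F q in nhds p. h q = h' q" if "p \<in> U" for p
    by (rule eventually_eq_open[OF assms(1) that]) (rule Suc.prems(1))
  show ?case
  proof (rule Ck_on_SucI'[where D="\<lambda>c. partial_deriv c h"])
    show "continuous_on U h'"
      by (rule continuous_on_eq[OF Ck_on_continuous[OF Suc.prems(2)] Suc.prems(1)])
    show "Ck_on k U (partial_deriv c h')" for c
      by (rule Suc.IH[OF _ Ck_on_SucD(2)[OF Suc.prems(2)]]) (rule partial_deriv_cong_ev[OF ev])
    fix c p assume p: "p \<in> U"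
    show "((\<lambda>t. h' (p(c := t))) has_real_derivative partial_deriv c h p) (at (p c))"
      by (rule DERIV_cong_ev[THEN iffD1, OF refl _ refl Ck_on_SucD(1)[OF Suc.prems(2) p]])
        (rule eventually_compose_filterlim[OF ev[OF p] tendsto_fun_upd_line])
  qed
qed

text \<open>Lets an explicit formula \<open>D\<close> stand for the partial derivatives: both agree
  on the open set \<open>U\<close>, so regularity passes from one to the other.\<close>

lemma Ck_on_SucI:
  assumes "open U" "continuous_on U h"
    "\<And>c p. p \<in> U \<Longrightarrow> ((\<lambda>t. h (p(c := t))) has_real_derivative D c p) (at (p c))"
    "\<And>c. Ck_on k U (D c)"
  shows "Ck_on (Suc k) U h"
  by (rule Ck_on_SucI'[OF assms(2,3)], assumption,
      rule Ck_on_cong[OF assms(1) _ assms(4)], rule partial_derivI[OF assms(3), symmetric])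

lemma Ck_on_const: "open U \<Longrightarrow> Ck_on k U (\<lambda>q. a)"
proof (induction k arbitrary: a)
  case (Suc k)
  show ?case by (rule Ck_on_SucI[OF Suc.prems, where D="\<lambda>c q. 0"]) (auto intro: Suc)
qed auto

lemma continuous_on_fun_coord: "continuous_on U (\<lambda>q::'c \<Rightarrow> real. q c)"
  by (rule continuous_on_subset[OF continuous_on_product_coordinates subset_UNIV])

lemma Ck_on_coord: "open U \<Longrightarrow> Ck_on k U (\<lambda>q. q d)"
proof (cases k)
  case (Suc k')
  assume U: "open U"
  show ?thesis unfolding Suc
    by (rule Ck_on_SucI[OF U, where D="\<lambda>c q. if c = d then 1 else 0"])
      (auto simp: continuous_on_fun_coord intro!: Ck_on_const[OF U])
qed (simp add: continuous_on_fun_coord)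

lemma Ck_on_add:
  assumes "open U" "Ck_on k U g" "Ck_on k U h"
  shows "Ck_on k U (\<lambda>q. g q + h q)"
  using assms(2,3)
proof (induction k arbitrary: g h)
  case (Suc k)
  show ?case
  proof (rule Ck_on_SucI[OF assms(1), where D="\<lambda>c q. partial_deriv c g q + partial_deriv c h q"])
    show "continuous_on U (\<lambda>q. g q + h q)"
      using Suc.prems by (intro continuous_on_add Ck_on_continuous)
    show "Ck_on k U (\<lambda>q. partial_deriv c g q + partial_deriv c h q)" for c
      by (intro Suc.IH Suc.prems[THEN Ck_on_SucD(2)])
    show "((\<lambda>t. g (p(c := t)) + h (p(c := t))) has_real_derivative
        partial_deriv c g p + partial_deriv c h p) (at (p c))" if "p \<in> U" for c p
      by (intro DERIV_add Suc.prems[THEN Ck_on_SucD(1)] that)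
  qed
qed (auto intro: continuous_on_add)

lemma Ck_on_mult:
  assumes "open U" "Ck_on k U g" "Ck_on k U h"
  shows "Ck_on k U (\<lambda>q. g q * h q)"
  using assms(2,3)
proof (induction k arbitrary: g h)
  case (Suc k)
  show ?case
  proof (rule Ck_on_SucI[OF assms(1), where D="\<lambda>c q. partial_deriv c g q * h q + g q * partial_deriv c h q"])
    show "continuous_on U (\<lambda>q. g q * h q)"
      using Suc.prems by (intro continuous_on_mult Ck_on_continuous)
    show "Ck_on k U (\<lambda>q. partial_deriv c g q * h q + g q * partial_deriv c h q)" for c
      using Suc.prems[THEN Ck_on_Suc_imp] Suc.prems[THEN Ck_on_SucD(2)]
      by (intro Ck_on_add Suc.IH assms(1))
    fix c p assume "p \<in> U"
    from DERIV_mult[OF Ck_on_SucD(1)[OF Suc.prems(1) this, of c] Ck_on_SucD(1)[OF Suc.prems(2) this, of c]]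
    show "((\<lambda>t. g (p(c := t)) * h (p(c := t))) has_real_derivative
        partial_deriv c g p * h p + g p * partial_deriv c h p) (at (p c))"
      by (rule DERIV_cong) (simp add: algebra_simps)
  qed
qed (auto intro: continuous_on_mult)

lemma Ck_on_sum:
  "open U \<Longrightarrow> (\<And>i. i \<in> I \<Longrightarrow> Ck_on k U (g i)) \<Longrightarrow> Ck_on k U (\<lambda>q. \<Sum>i\<in>I. g i q)"
  by (induction I rule: infinite_finite_induct) (auto intro: Ck_on_const Ck_on_add)

lemma Ck_on_inverse:
  assumes "open U" "Ck_on k U g" "\<And>q. q \<in> U \<Longrightarrow> g q \<noteq> 0"
  shows "Ck_on k U (\<lambda>q. inverse (g q))"
  using assms(2)
proof (induction k)
  case (Suc k)
  show ?case
  proof (rule Ck_on_SucI[OF assms(1), where D="\<lambda>c q. (-1) * (partial_deriv c g q * (inverse (g q) * inverse (g q)))"])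
    show "continuous_on U (\<lambda>q. inverse (g q))"
      using Ck_on_continuous[OF Suc.prems] assms(3) by (intro continuous_on_inverse) auto
    show "Ck_on k U (\<lambda>q. (-1) * (partial_deriv c g q * (inverse (g q) * inverse (g q))))" for c
      by (intro Ck_on_mult Ck_on_const Suc.IH assms(1) Suc.prems[THEN Ck_on_SucD(2)]
          Suc.prems[THEN Ck_on_Suc_imp])
    fix c p assume p: "p \<in> U"
    from DERIV_inverse'[OF Ck_on_SucD(1)[OF Suc.prems p, of c]]
    show "((\<lambda>t. inverse (g (p(c := t)))) has_real_derivative
        (-1) * (partial_deriv c g p * (inverse (g p) * inverse (g p)))) (at (p c))"
      by (rule DERIV_cong) (use assms(3)[OF p] in \<open>simp_all add: algebra_simps\<close>)
  qed
next
  case 0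
  then show ?case using assms(3) by (auto intro!: continuous_on_inverse)
qed

section \<open>Mean value theorem and chain rule\<close>

text \<open>The order of \<open>u\<close> and \<open>v\<close> is left open and equality is allowed,
  with closed bounds on \<open>z\<close>, because the end points will vary along a filter.\<close>

lemma mvt_segment:
  fixes f :: "real \<Rightarrow> real"
  assumes "\<And>x. min u v \<le> x \<Longrightarrow> x \<le> max u v \<Longrightarrow> (f has_real_derivative f' x) (at x)"
  shows "\<exists>z. min u v \<le> z \<and> z \<le> max u v \<and> f v - f u = f' z * (v - u)"
proof (cases u v rule: linorder_cases)
  case less
  from MVT2[OF this, of f f'] obtain z where "u < z" "z < v" "f v - f u = (v - u) * f' z"
    using assms less by auto
  then show ?thesis using less by (intro exI[of _ z]) (auto simp: min_def max_def)
next
  case equal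
  then show ?thesis by auto
next
  case greater
  from MVT2[OF this, of f f'] obtain z where "v < z" "z < u" "f u - f v = (u - v) * f' z"
    using assms greater by auto
  then show ?thesis using greater
    by (intro exI[of _ z]) (auto simp: min_def max_def algebra_simps)
qed

text \<open>The mean value theorem in the coordinate \<open>c\<close>, with the base point and both
  ends tending to \<open>x\<close>. The factor \<open>D\<close> replaces the difference quotient but
  stays meaningful where \<open>u s = v s\<close>; its limit comes from the continuity of the
  partial derivative. It drives both the chain rule and the differentiation of implicit
  functions.\<close>

lemma partial_increment:
  fixes q :: "'a \<Rightarrow> 'c \<Rightarrow> real"
  assumes "open U" "x \<in> U" "Ck_on (Suc 0) U h"
    and q: "(q \<longlongrightarrow> x) F" and u: "(u \<longlongrightarrow> x c) F" and v: "(v \<longlongrightarrow> x c) F"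
  obtains D where "(D \<longlongrightarrow> partial_deriv c h x) F"
    "\<forall>\<^sub>F s in F. h ((q s)(c := v s)) - h ((q s)(c := u s)) = D s * (v s - u s)"
proof -
  have "eventually (\<lambda>y. y \<in> U) (nhds x)" by (rule eventually_eq_open[OF assms(1,2)])
  then obtain A e where A: "finite A" "0 < e" "\<And>y. (\<forall>d\<in>A. \<bar>y d - x d\<bar> < e) \<Longrightarrow> y \<in> U"
    unfolding eventually_nhds_fun_iff by blast
  define good where "good s \<longleftrightarrow> (\<forall>d\<in>A. \<bar>q s d - x d\<bar> < e) \<and> \<bar>u s - x c\<bar> < e \<and> \<bar>v s - x c\<bar> < e" for s
  have "\<forall>\<^sub>F s in F. \<bar>q s d - x d\<bar> < e" for d
    using q A(2) unfolding tendsto_fun_iff by (auto simp: tendsto_iff dist_real_def)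
  then have good: "eventually good F"
    unfolding good_def using u v A(1,2)
    by (intro eventually_conj eventually_ball_finite) (auto simp: tendsto_iff dist_real_def)
  have inU: "(q s)(c := z) \<in> U" if "good s" "min (u s) (v s) \<le> z" "z \<le> max (u s) (v s)" for s z
    using that by (intro A(3)) (auto simp: good_def)
  \<comment> \<open>The bounds on \<open>z\<close> are claimed for every \<open>s\<close> and only
    the mean value identity is conditional, so that \<open>z\<close> can be chosen as a total
    function and squeezed without restriction.\<close>
  have "\<exists>z. min (u s) (v s) \<le> z \<and> z \<le> max (u s) (v s) \<and> (good s \<longrightarrow>
      h ((q s)(c := v s)) - h ((q s)(c := u s)) = partial_deriv c h ((q s)(c := z)) * (v s - u s))" for s
  proof (cases "good s")
    case True
    have "((\<lambda>t. h ((q s)(c := t))) has_real_derivative partial_deriv c h ((q s)(c := z))) (at z)"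
      if "min (u s) (v s) \<le> z" "z \<le> max (u s) (v s)" for z
      using Ck_on_SucD(1)[OF assms(3) inU[OF True that], of c] by simp
    from mvt_segment[OF this] show ?thesis by blast
  qed auto
  then obtain z where z: "\<And>s. min (u s) (v s) \<le> z s" "\<And>s. z s \<le> max (u s) (v s)"
    "\<And>s. good s \<Longrightarrow>
      h ((q s)(c := v s)) - h ((q s)(c := u s)) = partial_deriv c h ((q s)(c := z s)) * (v s - u s)"
    by metis
  have "(z \<longlongrightarrow> x c) F"
    by (rule tendsto_sandwich[where f="\<lambda>s. min (u s) (v s)" and h="\<lambda>s. max (u s) (v s)"])
      (use z tendsto_min[OF u v] tendsto_max[OF u v] in auto)
  from tendsto_fun_upd[OF q this, of c] have "((\<lambda>s. (q s)(c := z s)) \<longlongrightarrow> x) F" by simp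
  moreover have "(partial_deriv c h \<longlongrightarrow> partial_deriv c h x) (nhds x)"
    using Ck_on_continuous[OF Ck_on_SucD(2)[OF assms(3), of c]] assms(1,2)
    by (simp add: continuous_on_nhds_iff)
  ultimately have "((\<lambda>s. partial_deriv c h ((q s)(c := z s))) \<longlongrightarrow> partial_deriv c h x) F"
    by (rule filterlim_compose[rotated])
  then show thesis
  proof (rule that)
    show "\<forall>\<^sub>F s in F. h ((q s)(c := v s)) - h ((q s)(c := u s)) =
        partial_deriv c h ((q s)(c := z s)) * (v s - u s)"
      using good by (rule eventually_mono) (rule z(3))
  qed
qed

text \<open>Coordinates of \<open>C\<close> are released onto the curve one at a time. Each release
  changes \<open>h\<close> by an increment in a single coordinate, to which
  \<open>partial_increment\<close> applies; coordinates outside \<open>C\<close> stay fixed, unseen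
  by \<open>h\<close>. No total differential is needed.\<close>

lemma chain_rule_curve:
  assumes "finite C" "depends_only C UNIV h" "open U" "Ck_on (Suc 0) U h"
    and "(\<lambda>c. \<gamma> c s) \<in> U"
    and \<gamma>: "\<And>c. c \<in> C \<Longrightarrow> (\<gamma> c has_real_derivative D c) (at s)"
  shows "((\<lambda>t. h (\<lambda>c. \<gamma> c t)) has_real_derivative
    (\<Sum>c\<in>C. partial_deriv c h (\<lambda>c. \<gamma> c s) * D c)) (at s)"
proof -
  define x where "x = (\<lambda>c. \<gamma> c s)"
  \<comment> \<open>Follows the curve in the coordinates from \<open>B\<close> and rests at the base
    point in all others.\<close>
  define \<sigma> where "\<sigma> B t = (\<lambda>c. if c \<in> B then \<gamma> c t else x c)" for B t
  have cont: "(\<gamma> c \<longlongrightarrow> x c) (at s)" if "c \<in> C" for c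
    using DERIV_isCont[OF \<gamma>[OF that]] by (simp add: x_def isCont_def)
  have "((\<lambda>t. h (\<sigma> B t)) has_real_derivative (\<Sum>c\<in>B. partial_deriv c h x * D c)) (at s)"
    if "finite B" "B \<subseteq> C" for B
    using that
  proof (induction B rule: finite_induct)
    case empty
    then show ?case by (simp add: \<sigma>_def)
  next
    case (insert c B)
    have "(\<sigma> B \<longlongrightarrow> x) (at s)"
      unfolding tendsto_fun_iff
    proof
      fix d
      show "((\<lambda>t. \<sigma> B t d) \<longlongrightarrow> x d) (at s)"
        using cont[of d] insert.prems by (cases "d \<in> B") (auto simp: \<sigma>_def)
    qed
    from partial_increment[OF assms(3) _ assms(4) this, of "\<lambda>_. x c" c "\<gamma> c"]
    obtain E where E: "(E \<longlongrightarrow> partial_deriv c h x) (at s)"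
      "\<forall>\<^sub>F t in at s. h ((\<sigma> B t)(c := \<gamma> c t)) - h ((\<sigma> B t)(c := x c)) = E t * (\<gamma> c t - x c)"
      using assms(5) cont[of c] insert.prems by (auto simp: x_def)
    have "((\<lambda>t. h ((\<sigma> B t)(c := \<gamma> c t)) - h ((\<sigma> B t)(c := x c))) has_real_derivative
        partial_deriv c h x * D c) (at s)"
      unfolding has_field_derivative_iff
    proof (rule Lim_transform_eventually)
      show "((\<lambda>t. E t * ((\<gamma> c t - \<gamma> c s) / (t - s))) \<longlongrightarrow> partial_deriv c h x * D c) (at s)"
        using \<gamma>[of c] insert.prems unfolding has_field_derivative_iff by (intro tendsto_mult E) auto
      have "(\<sigma> B s)(c := \<gamma> c s) = (\<sigma> B s)(c := x c)" by (simp add: x_def)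
      then show "\<forall>\<^sub>F t in at s. E t * ((\<gamma> c t - \<gamma> c s) / (t - s)) =
        (h ((\<sigma> B t)(c := \<gamma> c t)) - h ((\<sigma> B t)(c := x c)) -
         (h ((\<sigma> B s)(c := \<gamma> c s)) - h ((\<sigma> B s)(c := x c)))) / (t - s)"
        by (intro eventually_mono[OF E(2)]) (simp add: x_def)
    qed
    moreover have "(\<sigma> B t)(c := \<gamma> c t) = \<sigma> (insert c B) t" "(\<sigma> B t)(c := x c) = \<sigma> B t" for t
      using insert.hyps by (auto simp: \<sigma>_def)
    ultimately have "((\<lambda>t. h (\<sigma> (insert c B) t) - h (\<sigma> B t)) has_real_derivative
        partial_deriv c h x * D c) (at s)" by simp
    from DERIV_add[OF this insert.IH] show ?case
      using insert by simp
  qed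
  from this[OF assms(1) subset_refl] show ?thesis
    using depends_onlyD[OF assms(2), of "\<sigma> C t" "\<lambda>c. \<gamma> c t" for t]
    unfolding x_def by (simp add: \<sigma>_def)
qed

lemma has_partial_deriv_compose:
  assumes "finite C" "depends_only C UNIV h" "open U" "Ck_on (Suc 0) U h"
    and "(\<lambda>c. N c q) \<in> U" "q \<in> V" "\<And>c. c \<in> C \<Longrightarrow> Ck_on (Suc 0) V (N c)"
  shows "((\<lambda>t. h (\<lambda>c. N c (q(d := t)))) has_real_derivative
    (\<Sum>c\<in>C. partial_deriv c h (\<lambda>c. N c q) * partial_deriv d (N c) q)) (at (q d))"
  using chain_rule_curve[OF assms(1-4), of "\<lambda>c t. N c (q(d := t))" "q d" "\<lambda>c. partial_deriv d (N c) q"]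
    assms(5) Ck_on_SucD(1)[OF assms(7) assms(6)] by simp

lemma Ck_on_1: "Ck_on (Suc k) U h \<Longrightarrow> Ck_on (Suc 0) U h"
  by (induction k) (auto dest: Ck_on_Suc_imp simp del: Ck_on.simps)

text \<open>By the chain rule a partial derivative of the composite is a sum of products of
  functions of order \<open>k\<close>, so the induction must run over all \<open>h\<close> at
  once.\<close>

lemma Ck_on_compose_UNIV:
  assumes "finite C" "depends_only C UNIV h" "open U" "open V" "Ck_on k U h"
    "\<And>c. Ck_on k V (N c)" "\<And>q. q \<in> V \<Longrightarrow> (\<lambda>c. N c q) \<in> U"
  shows "Ck_on k V (\<lambda>q. h (\<lambda>c. N c q))"
  using assms(2,5,6)
proof (induction k arbitrary: h)
  case 0
  show ?case
    unfolding Ck_on.simps continuous_on_nhds_iff[OF assms(4)]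
  proof
    fix q assume q: "q \<in> V"
    have "((\<lambda>q. (\<lambda>c. N c q)) \<longlongrightarrow> (\<lambda>c. N c q)) (nhds q)"
      unfolding tendsto_fun_iff using 0(3) q by (auto simp: continuous_on_nhds_iff[OF assms(4)])
    moreover have "(h \<longlongrightarrow> h (\<lambda>c. N c q)) (nhds (\<lambda>c. N c q))"
      using 0(2) assms(7)[OF q] by (simp add: continuous_on_nhds_iff[OF assms(3)])
    ultimately show "((\<lambda>q. h (\<lambda>c. N c q)) \<longlongrightarrow> h (\<lambda>c. N c q)) (nhds q)"
      by (rule filterlim_compose[rotated])
  qed
next
  case (Suc k)
  show ?case
  proof (rule Ck_on_SucI[OF assms(4)])
    show "continuous_on V (\<lambda>q. h (\<lambda>c. N c q))"
      using Suc.IH[OF Suc.prems(1) Ck_on_Suc_imp[OF Suc.prems(2)] Ck_on_Suc_imp[OF Suc.prems(3)]]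
      by (rule Ck_on_continuous)
    show "((\<lambda>t. h (\<lambda>c. N c (q(d := t)))) has_real_derivative
      (\<Sum>c\<in>C. partial_deriv c h (\<lambda>c. N c q) * partial_deriv d (N c) q)) (at (q d))"
      if "q \<in> V" for q d
      by (rule has_partial_deriv_compose[OF assms(1) Suc.prems(1) assms(3) Ck_on_1[OF Suc.prems(2)]
            assms(7)[OF that] that Ck_on_1[OF Suc.prems(3)]])
    show "Ck_on k V (\<lambda>q. \<Sum>c\<in>C. partial_deriv c h (\<lambda>c. N c q) * partial_deriv d (N c) q)" for d
    proof (rule Ck_on_sum[OF assms(4)], rule Ck_on_mult[OF assms(4)])
      show "Ck_on k V (\<lambda>q. partial_deriv c h (\<lambda>c. N c q))" for c
        by (rule Suc.IH[OF depends_only_partial_deriv[OF Suc.prems(1)]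
              Ck_on_SucD(2)[OF Suc.prems(2)] Ck_on_Suc_imp[OF Suc.prems(3)]])
      show "Ck_on k V (partial_deriv d (N c))" for c
        by (rule Ck_on_SucD(2)[OF Suc.prems(3)])
    qed
  qed
qed

section \<open>Germs of smooth functions\<close>

text \<open>Only the local half of \<open>smooth_fn\<close>: unlike the global dependence on
  \<open>C\<close>, it survives a change of the function away from \<open>p\<close>.\<close>

definition smooth_at :: "('c \<Rightarrow> real) \<Rightarrow> (('c \<Rightarrow> real) \<Rightarrow> real) \<Rightarrow> bool" where
  "smooth_at p h \<longleftrightarrow> (\<exists>U. open U \<and> p \<in> U \<and> (\<forall>k. Ck_on k U h))"

lemma smooth_fn_iff: "smooth_fn C p h \<longleftrightarrow> depends_only C UNIV h \<and> smooth_at p h"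
  by (simp add: smooth_fn_def smooth_at_def)

lemma smooth_fn_smooth_at: "smooth_fn C p h \<Longrightarrow> smooth_at p h"
  and smooth_fn_depends_only: "smooth_fn C p h \<Longrightarrow> depends_only C UNIV h"
  by (simp_all add: smooth_fn_iff)

lemma smooth_fn_mono: "smooth_fn C p h \<Longrightarrow> C \<subseteq> C' \<Longrightarrow> smooth_fn C' p h"
  using depends_only_mono by (auto simp: smooth_fn_iff)

lemma smooth_at_cong_ev:
  assumes "\<forall>\<^sub>F q in nhds p. h q = h' q" "smooth_at p h"
  shows "smooth_at p h'"
proof -
  obtain U where U: "open U" "p \<in> U" "\<And>k. Ck_on k U h"
    using assms(2) unfolding smooth_at_def by blast
  obtain V where V: "open V" "p \<in> V" "\<And>q. q \<in> V \<Longrightarrow> h q = h' q"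
    using assms(1) unfolding eventually_nhds by blast
  have "Ck_on k (U \<inter> V) h'" for k
    by (rule Ck_on_cong[where h=h]) (use U V Ck_on_subset[OF U(3)] in auto)
  then show ?thesis unfolding smooth_at_def using U V by (intro exI[of _ "U \<inter> V"]) auto
qed

lemma smooth_at_const: "smooth_at p (\<lambda>q. a)"
  unfolding smooth_at_def by (intro exI[of _ UNIV]) (auto intro: Ck_on_const)

lemma smooth_at_coord: "smooth_at p (\<lambda>q. q d)"
  unfolding smooth_at_def by (intro exI[of _ UNIV]) (auto intro: Ck_on_coord)

lemma smooth_at_common:
  assumes "finite I" "\<And>i. i \<in> I \<Longrightarrow> smooth_at p (g i)"
  obtains U where "open U" "p \<in> U" "\<And>i k. i \<in> I \<Longrightarrow> Ck_on k U (g i)"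
proof -
  obtain U where U: "\<And>i. i \<in> I \<Longrightarrow> open (U i)" "\<And>i. i \<in> I \<Longrightarrow> p \<in> U i"
    "\<And>i k. i \<in> I \<Longrightarrow> Ck_on k (U i) (g i)"
    using assms(2) unfolding smooth_at_def by metis
  show thesis
  proof (rule that)
    show "open (\<Inter>i\<in>I. U i)" using U(1) assms(1) by auto
    show "p \<in> (\<Inter>i\<in>I. U i)" using U(2) by auto
    show "Ck_on k (\<Inter>i\<in>I. U i) (g i)" if "i \<in> I" for i k
      by (rule Ck_on_subset[OF U(3)[OF that]]) (use that in auto)
  qed
qed

lemma smooth_at_mult:
  assumes "smooth_at p g" "smooth_at p h"
  shows "smooth_at p (\<lambda>q. g q * h q)"
proof -
  obtain U where U: "open U" "p \<in> U" "\<And>i k. Ck_on k U (if i then g else h)"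
    by (rule smooth_at_common[of "UNIV :: bool set" p "\<lambda>i. if i then g else h"])
      (use assms in auto)
  show ?thesis
    unfolding smooth_at_def using U(1,2) Ck_on_mult[OF U(1) U(3)[of _ True] U(3)[of _ False]]
    by auto
qed

lemma smooth_at_sum:
  assumes "finite I" "\<And>i. i \<in> I \<Longrightarrow> smooth_at p (g i)"
  shows "smooth_at p (\<lambda>q. \<Sum>i\<in>I. g i q)"
proof -
  obtain U where "open U" "p \<in> U" "\<And>i k. i \<in> I \<Longrightarrow> Ck_on k U (g i)"
    using smooth_at_common[of I p g] assms by blast
  then show ?thesis unfolding smooth_at_def by (auto intro!: Ck_on_sum)
qed

lemma smooth_atE:
  assumes "smooth_at p h"
  obtains U where "open U" "p \<in> U" "\<And>k. Ck_on k U h"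
  using assms unfolding smooth_at_def by blast

lemma smooth_atI: "open U \<Longrightarrow> p \<in> U \<Longrightarrow> (\<And>k. Ck_on k U h) \<Longrightarrow> smooth_at p h"
  unfolding smooth_at_def by blast

lemma smooth_at_partial_deriv:
  assumes "smooth_at p h"
  shows "smooth_at p (partial_deriv c h)"
proof -
  obtain U where U: "open U" "p \<in> U" "\<And>k. Ck_on k U h" by (rule smooth_atE[OF assms]) blast
  show ?thesis by (rule smooth_atI[OF U(1,2)]) (rule Ck_on_SucD(2)[OF U(3)])
qed

lemma smooth_at_tendsto:
  assumes "smooth_at p h"
  shows "(h \<longlongrightarrow> h p) (nhds p)"
proof -
  obtain U where U: "open U" "p \<in> U" "\<And>k. Ck_on k U h" by (rule smooth_atE[OF assms]) blast
  show ?thesis using Ck_on_continuous[OF U(3)] U(2) by (simp add: continuous_on_nhds_iff[OF U(1)])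
qed

text \<open>The preimage of a neighbourhood of smoothness under freezing is a cylinder over
  \<open>C\<close>, and on it \<open>h\<close> equals \<open>h\<close> after freezing. Hence the
  base point matters only through its coordinates in \<open>C\<close>.\<close>

lemma smooth_fn_cylinder:
  assumes "smooth_fn C p h" "finite C"
  obtains U where "open U" "p \<in> U" "\<And>q q'. (\<And>c. c \<in> C \<Longrightarrow> q c = q' c) \<Longrightarrow> q \<in> U \<Longrightarrow> q' \<in> U"
    "\<And>k. Ck_on k U h"
proof -
  obtain U where U: "open U" "p \<in> U" "\<And>k. Ck_on k U h"
    by (rule smooth_atE[OF smooth_fn_smooth_at[OF assms(1)]]) blast
  define V where "V = {q. freeze C p q \<in> U}"
  have V: "open V"
    unfolding open_subopen[of V]
  proof
    fix q assume "q \<in> V"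
    then have "\<forall>\<^sub>F q' in nhds q. freeze C p q' \<in> U"
      by (intro eventually_compose_filterlim[OF _ tendsto_freeze'] eventually_eq_open[OF U(1)])
        (auto simp: V_def)
    then show "\<exists>T. open T \<and> q \<in> T \<and> T \<subseteq> V"
      unfolding V_def eventually_nhds by auto
  qed
  have "Ck_on k V (\<lambda>q. h (\<lambda>c. freeze C p q c))" for k
  proof (rule Ck_on_compose_UNIV[OF assms(2) smooth_fn_depends_only[OF assms(1)] U(1) V U(3)])
    show "Ck_on k V (\<lambda>q. freeze C p q c)" for c
      using Ck_on_const[OF V] Ck_on_coord[OF V] by (cases "c \<in> C") (simp_all add: freeze_def)
  qed (simp add: V_def)
  then have "Ck_on k V h" for k
    using depends_only_freeze[OF smooth_fn_depends_only[OF assms(1)]] by simp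
  moreover have "p \<in> V" using U(2) by (simp add: V_def freeze_def)
  moreover have "q' \<in> V" if "\<And>c. c \<in> C \<Longrightarrow> q c = q' c" "q \<in> V" for q q'
  proof -
    have "freeze C p q = freeze C p q'" using that(1) by (auto simp: freeze_def)
    with that(2) show ?thesis by (simp add: V_def)
  qed
  ultimately show thesis using that[OF V] by metis
qed

lemma smooth_fn_cong_point:
  assumes "smooth_fn C p h" "finite C" "\<And>c. c \<in> C \<Longrightarrow> p c = p' c"
  shows "smooth_fn C p' h"
proof -
  obtain U where "open U" "p \<in> U" "\<And>q q'. (\<And>c. c \<in> C \<Longrightarrow> q c = q' c) \<Longrightarrow> q \<in> U \<Longrightarrow> q' \<in> U"
    "\<And>k. Ck_on k U h" using smooth_fn_cylinder[OF assms(1,2)] by metis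
  then show ?thesis using assms(1,3) unfolding smooth_fn_def by metis
qed

text \<open>Smoothness and the chain rule are proved together because they need the same
  neighbourhood. The cylinder shape of \<open>U\<close> makes it harmless that \<open>N\<close> is
  arbitrary outside \<open>C\<close>.\<close>

lemma smooth_at_compose_aux:
  assumes "smooth_fn C (\<lambda>c. N c p) h" "finite C" "\<And>c. c \<in> C \<Longrightarrow> smooth_at p (N c)"
  shows "smooth_at p (\<lambda>q. h (\<lambda>c. N c q)) \<and>
    (\<forall>\<^sub>F q in nhds p. \<forall>d. partial_deriv d (\<lambda>q. h (\<lambda>c. N c q)) q =
      (\<Sum>c\<in>C. partial_deriv c h (\<lambda>c. N c q) * partial_deriv d (N c) q))"
proof -
  obtain U where U: "open U" "(\<lambda>c. N c p) \<in> U"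
    "\<And>q q'. (\<And>c. c \<in> C \<Longrightarrow> q c = q' c) \<Longrightarrow> q \<in> U \<Longrightarrow> q' \<in> U"
    "\<And>k. Ck_on k U h" by (rule smooth_fn_cylinder[OF assms(1,2)]) blast
  obtain V where V: "open V" "p \<in> V" "\<And>c k. c \<in> C \<Longrightarrow> Ck_on k V (N c)"
    by (rule smooth_at_common[OF assms(2), of p N, OF assms(3)]) blast+
  \<comment> \<open>Outside \<open>C\<close> even continuity of \<open>N c\<close> is unknown;
    replacing it by zero changes neither the value of \<open>h\<close> nor membership in the
    cylinder.\<close>
  define N' where "N' c = (if c \<in> C then N c else (\<lambda>_. 0))" for c
  have N': "Ck_on k V (N' c)" for c k
    using V Ck_on_const[OF V(1)] by (auto simp: N'_def)
  have "(N' c \<longlongrightarrow> N' c p) (nhds p)" for c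
    using continuous_on_nhds_iff[OF V(1), THEN iffD1, OF Ck_on_continuous[OF N'[of 0 c]]] V(2)
    by blast
  then have "((\<lambda>q. (\<lambda>c. N' c q)) \<longlongrightarrow> (\<lambda>c. N' c p)) (nhds p)"
    unfolding tendsto_fun_iff by blast
  moreover have "\<forall>\<^sub>F x in nhds (\<lambda>c. N' c p). x \<in> U"
    by (rule eventually_eq_open[OF U(1) U(3)[OF _ U(2)]]) (simp_all add: N'_def)
  ultimately have "\<forall>\<^sub>F q in nhds p. (\<lambda>c. N' c q) \<in> U"
    by (rule eventually_compose_filterlim[rotated])
  moreover have "\<forall>\<^sub>F q in nhds p. q \<in> V" by (rule eventually_eq_open[OF V(1,2)])
  ultimately have "\<forall>\<^sub>F q in nhds p. q \<in> V \<and> (\<lambda>c. N' c q) \<in> U" by (intro eventually_conj)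
  then obtain W where W: "open W" "p \<in> W" "\<And>q. q \<in> W \<Longrightarrow> q \<in> V" "\<And>q. q \<in> W \<Longrightarrow> (\<lambda>c. N' c q) \<in> U"
    unfolding eventually_nhds by blast
  have dep: "depends_only C UNIV h" using assms(1) by (rule smooth_fn_depends_only)
  have N'W: "Ck_on k W (N' c)" for c k
    by (rule Ck_on_subset[OF N']) (use W(3) in blast)
  have eq: "h (\<lambda>c. N c q) = h (\<lambda>c. N' c q)" for q
    by (rule depends_onlyD[OF dep]) (simp add: N'_def)
  have "Ck_on k W (\<lambda>q. h (\<lambda>c. N' c q))" for k
    by (rule Ck_on_compose_UNIV[OF assms(2) dep U(1) W(1) U(4) N'W W(4)])
  then have "smooth_at p (\<lambda>q. h (\<lambda>c. N c q))"
    unfolding eq by (rule smooth_atI[OF W(1,2)])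
  moreover have "partial_deriv d (\<lambda>q. h (\<lambda>c. N c q)) q =
      (\<Sum>c\<in>C. partial_deriv c h (\<lambda>c. N c q) * partial_deriv d (N c) q)" if "q \<in> W" for d q
  proof -
    have Nq: "(\<lambda>c. N c q) \<in> U"
      by (rule U(3)[OF _ W(4)[OF that]]) (simp add: N'_def)
    show ?thesis
      by (rule partial_derivI[OF has_partial_deriv_compose[where N=N and V=V, OF assms(2) dep U(1) U(4)[of "Suc 0"] Nq W(3)[OF that]]])
        (rule V(3))
  qed
  then have "\<forall>\<^sub>F q in nhds p. \<forall>d. partial_deriv d (\<lambda>q. h (\<lambda>c. N c q)) q =
      (\<Sum>c\<in>C. partial_deriv c h (\<lambda>c. N c q) * partial_deriv d (N c) q)"
    by (intro eventually_eq_open[OF W(1,2)]) blast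
  ultimately show ?thesis by (rule conjI)
qed

lemmas smooth_at_compose = smooth_at_compose_aux[THEN conjunct1]

lemma partial_deriv_compose_ev:
  assumes "smooth_fn C (\<lambda>c. N c p) h" "finite C" "\<And>c. c \<in> C \<Longrightarrow> smooth_at p (N c)"
  shows "\<forall>\<^sub>F q in nhds p. partial_deriv d (\<lambda>q. h (\<lambda>c. N c q)) q =
      (\<Sum>c\<in>C. partial_deriv c h (\<lambda>c. N c q) * partial_deriv d (N c) q)"
  using smooth_at_compose_aux[OF assms] by (auto elim: eventually_mono)

section \<open>The inverse function theorem\<close>

lemma eventually_nhds_compose_on:
  fixes y :: "'c \<Rightarrow> real"
  assumes "eventually P (nhds y)" "\<And>c. c \<in> C \<Longrightarrow> (N c \<longlongrightarrow> y c) F"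
    "\<And>q q'. (\<And>c. c \<in> C \<Longrightarrow> q c = q' c) \<Longrightarrow> P q \<Longrightarrow> P q'"
  shows "\<forall>\<^sub>F r in F. P (\<lambda>c. N c r)"
proof -
  have "((\<lambda>r. (\<lambda>c. if c \<in> C then N c r else y c)) \<longlongrightarrow> y) F"
    unfolding tendsto_fun_iff
  proof
    fix c
    show "((\<lambda>r. if c \<in> C then N c r else y c) \<longlongrightarrow> y c) F"
      using assms(2)[of c] by (cases "c \<in> C") simp_all
  qed
  then have "\<forall>\<^sub>F r in F. P (\<lambda>c. if c \<in> C then N c r else y c)"
    by (rule eventually_compose_filterlim[OF assms(1)])
  then show ?thesis
  proof (rule eventually_mono)
    fix r
    assume "P (\<lambda>c. if c \<in> C then N c r else y c)"
    then show "P (\<lambda>c. N c r)" by (rule assms(3)[rotated]) simp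
  qed
qed

lemma depends_only_compose:
  assumes "depends_only C UNIV h" "\<And>c. c \<in> C \<Longrightarrow> depends_only D UNIV (N c)"
  shows "depends_only D UNIV (\<lambda>q. h (\<lambda>c. N c q))"
  unfolding depends_only_def
  by (intro ballI impI depends_onlyD[OF assms(1)] depends_onlyD[OF assms(2)]) auto

lemma depends_only_coord: "d \<in> D \<Longrightarrow> depends_only D UNIV (\<lambda>q. q d)"
  by (simp add: depends_only_def)

lemma smooth_fn_coord: "d \<in> D \<Longrightarrow> smooth_fn D p (\<lambda>q. q d)"
  by (simp add: smooth_fn_iff depends_only_coord smooth_at_coord)

lemma smooth_fn_compose:
  assumes "smooth_fn C (\<lambda>c. N c p) h" "finite C" "\<And>c. c \<in> C \<Longrightarrow> smooth_fn D p (N c)"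
  shows "smooth_fn D p (\<lambda>q. h (\<lambda>c. N c q))"
  unfolding smooth_fn_iff
  by (intro conjI depends_only_compose[OF smooth_fn_depends_only[OF assms(1)]]
      smooth_at_compose[where N=N and p=p, OF assms(1,2)] smooth_fn_depends_only[OF assms(3)]
      smooth_fn_smooth_at[OF assms(3)])

text \<open>The one-variable implicit function theorem, phrased as an exchange of coordinates.\<close>

lemma exchange_coordinate_pos:
  assumes h: "smooth_fn A p h" and A: "finite A" "a \<in> A" and pos: "partial_deriv a h p > 0"
  shows "\<exists>g. smooth_fn A (p(a := h p)) g \<and> (\<forall>\<^sub>F q in nhds p. g (q(a := h q)) = q a) \<and>
    (\<forall>\<^sub>F r in nhds (p(a := h p)). h (r(a := g r)) = r a)"
proof -
  obtain U where U: "open U" "p \<in> U" "\<And>k. Ck_on k U h"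
    by (rule smooth_atE[OF smooth_fn_smooth_at[OF h]]) blast
  have dep: "depends_only A UNIV h" using h by (rule smooth_fn_depends_only)
  have "(partial_deriv a h \<longlongrightarrow> partial_deriv a h p) (nhds p)"
    using smooth_fn_smooth_at[OF h] by (intro smooth_at_tendsto smooth_at_partial_deriv)
  then have "\<forall>\<^sub>F q in nhds p. partial_deriv a h q > 0" using pos by (rule order_tendstoD)
  moreover have "\<forall>\<^sub>F q in nhds p. q \<in> U" by (rule eventually_eq_open[OF U(1,2)])
  ultimately have "\<forall>\<^sub>F q in nhds p. q \<in> U \<and> partial_deriv a h q > 0" by eventually_elim simp
  then obtain A0 e where A0: "finite A0" "0 < e"
    "\<And>y. (\<forall>c\<in>A0. \<bar>y c - p c\<bar> < e) \<Longrightarrow> y \<in> U \<and> partial_deriv a h y > 0"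
    unfolding eventually_nhds_fun_iff by blast
  \<comment> \<open>In the new coordinates the entry at \<open>a\<close> is a value of
    \<open>h\<close> and need not be close to \<open>p a\<close>; the box therefore leaves
    \<open>a\<close> free.\<close>
  define Box where "Box = {y. \<forall>c\<in>A0 - {a}. \<bar>y c - p c\<bar> < e}"
  define \<epsilon> where "\<epsilon> = e / 2"
  have \<epsilon>: "0 < \<epsilon>" "\<epsilon> < e" using A0(2) by (auto simp: \<epsilon>_def)
  have inU: "y(a := t) \<in> U" and Dpos: "partial_deriv a h (y(a := t)) > 0"
    if "y \<in> Box" "\<bar>t - p a\<bar> \<le> \<epsilon>" for y t
    using A0(3)[of "y(a := t)"] that \<epsilon> by (auto simp: Box_def)
  have incr: "h (y(a := s)) < h (y(a := t))"
    if "y \<in> Box" "\<bar>s - p a\<bar> \<le> \<epsilon>" "\<bar>t - p a\<bar> \<le> \<epsilon>" "s < t" for y s t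
  proof (rule DERIV_pos_imp_increasing[OF that(4)])
    fix x assume "s \<le> x" "x \<le> t"
    then have x: "\<bar>x - p a\<bar> \<le> \<epsilon>" using that by auto
    show "\<exists>D. ((\<lambda>t. h (y(a := t))) has_real_derivative D) (at x) \<and> D > 0"
      using Ck_on_SucD(1)[OF U(3) inU[OF that(1) x], of a] Dpos[OF that(1) x] by auto
  qed
  \<comment> \<open>The box is kept out of \<open>P\<close>, since its coordinates may lie outside
    \<open>A\<close>. Thus the choice \<open>g\<close> depends on \<open>A\<close> alone at every
    point, not only near the base point.\<close>
  define P where "P r t \<longleftrightarrow> \<bar>t - p a\<bar> \<le> \<epsilon> \<and> h (r(a := t)) = r a" for r t
  define g where "g r = (SOME t. P r t)" for r
  \<comment> \<open>The strict inequalities make \<open>V\<close> open, yield a root by the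
    intermediate value theorem, and keep that root away from both ends of the interval.\<close>
  define V where "V = {r \<in> Box. h (r(a := p a - \<epsilon>)) < r a \<and> r a < h (r(a := p a + \<epsilon>))}"
  have P_unique: "t = t'" if "r \<in> Box" "P r t" "P r t'" for r t t'
    using incr[OF that(1), of t t'] incr[OF that(1), of t' t] that(2,3)
    unfolding P_def by (cases t t' rule: linorder_cases) auto
  have Pg: "P r (g r)" if "r \<in> V" for r
  proof -
    have r: "r \<in> Box" using that by (simp add: V_def)
    have "\<exists>t\<ge>p a - \<epsilon>. t \<le> p a + \<epsilon> \<and> h (r(a := t)) = r a"
    proof (rule IVT)
      show "\<forall>x. p a - \<epsilon> \<le> x \<and> x \<le> p a + \<epsilon> \<longrightarrow> isCont (\<lambda>t. h (r(a := t))) x"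
      proof (intro allI impI)
        fix x assume "p a - \<epsilon> \<le> x \<and> x \<le> p a + \<epsilon>"
        then have "r(a := x) \<in> U" by (intro inU[OF r]) auto
        from Ck_on_SucD(1)[OF U(3) this, of a] show "isCont (\<lambda>t. h (r(a := t))) x"
          by (auto intro: DERIV_isCont)
      qed
    qed (use that \<epsilon> in \<open>auto simp: V_def\<close>)
    then obtain t where "P r t" unfolding P_def by fastforce
    then show ?thesis unfolding g_def by (rule someI)
  qed
  have g_strict: "\<bar>g r - p a\<bar> < \<epsilon>" if "r \<in> V" for r
  proof (rule ccontr)
    assume "\<not> ?thesis"
    then have "g r = p a - \<epsilon> \<or> g r = p a + \<epsilon>" using Pg[OF that] by (auto simp: P_def)
    then show False using Pg[OF that] that by (auto simp: P_def V_def)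
  qed
  have hg: "h (r(a := g r)) = r a" if "r \<in> V" for r using Pg[OF that] by (simp add: P_def)
  have h_cont: "(h \<longlongrightarrow> h y) (nhds y)" if "y \<in> U" for y
    using Ck_on_continuous[OF U(3)] that by (simp add: continuous_on_nhds_iff[OF U(1)])
  have h_upd: "((\<lambda>r. h (r(a := t))) \<longlongrightarrow> h (r(a := t))) (nhds r)" if "r \<in> Box" "\<bar>t - p a\<bar> \<le> \<epsilon>" for r t
    by (rule filterlim_compose[OF h_cont[OF inU[OF that]] tendsto_fun_upd]) (auto simp: filterlim_ident)
  have less1: "\<forall>\<^sub>F r' in nhds r. h (r'(a := t)) < r' a"
    if "r \<in> Box" "\<bar>t - p a\<bar> \<le> \<epsilon>" "h (r(a := t)) < r a" for r t
    using order_tendstoD(1)[OF tendsto_diff[OF tendsto_fun_coord[of a r] h_upd[OF that(1,2)]], of 0] that(3)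
    by simp
  have less2: "\<forall>\<^sub>F r' in nhds r. r' a < h (r'(a := t))"
    if "r \<in> Box" "\<bar>t - p a\<bar> \<le> \<epsilon>" "r a < h (r(a := t))" for r t
    using order_tendstoD(1)[OF tendsto_diff[OF h_upd[OF that(1,2)] tendsto_fun_coord[of a r]], of 0] that(3)
    by simp
  have evBox: "\<forall>\<^sub>F r' in nhds r. r' \<in> Box" if "r \<in> Box" for r
  proof -
    have "\<forall>\<^sub>F r' in nhds r. \<bar>r' c - p c\<bar> < e" if c: "c \<in> A0 - {a}" for c
      by (rule order_tendstoD(2)[OF tendsto_rabs[OF tendsto_diff[OF tendsto_fun_coord tendsto_const]]])
        (use \<open>r \<in> Box\<close> c in \<open>simp add: Box_def\<close>)
    then show ?thesis unfolding Box_def mem_Collect_eq using A0(1) by (intro eventually_ball_finite) auto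
  qed
  have evV: "\<forall>\<^sub>F r' in nhds r. r' \<in> V" if "r \<in> V" for r
    using evBox[of r] less1[of r "p a - \<epsilon>"] less2[of r "p a + \<epsilon>"] that \<epsilon>(1)
    unfolding V_def by (auto intro!: eventually_conj)
  have V: "open V"
    unfolding open_subopen[of V] using evV unfolding eventually_nhds by (metis subsetI)
  have g_cont: "(g \<longlongrightarrow> g r) (nhds r)" if r: "r \<in> V" for r
  proof (rule tendstoI)
    fix \<delta> :: real assume "0 < \<delta>"
    \<comment> \<open>Small enough that both \<open>g r - \<eta>\<close> and
      \<open>g r + \<eta>\<close> stay in the interval of monotonicity; their strict inequalities
      persist nearby and trap \<open>g r'\<close> between them.\<close>
    define \<eta> where "\<eta> = min (\<delta> / 2) (\<epsilon> - \<bar>g r - p a\<bar>)"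
    have "\<eta> \<le> \<epsilon> - \<bar>g r - p a\<bar>" "0 < \<eta>" "\<eta> < \<delta>"
      using \<open>0 < \<delta>\<close> g_strict[OF r] by (auto simp: \<eta>_def min_def)
    then have \<eta>: "0 < \<eta>" "\<eta> < \<delta>" "\<bar>g r - \<eta> - p a\<bar> \<le> \<epsilon>" "\<bar>g r + \<eta> - p a\<bar> \<le> \<epsilon>"
      by linarith+
    have rB: "r \<in> Box" using r by (simp add: V_def)
    have gr: "\<bar>g r - p a\<bar> \<le> \<epsilon>" using g_strict[OF r] by simp
    have "h (r(a := g r - \<eta>)) < r a" "r a < h (r(a := g r + \<eta>))"
      using incr[OF rB \<eta>(3) gr] incr[OF rB gr \<eta>(4)] \<eta>(1) hg[OF r] by auto
    from evV[OF r] less1[OF rB \<eta>(3) this(1)] less2[OF rB \<eta>(4) this(2)]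
    show "\<forall>\<^sub>F r' in nhds r. dist (g r') (g r) < \<delta>"
    proof eventually_elim
      case (elim r')
      have r'B: "r' \<in> Box" using elim(1) by (simp add: V_def)
      have gr': "\<bar>g r' - p a\<bar> \<le> \<epsilon>" using g_strict[OF elim(1)] by simp
      have "g r - \<eta> < g r'"
        using incr[OF r'B gr' \<eta>(3)] hg[OF elim(1)] elim(2) by (cases "g r'" "g r - \<eta>" rule: linorder_cases) auto
      moreover have "g r' < g r + \<eta>"
        using incr[OF r'B \<eta>(4) gr'] hg[OF elim(1)] elim(3) by (cases "g r'" "g r + \<eta>" rule: linorder_cases) auto
      ultimately show ?case using \<eta>(2) by (auto simp: dist_real_def)
    qed
  qed
  define N where "N c r = (if c = a then g r else r c)" for c r
  have N_upd: "(\<lambda>c. N c r) = r(a := g r)" for r by (auto simp: N_def)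
  have NU: "(\<lambda>c. N c r) \<in> U" and ND: "partial_deriv a h (\<lambda>c. N c r) > 0" if "r \<in> V" for r
    using that g_strict[OF that] inU[of r "g r"] Dpos[of r "g r"] by (auto simp: N_upd V_def)
  \<comment> \<open>Obtained by differentiating \<open>h (r(a := g r)) = r a\<close>. For
    \<open>d = a\<close> the entry of \<open>r\<close> inside \<open>h\<close> is overwritten, so
    only the right-hand side contributes, with derivative 1.\<close>
  define G where "G d r = (if d = a then 1 else - 1 * partial_deriv d h (\<lambda>c. N c r)) *
    inverse (partial_deriv a h (\<lambda>c. N c r))" for d r
  have g_deriv: "((\<lambda>t. g (r(d := t))) has_real_derivative G d r) (at (r d))" if r: "r \<in> V" for d r
  proof -
    define x where "x = r(a := g r)"
    have xU: "x \<in> U" and xD: "partial_deriv a h x > 0"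
      using NU[OF r] ND[OF r] by (simp_all add: N_upd x_def)
    \<comment> \<open>The defect of the equation when \<open>g\<close> is held at its value in
      \<open>r\<close>. It equals \<open>D t\<close> times the increment of \<open>g\<close>, so the
      difference quotient of \<open>g\<close> is that of \<open>\<kappa>\<close> divided by
      \<open>D t\<close>, and \<open>g\<close> need not be known to be differentiable.\<close>
    define \<kappa> where "\<kappa> t = (r(d := t)) a - h ((r(d := t))(a := g r))" for t
    have line: "((\<lambda>t. r(d := t)) \<longlongrightarrow> r) (at (r d))"
      using tendsto_fun_upd_line[of r d] by (rule tendsto_mono[OF at_within_le_nhds])
    have gline: "((\<lambda>t. g (r(d := t))) \<longlongrightarrow> x a) (at (r d))"
      using filterlim_compose[OF g_cont[OF r] line] by (simp add: x_def)
    have qline: "((\<lambda>t. (r(d := t))(a := g r)) \<longlongrightarrow> x) (at (r d))"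
      unfolding x_def by (rule tendsto_fun_upd[OF line tendsto_const])
    obtain D where D: "(D \<longlongrightarrow> partial_deriv a h x) (at (r d))"
      "\<forall>\<^sub>F t in at (r d). h ((r(d := t))(a := g r, a := g (r(d := t)))) -
         h ((r(d := t))(a := g r, a := x a)) = D t * (g (r(d := t)) - x a)"
      by (rule partial_increment[OF U(1) xU U(3) qline tendsto_const gline]) blast
    have \<kappa>: "(\<kappa> has_real_derivative (if d = a then 1 else - 1 * partial_deriv d h x)) (at (r d))"
    proof (cases "d = a")
      case True
      then show ?thesis unfolding \<kappa>_def by (auto intro!: derivative_eq_intros)
    next
      case False
      then have *: "(r(d := t))(a := g r) = x(d := t)" "(r(d := t)) a = r a" for t
        by (auto simp: x_def)
      have "x d = r d" using False by (simp add: x_def)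
      then show ?thesis
        using DERIV_diff[OF DERIV_const Ck_on_SucD(1)[OF U(3) xU, of d], of "r a"] False
        unfolding \<kappa>_def * by simp
    qed
    have \<kappa>0: "\<kappa> (r d) = 0" using hg[OF r] by (simp add: \<kappa>_def)
    show ?thesis
      unfolding has_field_derivative_iff
    proof (rule Lim_transform_eventually)
      show "((\<lambda>t. (\<kappa> t - \<kappa> (r d)) / (t - r d) * inverse (D t)) \<longlongrightarrow> G d r) (at (r d))"
        unfolding G_def N_upd x_def[symmetric]
        using \<kappa> xD D(1) unfolding has_field_derivative_iff
        by (intro tendsto_mult tendsto_inverse) auto
      have "\<forall>\<^sub>F t in at (r d). D t > 0" using D(1) xD by (rule order_tendstoD)
      moreover have "\<forall>\<^sub>F t in at (r d). r(d := t) \<in> V"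
        by (rule eventually_compose_filterlim[OF evV[OF r] line])
      ultimately show "\<forall>\<^sub>F t in at (r d). (\<kappa> t - \<kappa> (r d)) / (t - r d) * inverse (D t) =
          (g (r(d := t)) - g (r(d := r d))) / (t - r d)"
        using D(2)
      proof eventually_elim
        case (elim t)
        have "\<kappa> t = D t * (g (r(d := t)) - g r)"
          using elim(3) hg[OF elim(2)] by (simp add: \<kappa>_def x_def)
        then have "g (r(d := t)) - g r = \<kappa> t * inverse (D t)" using elim(1) by simp
        then show ?case by (simp add: \<kappa>0 divide_inverse ac_simps)
      qed
    qed
  qed
  \<comment> \<open>Bootstrapping: the formula \<open>G\<close> for the derivatives contains
    \<open>g\<close> only undifferentiated, so each order of regularity of \<open>g\<close> yields
    the next.\<close>
  have Ckg: "Ck_on k V g" for k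
  proof (induction k)
    case 0
    then show ?case using g_cont by (simp add: continuous_on_nhds_iff[OF V])
  next
    case (Suc k)
    have "N c = (if c = a then g else (\<lambda>r. r c))" for c by (auto simp: N_def)
    then have NC: "Ck_on k V (N c)" for c
      using Suc.IH Ck_on_coord[OF V] by (cases "c = a") simp_all
    have comp: "Ck_on k V (\<lambda>r. partial_deriv d h (\<lambda>c. N c r))" for d
      by (rule Ck_on_compose_UNIV[OF A(1) depends_only_partial_deriv[OF dep] U(1) V
            Ck_on_SucD(2)[OF U(3)] NC NU])
    have "Ck_on k V (\<lambda>r. if d = a then 1 else - 1 * partial_deriv d h (\<lambda>c. N c r))" for d
      by (cases "d = a") (auto intro!: Ck_on_const[OF V] Ck_on_mult[OF V Ck_on_const[OF V] comp, of "-1", simplified])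
    moreover have "Ck_on k V (\<lambda>r. inverse (partial_deriv a h (\<lambda>c. N c r)))"
      by (rule Ck_on_inverse[OF V comp]) (use ND in force)
    ultimately have "Ck_on k V (G d)" for d
      unfolding G_def by (rule Ck_on_mult[OF V])
    moreover have "continuous_on V g" using g_cont by (simp add: continuous_on_nhds_iff[OF V])
    ultimately show ?case by (intro Ck_on_SucI[OF V _ g_deriv])
  qed
  define p' where "p' = p(a := h p)"
  have pB: "p \<in> Box" using A0(2) by (simp add: Box_def)
  have p'V: "p' \<in> V"
    using incr[OF pB, of "p a - \<epsilon>" "p a"] incr[OF pB, of "p a" "p a + \<epsilon>"] \<epsilon>(1) pB
    by (auto simp: V_def p'_def Box_def)
  have "P r = P r'" if "\<forall>c\<in>A. r c = r' c" for r r'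
  proof
    fix t
    have "h (r(a := t)) = h (r'(a := t))" by (rule depends_onlyD[OF dep]) (use that in auto)
    then show "P r t = P r' t" using that A(2) by (simp add: P_def)
  qed
  then have "depends_only A UNIV g" unfolding depends_only_def g_def by metis
  then have "smooth_fn A p' g"
    using smooth_atI[OF V p'V Ckg] by (simp add: smooth_fn_iff)
  moreover have "\<forall>\<^sub>F q in nhds p. g (q(a := h q)) = q a"
  proof -
    have "((\<lambda>q. q(a := h q)) \<longlongrightarrow> p') (nhds p)"
      unfolding p'_def using tendsto_fun_upd[OF filterlim_ident smooth_at_tendsto[OF smooth_fn_smooth_at[OF h]]] .
    from eventually_compose_filterlim[OF evV[OF p'V] this]
    have "\<forall>\<^sub>F q in nhds p. q(a := h q) \<in> V" .
    moreover have "\<forall>\<^sub>F q in nhds p. \<bar>q a - p a\<bar> < \<epsilon>"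
      by (rule order_tendstoD(2)[OF tendsto_rabs[OF tendsto_diff[OF tendsto_fun_coord tendsto_const]]])
        (use \<epsilon> in simp)
    ultimately show ?thesis
    proof eventually_elim
      case (elim q)
      have "P (q(a := h q)) (q a)" using elim(2) by (simp add: P_def)
      with Pg[OF elim(1)] P_unique show ?case using elim(1) by (auto simp: V_def)
    qed
  qed
  moreover have "\<forall>\<^sub>F r in nhds p'. h (r(a := g r)) = r a"
    using evV[OF p'V] by (rule eventually_mono) (rule hg)
  ultimately show ?thesis unfolding p'_def by blast
qed

lemma smooth_fn_uminus: "smooth_fn A p h \<Longrightarrow> smooth_fn A p (\<lambda>q. - h q)"
  using smooth_at_mult[OF smooth_at_const[of p "-1"]] by (auto simp: smooth_fn_iff depends_only_def)

text \<open>A negative derivative is made positive by passing to \<open>- h\<close>; the sign is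
  undone by flipping the coordinate \<open>a\<close> in the argument of \<open>g\<close>.\<close>

lemma exchange_coordinate:
  assumes h: "smooth_fn A p h" and A: "finite A" "a \<in> A" and nz: "partial_deriv a h p \<noteq> 0"
  obtains g where "smooth_fn A (p(a := h p)) g" "\<forall>\<^sub>F q in nhds p. g (q(a := h q)) = q a"
    "\<forall>\<^sub>F r in nhds (p(a := h p)). h (r(a := g r)) = r a"
proof (cases "partial_deriv a h p > 0")
  case True
  show thesis using exchange_coordinate_pos[OF h A True] that by blast
next
  case False
  obtain U where U: "open U" "p \<in> U" "\<And>k. Ck_on k U h"
    by (rule smooth_atE[OF smooth_fn_smooth_at[OF h]]) blast
  have "partial_deriv a (\<lambda>q. - h q) p = - partial_deriv a h p"
    by (rule partial_derivI[OF DERIV_minus[OF Ck_on_SucD(1)[OF U(3) U(2)]]])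
  then have "partial_deriv a (\<lambda>q. - h q) p > 0" using nz False by simp
  from exchange_coordinate_pos[OF smooth_fn_uminus[OF h] A this]
  obtain g where g: "smooth_fn A (p(a := - h p)) g"
    "\<forall>\<^sub>F q in nhds p. g (q(a := - h q)) = q a"
    "\<forall>\<^sub>F r in nhds (p(a := - h p)). - h (r(a := g r)) = r a" by blast
  define N :: "'a \<Rightarrow> ('a \<Rightarrow> real) \<Rightarrow> real" where "N c r = (if c = a then - r a else r c)" for c r
  have N_upd: "(\<lambda>c. N c r) = r(a := - r a)" for r by (auto simp: N_def)
  have N_eq: "N c = (if c = a then (\<lambda>r. - r a) else (\<lambda>r. r c))" for c by (auto simp: N_def)
  show thesis
  proof (rule that)
    show "smooth_fn A (p(a := h p)) (\<lambda>r. g (\<lambda>c. N c r))"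
    proof (rule smooth_fn_compose[where N=N and h=g, OF _ A(1)])
      show "smooth_fn A (\<lambda>c. N c (p(a := h p))) g" using g(1) by (simp add: N_upd)
      show "smooth_fn A (p(a := h p)) (N c)" if "c \<in> A" for c
        using that A(2) by (simp add: N_eq smooth_fn_coord smooth_fn_uminus)
    qed
    show "\<forall>\<^sub>F q in nhds p. g (\<lambda>c. N c (q(a := h q))) = q a"
      using g(2) by (simp add: N_upd)
    have "((\<lambda>r. r(a := - r a)) \<longlongrightarrow> (p(a := h p))(a := - h p)) (nhds (p(a := h p)))"
      by (rule tendsto_fun_upd[OF filterlim_ident tendsto_minus])
        (use tendsto_fun_coord[of a "p(a := h p)"] in simp)
    then have "((\<lambda>r. r(a := - r a)) \<longlongrightarrow> p(a := - h p)) (nhds (p(a := h p)))" by simp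
    from eventually_compose_filterlim[OF g(3) this]
    show "\<forall>\<^sub>F r in nhds (p(a := h p)). h (r(a := g (\<lambda>c. N c r))) = r a"
      by (simp add: N_upd)
  qed
qed

text \<open>
  Gaussian elimination: \<open>T b\<close> already is the coordinate \<open>\<tau> b\<close> for \<open>b \<in> D\<close>, and each step exchanges
  one further coordinate for a component of \<open>T\<close>.
\<close>

lemma inverse_function_aux:
  fixes T :: "'b \<Rightarrow> ('a \<Rightarrow> real) \<Rightarrow> real"
  assumes "finite A" "finite B" "card A = card B"
  shows "\<lbrakk>card (B - D) = n; D \<subseteq> B; inj_on \<tau> D; \<tau> ` D \<subseteq> A; \<And>b q. b \<in> D \<Longrightarrow> T b q = q (\<tau> b);
    \<And>b. b \<in> B \<Longrightarrow> smooth_fn A p (T b);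
    \<And>l. (\<And>a. a \<in> A \<Longrightarrow> (\<Sum>b\<in>B. l b * partial_deriv a (T b) p) = 0) \<Longrightarrow> \<forall>b\<in>B. l b = 0\<rbrakk>
   \<Longrightarrow> \<exists>X. local_diffeo A B T X p"
proof (induction n arbitrary: D \<tau> T p)
  case 0
  then have D: "D = B" using assms(2) by auto
  have bij: "bij_betw \<tau> B A"
    using 0(3,4) card_image[OF 0(3)] assms card_subset_eq[of A "\<tau> ` B"] by (auto simp: bij_betw_def D)
  define \<rho> where "\<rho> = inv_into B \<tau>"
  have \<rho>: "\<And>a. a \<in> A \<Longrightarrow> \<rho> a \<in> B \<and> \<tau> (\<rho> a) = a" "\<And>b. b \<in> B \<Longrightarrow> \<tau> b \<in> A \<and> \<rho> (\<tau> b) = b"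
    using bij bij_betw_inv_into_left[OF bij] bij_betw_inv_into_right[OF bij]
      bij_betwE[OF bij] bij_betwE[OF bij_betw_inv_into[OF bij]] by (auto simp: \<rho>_def)
  have "local_diffeo A B T (\<lambda>a r. r (\<rho> a)) p"
    unfolding local_diffeo_def using 0(5) \<rho> by (auto simp: D intro!: smooth_fn_coord 0(6))
  then show ?case by blast
next
  case (Suc n)
  note T = Suc.prems(5) and smooth = Suc.prems(6) and indep = Suc.prems(7)
  from Suc.prems(1) obtain c where c: "c \<in> B" "c \<notin> D"
    by (metis Diff_iff card.empty ex_in_conv nat.distinct(1))
  have "\<exists>a\<in>A - \<tau> ` D. partial_deriv a (T c) p \<noteq> 0"
  proof (rule ccontr)
    assume neg: "\<not> ?thesis"
    \<comment> \<open>If \<open>T c\<close> had derivatives only in the coordinates already used,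
      its differential would be a combination of the differentials of \<open>T b\<close>,
      \<open>b \<in> D\<close>; these are the coefficients of the resulting forbidden
      relation.\<close>
    define l where "l b = (if b = c then 1 else if b \<in> D then - partial_deriv (\<tau> b) (T c) p else 0)" for b
    have "(\<Sum>b\<in>B. l b * partial_deriv a (T b) p) = 0" if a: "a \<in> A" for a
    proof -
      have "partial_deriv a (T b) p = (if a = \<tau> b then 1 else 0)" if "b \<in> D" for b
        using T[OF that] partial_deriv_coord[of a "\<tau> b" p] by (simp cong: if_cong add: ext[of "T b" "\<lambda>q. q (\<tau> b)"])
      then have D_sum: "(\<Sum>b\<in>D. l b * partial_deriv a (T b) p) =
          (\<Sum>b\<in>D. if a = \<tau> b then - partial_deriv a (T c) p else 0)"
        using c by (intro sum.cong) (auto simp: l_def)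
      have fD: "finite D" using Suc.prems(2) assms(2) finite_subset by blast
      have "(\<Sum>b\<in>B. l b * partial_deriv a (T b) p) = (\<Sum>b\<in>insert c D. l b * partial_deriv a (T b) p)"
        using assms(2) c Suc.prems(2) by (intro sum.mono_neutral_right) (auto simp: l_def)
      also have "\<dots> = partial_deriv a (T c) p + (\<Sum>b\<in>D. if a = \<tau> b then - partial_deriv a (T c) p else 0)"
        using c fD D_sum by (simp add: l_def)
      also have "\<dots> = 0"
      proof (cases "a \<in> \<tau> ` D")
        case True
        then obtain b where b: "b \<in> D" "a = \<tau> b" by blast
        have "(\<Sum>b'\<in>D. if a = \<tau> b' then - partial_deriv a (T c) p else 0) =
            (\<Sum>b'\<in>D. if b' = b then - partial_deriv a (T c) p else 0)"
          using b inj_onD[OF Suc.prems(3)] by (intro sum.cong) auto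
        then show ?thesis using b fD by simp
      next
        case False
        then have "(\<Sum>b'\<in>D. if a = \<tau> b' then - partial_deriv a (T c) p else 0) = 0"
          by (intro sum.neutral) auto
        then show ?thesis using False neg a by auto
      qed
      finally show ?thesis .
    qed
    from indep[OF this] c(1) show False by (auto simp: l_def)
  qed
  then obtain a where a: "a \<in> A" "a \<notin> \<tau> ` D" "partial_deriv a (T c) p \<noteq> 0" by blast
  define p' where "p' = p(a := T c p)"
  obtain g where g: "smooth_fn A p' g" "\<forall>\<^sub>F q in nhds p. g (q(a := T c q)) = q a"
    "\<forall>\<^sub>F r in nhds p'. T c (r(a := g r)) = r a"
    by (rule exchange_coordinate[OF smooth[OF c(1)] assms(1) a(1,3), folded p'_def])
  have gp': "g p' = p a" using eventually_nhds_x_imp_x[OF g(2)] by (simp add: p'_def)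
  \<comment> \<open>\<open>E\<close> passes to the coordinates in which the value of
    \<open>T c\<close> stands in place of \<open>a\<close>; \<open>N\<close> is its inverse near the
    base point.\<close>
  define N where "N k r = (if k = a then g r else r k)" for k and r :: "'a \<Rightarrow> real"
  define E where "E k q = (if k = a then T c q else q k)" for k and q :: "'a \<Rightarrow> real"
  have N_upd: "(\<lambda>k. N k r) = r(a := g r)" for r by (auto simp: N_def)
  have E_upd: "(\<lambda>k. E k q) = q(a := T c q)" for q by (auto simp: E_def)
  have N_eq: "N k = (if k = a then g else (\<lambda>r. r k))" for k by (auto simp: N_def)
  have E_eq: "E k = (if k = a then T c else (\<lambda>r. r k))" for k by (auto simp: E_def)
  have Np': "(\<lambda>k. N k p') = p" unfolding N_upd gp' by (simp add: p'_def)
  have Ep: "(\<lambda>k. E k p) = p'" unfolding E_upd p'_def ..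
  have N_smooth: "smooth_fn A p' (N k)" if "k \<in> A" for k
    using g(1) that by (simp add: N_eq smooth_fn_coord)
  have E_smooth: "smooth_fn A p (E k)" if "k \<in> A" for k
    using smooth[OF c(1)] that by (simp add: E_eq smooth_fn_coord)
  \<comment> \<open>At \<open>c\<close> the coordinate itself is taken. It agrees with
    \<open>T c\<close> after \<open>N\<close> only near \<open>p'\<close>, whereas the induction
    demands equality at every point.\<close>
  define T' where "T' b = (if b = c then (\<lambda>r. r a) else (\<lambda>r. T b (\<lambda>k. N k r)))" for b
  have T'_smooth: "smooth_fn A p' (T' b)" if "b \<in> B" for b
    using smooth_fn_compose[of A N p' "T b" A] smooth[OF that] N_smooth assms(1) a(1)
    by (auto simp: T'_def Np' smooth_fn_coord)
  have T'_E: "\<forall>\<^sub>F q in nhds p. T' b (\<lambda>k. E k q) = T b q" for b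
    using g(2) by (rule eventually_mono) (auto simp: T'_def E_upd N_upd)
  have T'p': "(\<lambda>b. T' b p') = (\<lambda>b. T b p)"
  proof
    show "T' b p' = T b p" for b
      by (cases "b = c") (simp_all add: T'_def Np', simp add: p'_def)
  qed
  have "\<exists>X. local_diffeo A B T' X p'"
  proof (rule Suc.IH[of "insert c D" "\<tau>(c := a)"])
    have "B - insert c D = (B - D) - {c}" "c \<in> B - D" using c by auto
    then show "card (B - insert c D) = n"
      using Suc.prems(1) card_Diff_singleton[of c "B - D"] by presburger
    show "insert c D \<subseteq> B" using c Suc.prems(2) by simp
    show "inj_on (\<tau>(c := a)) (insert c D)" using Suc.prems(3) a(2) c(2) by (auto simp: inj_on_def)
    show "(\<tau>(c := a)) ` insert c D \<subseteq> A" using Suc.prems(4) a(1) by auto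
    show "T' b q = q ((\<tau>(c := a)) b)" if "b \<in> insert c D" for b q
      using that T[of b] a(2) c(2) by (auto simp: T'_def N_def)
    show "smooth_fn A p' (T' b)" if "b \<in> B" for b by (rule T'_smooth[OF that])
    fix l assume l: "\<And>a. a \<in> A \<Longrightarrow> (\<Sum>b\<in>B. l b * partial_deriv a (T' b) p') = 0"
    \<comment> \<open>Near \<open>p\<close>, \<open>T\<close> is \<open>T'\<close> after
      \<open>E\<close>; by the chain rule a relation among the differentials of \<open>T'\<close> is
      inherited by those of \<open>T\<close>.\<close>
    have "(\<Sum>b\<in>B. l b * partial_deriv d (T b) p) = 0" for d
    proof -
      have "partial_deriv d (T b) p = (\<Sum>k\<in>A. partial_deriv k (T' b) p' * partial_deriv d (E k) p)"
        if "b \<in> B" for b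
      proof -
        have "smooth_fn A (\<lambda>k. E k p) (T' b)" using T'_smooth[OF that] by (simp add: Ep)
        from eventually_nhds_x_imp_x[OF partial_deriv_compose_ev[OF this assms(1) smooth_fn_smooth_at[OF E_smooth]]]
        show ?thesis using partial_deriv_cong_ev[OF T'_E[of b], of d] by (simp add: Ep)
      qed
      then have "(\<Sum>b\<in>B. l b * partial_deriv d (T b) p) =
          (\<Sum>b\<in>B. \<Sum>k\<in>A. (l b * partial_deriv k (T' b) p') * partial_deriv d (E k) p)"
        by (simp add: sum_distrib_left mult.assoc)
      also have "\<dots> = (\<Sum>k\<in>A. (\<Sum>b\<in>B. l b * partial_deriv k (T' b) p') * partial_deriv d (E k) p)"
        by (subst sum.swap) (simp add: sum_distrib_right)
      also have "\<dots> = 0" by (simp add: l)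
      finally show ?thesis .
    qed
    then show "\<forall>b\<in>B. l b = 0" by (intro indep)
  qed
  then obtain X' where X': "local_diffeo A B T' X' p'" by blast
  have X'_smooth: "smooth_fn B (\<lambda>b. T b p) (X' k)" if "k \<in> A" for k
    using X' that by (simp add: local_diffeo_def T'p')
  have X'T': "\<forall>\<^sub>F r in nhds p'. \<forall>k\<in>A. X' k (\<lambda>b. T' b r) = r k"
    and T'X': "\<forall>\<^sub>F r in nhds (\<lambda>b. T b p). \<forall>b\<in>B. T' b (\<lambda>k. X' k r) = r b"
    using X' by (simp_all add: local_diffeo_def T'p')
  have X'Tp: "X' k (\<lambda>b. T b p) = p' k" if "k \<in> A" for k
    using eventually_nhds_x_imp_x[OF X'T'] that by (simp add: T'p')
  have gdep: "depends_only A UNIV g" using g(1) by (rule smooth_fn_depends_only)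
  \<comment> \<open>The inverse of \<open>T'\<close> gives the exchanged coordinates, from which
    \<open>g\<close> recovers the old entry at \<open>a\<close>.\<close>
  define X where "X k r = (if k = a then g (\<lambda>k. X' k r) else X' k r)" for k r
  have X_upd: "(\<lambda>k. X k r) = (\<lambda>k. X' k r)(a := g (\<lambda>k. X' k r))" for r by (auto simp: X_def)
  have X_eq: "X k = (if k = a then (\<lambda>r. g (\<lambda>k. X' k r)) else X' k)" for k by (auto simp: X_def)
  have "local_diffeo A B T X p"
    unfolding local_diffeo_def
  proof (intro conjI ballI)
    show "smooth_fn A p (T b)" if "b \<in> B" for b by (rule smooth[OF that])
    show "smooth_fn B (\<lambda>b. T b p) (X k)" if "k \<in> A" for k
    proof (cases "k = a")
      case True
      have "smooth_fn A (\<lambda>k. X' k (\<lambda>b. T b p)) g"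
        by (rule smooth_fn_cong_point[OF g(1) assms(1)]) (simp add: X'Tp)
      from smooth_fn_compose[OF this assms(1) X'_smooth] show ?thesis by (simp add: X_eq True)
    qed (simp add: X_eq X'_smooth that)
    have "\<forall>\<^sub>F q in nhds p. \<forall>k\<in>A. X' k (\<lambda>b. T' b (\<lambda>k. E k q)) = E k q"
    proof (rule eventually_compose_filterlim[OF X'T'])
      show "((\<lambda>q k. E k q) \<longlongrightarrow> p') (nhds p)"
        unfolding E_upd p'_def
        by (rule tendsto_fun_upd[OF filterlim_ident smooth_at_tendsto[OF smooth_fn_smooth_at[OF smooth[OF c(1)]]]])
    qed
    moreover have "\<forall>\<^sub>F q in nhds p. \<forall>b\<in>B. T' b (\<lambda>k. E k q) = T b q"
      using T'_E by (intro eventually_ball_finite assms(2)) blast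
    ultimately show "\<forall>\<^sub>F q in nhds p. \<forall>k\<in>A. X k (\<lambda>b. T b q) = q k"
      using g(2)
    proof eventually_elim
      case (elim q)
      have X'k: "X' k (\<lambda>b. T b q) = E k q" if "k \<in> A" for k
        using elim(1) that depends_onlyD[OF smooth_fn_depends_only[OF X'_smooth[OF that]],
            of "\<lambda>b. T' b (\<lambda>k. E k q)" "\<lambda>b. T b q"] elim(2) by auto
      have "g (\<lambda>k. X' k (\<lambda>b. T b q)) = g (\<lambda>k. E k q)"
        by (rule depends_onlyD[OF gdep]) (rule X'k)
      then show ?case using elim(3) X'k by (auto simp: X_def E_upd) (simp add: E_def)
    qed
    have "\<forall>\<^sub>F r in nhds (\<lambda>b. T b p). T c ((\<lambda>k. X' k r)(a := g (\<lambda>k. X' k r))) = X' a r"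
    proof (rule eventually_nhds_compose_on[OF g(3), of A])
      show "((X' k) \<longlongrightarrow> p' k) (nhds (\<lambda>b. T b p))" if "k \<in> A" for k
        using smooth_at_tendsto[OF smooth_fn_smooth_at[OF X'_smooth[OF that]]] X'Tp[OF that] by simp
      show "T c (q'(a := g q')) = q' a"
        if "\<And>c. c \<in> A \<Longrightarrow> q c = q' c" "T c (q(a := g q)) = q a" for q q'
      proof -
        have "g q = g q'" by (rule depends_onlyD[OF gdep that(1)])
        then have "T c (q(a := g q)) = T c (q'(a := g q'))"
          using that(1) by (intro depends_onlyD[OF smooth_fn_depends_only[OF smooth[OF c(1)]]]) auto
        then show ?thesis using that a(1) by simp
      qed
    qed
    then show "\<forall>\<^sub>F r in nhds (\<lambda>b. T b p). \<forall>b\<in>B. T b (\<lambda>k. X k r) = r b"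
      using T'X'
    proof eventually_elim
      case (elim r)
      show ?case
      proof
        fix b assume "b \<in> B"
        then have "T' b (\<lambda>k. X' k r) = r b" using elim(2) by blast
        then show "T b (\<lambda>k. X k r) = r b"
          using elim(1) by (cases "b = c") (simp_all add: T'_def X_upd N_upd)
      qed
    qed
  qed
  then show ?case by blast
qed

text \<open>Elimination starting with no coordinate fixed. Invertibility of the Jacobian is
  expressed as independence of its rows, the form in which a right inverse provides it.\<close>

lemma inverse_function:
  assumes "finite A" "finite B" "card A = card B" "\<And>b. b \<in> B \<Longrightarrow> smooth_fn A p (T b)"
    "\<And>l. (\<And>a. a \<in> A \<Longrightarrow> (\<Sum>b\<in>B. l b * partial_deriv a (T b) p) = 0) \<Longrightarrow> \<forall>b\<in>B. l b = 0"
  obtains X where "local_diffeo A B T X p"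
  using inverse_function_aux[OF assms(1-3), of "{}" _ undefined T p] assms(4,5) by auto

section \<open>Jets and total derivatives\<close>

lemma smooth_fn_mult:
  "smooth_fn C p g \<Longrightarrow> smooth_fn C p h \<Longrightarrow> smooth_fn C p (\<lambda>q. g q * h q)"
  unfolding smooth_fn_iff using smooth_at_mult by (auto simp: depends_only_def) metis+

lemma smooth_fn_sum:
  assumes "finite I" "\<And>i. i \<in> I \<Longrightarrow> smooth_fn C p (g i)"
  shows "smooth_fn C p (\<lambda>q. \<Sum>i\<in>I. g i q)"
  unfolding smooth_fn_iff
proof
  show "depends_only C UNIV (\<lambda>q. \<Sum>i\<in>I. g i q)"
    unfolding depends_only_def
    by (intro ballI impI sum.cong refl depends_onlyD[OF smooth_fn_depends_only[OF assms(2)]]) auto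
  show "smooth_at p (\<lambda>q. \<Sum>i\<in>I. g i q)"
    by (intro smooth_at_sum assms(1) smooth_fn_smooth_at[OF assms(2)])
qed

lemma smooth_fn_partial_deriv: "smooth_fn C p h \<Longrightarrow> smooth_fn C p (partial_deriv c h)"
  by (simp add: smooth_fn_iff depends_only_partial_deriv smooth_at_partial_deriv)

text \<open>The state type of an extended system has names beyond its states; this set separates the
  coordinates that evolve from those idle ones.\<close>

definition jet_names :: "'s set \<Rightarrow> ('s, 'i) coord set" where
  "jet_names S = State ` S \<union> {Input j \<alpha> |j \<alpha>. True}"

lemma jet_names_simps [simp]:
  "State s \<in> jet_names S \<longleftrightarrow> s \<in> S" "Input j \<alpha> \<in> jet_names S"
  "jet_names UNIV = UNIV"
  by (auto simp: jet_names_def image_iff) (metis coord.exhaust)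

lemma xu_coords_simps [simp]:
  "State s \<in> xu_coords S \<longleftrightarrow> s \<in> S" "Input j \<alpha> \<in> xu_coords S \<longleftrightarrow> \<alpha> = 0"
  by (auto simp: jet_coords_def)

lemma state_coords_simps [simp]:
  "State s \<in> state_coords S \<longleftrightarrow> s \<in> S" "Input j \<alpha> \<notin> state_coords S"
  by (auto simp: state_coords_def)

lemma jet_coords_subset: "jet_coords S Q \<subseteq> jet_names S"
  by (auto simp: jet_coords_def jet_names_def)

lemma finite_jet_coords:
  fixes S :: "'s set" and Q :: "'i::finite \<Rightarrow> nat"
  assumes "finite S"
  shows "finite (jet_coords S Q)"
proof -
  have "{Input j \<alpha> |j \<alpha>. \<alpha> \<le> Q j} = (\<lambda>(j, \<alpha>). Input j \<alpha> :: ('s, 'i) coord) ` (SIGMA j:UNIV. {..Q j})"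
    by auto
  then show ?thesis using assms by (simp add: jet_coords_def)
qed

section \<open>Functions of finite order on jet space\<close>

text \<open>The finite set of coordinates stays unnamed because it grows with every time
  derivative.\<close>

definition jet_fn :: "'s set \<Rightarrow> ('s, 'i) jet \<Rightarrow> (('s, 'i) jet \<Rightarrow> real) \<Rightarrow> bool" where
  "jet_fn S p h \<longleftrightarrow> (\<exists>C. finite C \<and> C \<subseteq> jet_names S \<and> smooth_fn C p h)"

lemma jet_fnI: "finite C \<Longrightarrow> C \<subseteq> jet_names S \<Longrightarrow> smooth_fn C p h \<Longrightarrow> jet_fn S p h"
  unfolding jet_fn_def by blast

lemma jet_fn_smooth_at: "jet_fn S p h \<Longrightarrow> smooth_at p h"
  unfolding jet_fn_def smooth_fn_iff by blast

lemma jet_fn_coord: "c \<in> jet_names S \<Longrightarrow> jet_fn S p (\<lambda>q. q c)"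
  by (rule jet_fnI[of "{c}"]) (auto intro: smooth_fn_coord)

lemma jet_fn_common:
  assumes "finite I" "\<And>i. i \<in> I \<Longrightarrow> jet_fn S p (g i)"
  obtains C where "finite C" "C \<subseteq> jet_names S" "\<And>i. i \<in> I \<Longrightarrow> smooth_fn C p (g i)"
proof -
  obtain C where C: "\<And>i. i \<in> I \<Longrightarrow> finite (C i) \<and> C i \<subseteq> jet_names S \<and> smooth_fn (C i) p (g i)"
    using assms(2) unfolding jet_fn_def by metis
  show thesis
  proof (rule that)
    show "finite (\<Union>i\<in>I. C i)" "(\<Union>i\<in>I. C i) \<subseteq> jet_names S" using C assms(1) by auto
    show "smooth_fn (\<Union>i\<in>I. C i) p (g i)" if "i \<in> I" for i
      using C[OF that] that by (blast intro: smooth_fn_mono)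
  qed
qed

lemma jet_fn_mult:
  assumes "jet_fn S p g" "jet_fn S p h"
  shows "jet_fn S p (\<lambda>q. g q * h q)"
proof -
  obtain C where C: "finite C" "C \<subseteq> jet_names S" "\<And>i. smooth_fn C p (if i then g else h)"
    by (rule jet_fn_common[of "UNIV :: bool set" S p "\<lambda>i. if i then g else h"]) (use assms in auto)
  show ?thesis
    by (rule jet_fnI[OF C(1,2)], rule smooth_fn_mult) (use C(3)[of True] C(3)[of False] in simp_all)
qed

lemma jet_fn_sum:
  assumes "finite I" "\<And>i. i \<in> I \<Longrightarrow> jet_fn S p (g i)"
  shows "jet_fn S p (\<lambda>q. \<Sum>i\<in>I. g i q)"
proof -
  obtain C where C: "finite C" "C \<subseteq> jet_names S" "\<And>i. i \<in> I \<Longrightarrow> smooth_fn C p (g i)"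
    by (rule jet_fn_common[of I S p g]) (use assms in blast)+
  show ?thesis by (rule jet_fnI[OF C(1,2)], rule smooth_fn_sum[OF assms(1) C(3)])
qed

lemma jet_fn_partial_deriv: "jet_fn S p h \<Longrightarrow> jet_fn S p (partial_deriv c h)"
  unfolding jet_fn_def by (elim exE conjE, intro exI conjI smooth_fn_partial_deriv)

lemma jet_fn_compose:
  assumes "jet_fn S' (M p) h" "\<And>c. c \<in> jet_names S' \<Longrightarrow> jet_fn S p (\<lambda>q. M q c)"
  shows "jet_fn S p (\<lambda>q. h (M q))"
proof -
  obtain C where C: "finite C" "C \<subseteq> jet_names S'" "smooth_fn C (M p) h"
    using assms(1) unfolding jet_fn_def by blast
  obtain D where D: "finite D" "D \<subseteq> jet_names S" "\<And>c. c \<in> C \<Longrightarrow> smooth_fn D p (\<lambda>q. M q c)"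
    by (rule jet_fn_common[of C S p "\<lambda>c q. M q c"]) (use C assms(2) in blast)+
  have "smooth_fn D p (\<lambda>q. h (\<lambda>c. M q c))"
    by (rule smooth_fn_compose[where N="\<lambda>c q. M q c", OF _ C(1) D(3)]) (use C(3) in simp)
  then show ?thesis using jet_fnI[OF D(1,2)] by simp
qed

text \<open>The component along the coordinate \<open>c\<close> of the vector field \<open>f\<^sub>u\<close>.\<close>

definition jet_velocity ::
  "'s set \<Rightarrow> ('s \<Rightarrow> ('s, 'i) jet \<Rightarrow> real) \<Rightarrow> ('s, 'i) coord \<Rightarrow> ('s, 'i) jet \<Rightarrow> real" where
  "jet_velocity S f c q =
     (case c of State s \<Rightarrow> if s \<in> S then f s q else 0 | Input j \<alpha> \<Rightarrow> q (Input j (Suc \<alpha>)))"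

text \<open>Replaces the series by one finite sum over states and inputs alike. \<open>C\<close> may
  be any finite set on which \<open>h\<close> depends: outside it the derivatives vanish, and on
  state names outside \<open>S\<close> the velocity does.\<close>

lemma total_deriv_eq_sum:
  fixes f :: "'s \<Rightarrow> ('s, 'i::finite) jet \<Rightarrow> real"
  assumes "finite S" "finite C" "depends_only C UNIV h"
  shows "total_deriv S f h q = (\<Sum>c\<in>C. jet_velocity S f c q * partial_deriv c h q)"
proof -
  \<comment> \<open>Exceeds every input order occurring in \<open>C\<close>; inserting 0 covers the
    case of no inputs at all.\<close>
  define M where "M = Suc (Max (insert 0 {\<alpha>. \<exists>j. Input j \<alpha> \<in> C}))"
  have "{\<alpha>. \<exists>j. Input j \<alpha> \<in> C} \<subseteq> (\<lambda>c. case c of State s \<Rightarrow> 0 | Input j \<alpha> \<Rightarrow> \<alpha>) ` C"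
    by force
  then have fin: "finite {\<alpha>. \<exists>j. Input j \<alpha> \<in> C}" using assms(2) finite_surj by blast
  have M: "\<alpha> < M" if "Input j \<alpha> \<in> C" for j \<alpha>
    using Max_ge[of "insert 0 {\<alpha>. \<exists>j. Input j \<alpha> \<in> C}" \<alpha>] fin that unfolding M_def less_Suc_eq_le by blast
  define t where "t c = jet_velocity S f c q * partial_deriv c h q" for c
  define I :: "('s, 'i) coord set" where "I = (\<lambda>(\<alpha>, j). Input j \<alpha>) ` ({..<M} \<times> (UNIV :: 'i set))"
  have out: "t c = 0" if "c \<notin> C" for c
    using partial_deriv_indep[OF assms(3) that] by (simp add: t_def)
  have "(\<Sum>\<alpha>. \<Sum>j\<in>UNIV. q (Input j (Suc \<alpha>)) * partial_deriv (Input j \<alpha>) h q) =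
      (\<Sum>\<alpha><M. \<Sum>j\<in>UNIV. t (Input j \<alpha>))"
    unfolding t_def jet_velocity_def
    by (subst suminf_finite[of "{..<M}"])
      (auto intro!: sum.neutral partial_deriv_indep[OF assms(3)] dest: M)
  also have "\<dots> = (\<Sum>c\<in>I. t c)"
    unfolding I_def by (subst sum.reindex) (auto simp: inj_on_def sum.cartesian_product case_prod_beta)
  finally have inputs: "(\<Sum>\<alpha>. \<Sum>j\<in>UNIV. q (Input j (Suc \<alpha>)) * partial_deriv (Input j \<alpha>) h q) = (\<Sum>c\<in>I. t c)" .
  have states: "(\<Sum>s\<in>S. f s q * partial_deriv (State s) h q) = (\<Sum>c\<in>State ` S. t c)"
    by (subst sum.reindex) (auto simp: inj_on_def t_def jet_velocity_def)
  have "(\<Sum>c\<in>State ` S. t c) + (\<Sum>c\<in>I. t c) = (\<Sum>c\<in>State ` S \<union> I. t c)"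
    using assms(1) by (intro sum.union_disjoint[symmetric]) (auto simp: I_def)
  also have "\<dots> = (\<Sum>c\<in>State ` S \<union> I \<union> C. t c)"
  proof (rule sum.mono_neutral_left)
    show "\<forall>c\<in>State ` S \<union> I \<union> C - (State ` S \<union> I). t c = 0"
    proof
      fix c assume c: "c \<in> State ` S \<union> I \<union> C - (State ` S \<union> I)"
      then show "t c = 0"
      proof (cases c)
        case (State s)
        then show ?thesis using c by (auto simp: t_def jet_velocity_def)
      next
        case (Input j \<alpha>)
        then have "Input j \<alpha> \<in> I" using c M[of j \<alpha>] by (auto simp: I_def)
        then show ?thesis using c Input by simp
      qed
    qed
  qed (use assms in \<open>auto simp: I_def\<close>)
  also have "\<dots> = (\<Sum>c\<in>C. t c)"
    by (rule sum.mono_neutral_right) (use assms out in \<open>auto simp: I_def\<close>)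
  finally show ?thesis
    unfolding total_deriv_def inputs states by (simp add: t_def)
qed

lemma total_deriv_coord:
  fixes f :: "'s \<Rightarrow> ('s, 'i::finite) jet \<Rightarrow> real"
  shows "finite S \<Longrightarrow> total_deriv S f (\<lambda>q. q c) q = jet_velocity S f c q"
  by (subst total_deriv_eq_sum[of S "{c}"]) (auto simp: partial_deriv_coord depends_only_coord)

lemma total_deriv_cong_ev:
  assumes "\<forall>\<^sub>F q in nhds p. h q = h' q"
  shows "\<forall>\<^sub>F q in nhds p. total_deriv S f h q = total_deriv S f h' q"
  using assms[THEN eventually_eventually[THEN iffD2]]
proof (rule eventually_mono)
  fix q assume "\<forall>\<^sub>F q in nhds q. h q = h' q"
  then have "partial_deriv c h q = partial_deriv c h' q" for c by (rule partial_deriv_cong_ev)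
  then show "total_deriv S f h q = total_deriv S f h' q" by (simp add: total_deriv_def)
qed

lemma time_deriv_0 [simp]: "time_deriv S f 0 h = h"
  and time_deriv_Suc: "time_deriv S f (Suc \<alpha>) h = total_deriv S f (time_deriv S f \<alpha> h)"
  by (simp_all add: time_deriv_def)

lemma time_deriv_add: "time_deriv S f \<alpha> (time_deriv S f \<beta> h) = time_deriv S f (\<beta> + \<alpha>) h"
  by (simp add: time_deriv_def funpow_add add.commute[of \<beta>])

lemma time_deriv_cong_ev:
  assumes "\<forall>\<^sub>F q in nhds p. h q = h' q"
  shows "\<forall>\<^sub>F q in nhds p. time_deriv S f \<alpha> h q = time_deriv S f \<alpha> h' q"
proof (induction \<alpha>)
  case (Suc \<alpha>)
  then show ?case unfolding time_deriv_Suc by (rule total_deriv_cong_ev)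
qed (simp add: assms)

lemma time_deriv_input:
  fixes f :: "'s \<Rightarrow> ('s, 'i::finite) jet \<Rightarrow> real"
  assumes "finite S"
  shows "time_deriv S f \<alpha> (\<lambda>q. q (Input j 0)) = (\<lambda>q. q (Input j \<alpha>))"
proof (induction \<alpha>)
  case (Suc \<alpha>)
  then show ?case
    unfolding time_deriv_Suc using total_deriv_coord[OF assms, of f "Input j \<alpha>"]
    by (auto simp: jet_velocity_def)
qed simp

lemma jet_fn_velocity:
  fixes f :: "'s \<Rightarrow> ('s, 'i::finite) jet \<Rightarrow> real"
  assumes "control_system S f p" "c \<in> jet_names S"
  shows "jet_fn S p (jet_velocity S f c)"
proof (cases c)
  case (State s)
  then have "jet_velocity S f c = f s" using assms(2) by (auto simp: jet_velocity_def fun_eq_iff)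
  moreover have "jet_fn S p (f s)"
    using assms State finite_jet_coords[of S "\<lambda>_. 0"] jet_coords_subset
    by (intro jet_fnI[of "xu_coords S"]) (auto simp: control_system_def)
  ultimately show ?thesis by simp
next
  case (Input j \<alpha>)
  then have "jet_velocity S f c = (\<lambda>q. q (Input j (Suc \<alpha>)))" by (simp add: jet_velocity_def fun_eq_iff)
  then show ?thesis by (simp add: jet_fn_coord)
qed

lemma jet_fn_total_deriv:
  fixes f :: "'s \<Rightarrow> ('s, 'i::finite) jet \<Rightarrow> real"
  assumes "control_system S f p" "jet_fn S p h"
  shows "jet_fn S p (total_deriv S f h)"
proof -
  obtain C where C: "finite C" "C \<subseteq> jet_names S" "smooth_fn C p h"
    using assms(2) unfolding jet_fn_def by blast
  have "finite S" using assms(1) by (simp add: control_system_def)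
  then have "total_deriv S f h = (\<lambda>q. \<Sum>c\<in>C. jet_velocity S f c q * partial_deriv c h q)"
    by (intro ext total_deriv_eq_sum C(1) smooth_fn_depends_only[OF C(3)])
  moreover have "jet_fn S p (\<lambda>q. \<Sum>c\<in>C. jet_velocity S f c q * partial_deriv c h q)"
    using C(2) by (intro jet_fn_sum C(1) jet_fn_mult jet_fn_velocity assms jet_fn_partial_deriv) auto
  ultimately show ?thesis by simp
qed

lemma jet_fn_time_deriv:
  fixes f :: "'s \<Rightarrow> ('s, 'i::finite) jet \<Rightarrow> real"
  assumes "control_system S f p" "jet_fn S p h"
  shows "jet_fn S p (time_deriv S f \<alpha> h)"
  by (induction \<alpha>) (simp_all add: assms time_deriv_Suc jet_fn_total_deriv)

section \<open>Maps of jet spaces that respect time derivatives\<close>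

text \<open>\<open>M\<close> relates the two vector fields, tested on coordinate functions only.
  Continuity is asked for all coordinates, idle ones included, so that neighbourhoods can be pulled
  back.\<close>

definition jet_morphism ::
  "'s set \<Rightarrow> ('s \<Rightarrow> ('s, 'i::finite) jet \<Rightarrow> real) \<Rightarrow> ('s, 'i) jet \<Rightarrow>
   't set \<Rightarrow> ('t \<Rightarrow> ('t, 'i) jet \<Rightarrow> real) \<Rightarrow> (('s, 'i) jet \<Rightarrow> ('t, 'i) jet) \<Rightarrow> bool" where
  "jet_morphism S f p S' f' M \<longleftrightarrow> (M \<longlongrightarrow> M p) (nhds p) \<and>
     (\<forall>c\<in>jet_names S'. jet_fn S p (\<lambda>q. M q c) \<and>
        (\<forall>\<^sub>F q in nhds p. total_deriv S f (\<lambda>q. M q c) q = jet_velocity S' f' c (M q)))"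

text \<open>Both total derivatives are derivations, so by the chain rule their agreement on
  coordinate functions extends to all functions of finite order.\<close>

lemma jet_morphism_total_deriv:
  fixes f :: "'s \<Rightarrow> ('s, 'i::finite) jet \<Rightarrow> real"
  assumes "finite S" "finite S'" and M: "jet_morphism S f p S' f' M" and "jet_fn S' (M p) h"
  shows "\<forall>\<^sub>F q in nhds p. total_deriv S f (\<lambda>q. h (M q)) q = total_deriv S' f' h (M q)"
proof -
  obtain C where C: "finite C" "C \<subseteq> jet_names S'" "smooth_fn C (M p) h"
    using assms(4) unfolding jet_fn_def by blast
  obtain D where D: "finite D" "D \<subseteq> jet_names S" "\<And>c. c \<in> C \<Longrightarrow> smooth_fn D p (\<lambda>q. M q c)"
    by (rule jet_fn_common[of C S p "\<lambda>c q. M q c"]) (use C M in \<open>auto simp: jet_morphism_def\<close>)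
  have hM: "smooth_fn D p (\<lambda>q. h (M q))"
    using smooth_fn_compose[where N="\<lambda>c q. M q c" and D=D, of C p h] C(1,3) D(3) by simp
  have "\<forall>\<^sub>F q in nhds p. \<forall>d\<in>D. partial_deriv d (\<lambda>q. h (M q)) q =
      (\<Sum>c\<in>C. partial_deriv c h (M q) * partial_deriv d (\<lambda>q. M q c) q)"
    using partial_deriv_compose_ev[where N="\<lambda>c q. M q c" and C=C and p=p and h=h] C(1,3)
      smooth_fn_smooth_at[OF D(3)]
    by (intro eventually_ball_finite D(1) ballI) simp
  moreover have "\<forall>\<^sub>F q in nhds p. \<forall>c\<in>C. total_deriv S f (\<lambda>q. M q c) q = jet_velocity S' f' c (M q)"
    using M C by (intro eventually_ball_finite) (auto simp: jet_morphism_def)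
  ultimately show ?thesis
  proof eventually_elim
    case (elim q)
    have "total_deriv S f (\<lambda>q. h (M q)) q = (\<Sum>d\<in>D. jet_velocity S f d q *
        (\<Sum>c\<in>C. partial_deriv c h (M q) * partial_deriv d (\<lambda>q. M q c) q))"
      using elim(1) by (simp add: total_deriv_eq_sum[OF assms(1) D(1) smooth_fn_depends_only[OF hM]])
    also have "\<dots> = (\<Sum>d\<in>D. \<Sum>c\<in>C. (jet_velocity S f d q * partial_deriv d (\<lambda>q. M q c) q) * partial_deriv c h (M q))"
      by (simp add: sum_distrib_left ac_simps)
    also have "\<dots> = (\<Sum>c\<in>C. (\<Sum>d\<in>D. jet_velocity S f d q * partial_deriv d (\<lambda>q. M q c) q) * partial_deriv c h (M q))"
      by (subst sum.swap) (simp add: sum_distrib_right)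
    also have "\<dots> = (\<Sum>c\<in>C. total_deriv S f (\<lambda>q. M q c) q * partial_deriv c h (M q))"
      by (intro sum.cong refl arg_cong2[where f="(*)"] total_deriv_eq_sum[symmetric] assms(1) D(1)
          smooth_fn_depends_only[OF D(3)])
    also have "\<dots> = total_deriv S' f' h (M q)"
      using elim(2) by (simp add: total_deriv_eq_sum[OF assms(2) C(1) smooth_fn_depends_only[OF C(3)]])
    finally show ?case .
  qed
qed

lemma jet_morphism_compose:
  fixes S :: "'s set" and S' :: "'t set" and S'' :: "'u set" and f :: "'s \<Rightarrow> ('s, 'i::finite) jet \<Rightarrow> real"
  assumes "finite S" "finite S'" "jet_morphism S f p S' f' M" "jet_morphism S' f' (M p) S'' f'' M'"
  shows "jet_morphism S f p S'' f'' (\<lambda>q. M' (M q))"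
  unfolding jet_morphism_def
proof (intro conjI ballI)
  have cont: "(M \<longlongrightarrow> M p) (nhds p)" using assms(3) by (simp add: jet_morphism_def)
  then show "((\<lambda>q. M' (M q)) \<longlongrightarrow> M' (M p)) (nhds p)"
    using assms(4) filterlim_compose[of M' "nhds (M' (M p))" "nhds (M p)" M]
    unfolding jet_morphism_def by blast
  fix c :: "('u, 'i) coord" assume c: "c \<in> jet_names S''"
  then have M'c: "jet_fn S' (M p) (\<lambda>q. M' q c)"
    and ev: "\<forall>\<^sub>F q in nhds (M p). total_deriv S' f' (\<lambda>q. M' q c) q = jet_velocity S'' f'' c (M' q)"
    using assms(4) by (auto simp: jet_morphism_def)
  show "jet_fn S p (\<lambda>q. M' (M q) c)"
    using jet_fn_compose[where M=M and p=p, OF M'c] assms(3) by (simp add: jet_morphism_def)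
  show "\<forall>\<^sub>F q in nhds p. total_deriv S f (\<lambda>q. M' (M q) c) q = jet_velocity S'' f'' c (M' (M q))"
    using jet_morphism_total_deriv[OF assms(1-3) M'c] eventually_compose_filterlim[OF ev cont]
    by eventually_elim simp
qed

lemma jet_morphism_time_deriv:
  fixes f :: "'s \<Rightarrow> ('s, 'i::finite) jet \<Rightarrow> real"
  assumes "finite S" "control_system S' f' (M p)" "jet_morphism S f p S' f' M" "jet_fn S' (M p) h"
  shows "\<forall>\<^sub>F q in nhds p. time_deriv S f \<alpha> (\<lambda>q. h (M q)) q = time_deriv S' f' \<alpha> h (M q)"
proof (induction \<alpha>)
  case (Suc \<alpha>)
  have "finite S'" using assms(2) by (simp add: control_system_def)
  from total_deriv_cong_ev[OF Suc.IH, of S f]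
    jet_morphism_total_deriv[OF assms(1) this assms(3) jet_fn_time_deriv[OF assms(2,4), of \<alpha>]]
  show ?case unfolding time_deriv_Suc by eventually_elim simp
qed simp


section \<open>Static feedback and prolongation\<close>

lemma with_inputs_simps [simp]:
  "with_inputs \<Phi> (State s) q = q (State s)" "with_inputs \<Phi> (Input j \<alpha>) q = \<Phi> j q"
  by (simp_all add: with_inputs_def)

lemma jet_map_simps [simp]:
  "jet_map S f \<Phi> q (State s) = q (State s)"
  "jet_map S f \<Phi> q (Input j \<alpha>) = time_deriv S f \<alpha> (\<Phi> j) q"
  by (simp_all add: jet_map_def)

lemma jet_map_eq_with_inputs: "c \<in> xu_coords S \<Longrightarrow> jet_map S' f \<Phi> q c = with_inputs \<Phi> c q"
  by (cases c) auto

lemma jet_fn_input_transformation: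
  fixes \<Phi> :: "'i::finite \<Rightarrow> ('s, 'i) jet \<Rightarrow> real"
  assumes "finite S" "smooth_fn (xu_coords S) p (with_inputs \<Phi> (Input j 0))"
  shows "jet_fn S p (\<Phi> j)"
proof -
  have "with_inputs \<Phi> (Input j 0) = \<Phi> j" by (simp add: fun_eq_iff)
  then show ?thesis using assms jet_fnI[OF finite_jet_coords jet_coords_subset] by metis
qed

lemma tendsto_jet_map:
  fixes f :: "'s \<Rightarrow> ('s, 'i::finite) jet \<Rightarrow> real"
  assumes "control_system S f p" "\<And>j. jet_fn S p (\<Phi> j)"
  shows "(jet_map S f \<Phi> \<longlongrightarrow> jet_map S f \<Phi> p) (nhds p)"
  unfolding tendsto_fun_iff
proof
  fix c
  show "((\<lambda>q. jet_map S f \<Phi> q c) \<longlongrightarrow> jet_map S f \<Phi> p c) (nhds p)"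
  proof (cases c)
    case (Input j \<alpha>)
    show ?thesis
      using smooth_at_tendsto[OF jet_fn_smooth_at[OF jet_fn_time_deriv[OF assms(1,2), of \<alpha> j]]]
      by (simp add: Input)
  qed (simp add: tendsto_fun_coord)
qed

text \<open>On inputs the condition holds by construction, as each component is the time derivative
  of the preceding one; only the state equations remain to be checked.\<close>

lemma jet_morphism_jet_map:
  fixes f :: "'s \<Rightarrow> ('s, 'i::finite) jet \<Rightarrow> real"
  assumes "control_system S f p" "\<And>j. jet_fn S p (\<Phi> j)"
    and "\<And>s. s \<in> S \<Longrightarrow> \<forall>\<^sub>F q in nhds p. g s (jet_map S f \<Phi> q) = f s q"
  shows "jet_morphism S f p S g (jet_map S f \<Phi>)"
  unfolding jet_morphism_def
proof (intro conjI ballI)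
  show "(jet_map S f \<Phi> \<longlongrightarrow> jet_map S f \<Phi> p) (nhds p)" by (rule tendsto_jet_map[OF assms(1,2)])
  have fin: "finite S" using assms(1) by (simp add: control_system_def)
  fix c :: "('s, 'i) coord" assume c: "c \<in> jet_names S"
  show "jet_fn S p (\<lambda>q. jet_map S f \<Phi> q c)"
  proof (cases c)
    case (State s)
    then show ?thesis using jet_fn_coord[OF c] by simp
  next
    case (Input j \<alpha>)
    then show ?thesis using jet_fn_time_deriv[OF assms(1,2), of \<alpha> j] by simp
  qed
  show "\<forall>\<^sub>F q in nhds p. total_deriv S f (\<lambda>q. jet_map S f \<Phi> q c) q =
      jet_velocity S g c (jet_map S f \<Phi> q)"
  proof (cases c)
    case (State s)
    then have s: "s \<in> S" using c by simp
    show ?thesis using assms(3)[OF s]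
      by eventually_elim (simp add: State s total_deriv_coord[OF fin] jet_velocity_def)
  next
    case (Input j \<alpha>)
    show ?thesis by (simp add: Input jet_velocity_def time_deriv_Suc)
  qed
qed

section \<open>Static feedback as an invertible map of jet spaces\<close>

context
  fixes S :: "'s set" and f :: "'s \<Rightarrow> ('s, 'i::finite) jet \<Rightarrow> real" and p :: "('s, 'i) jet"
    and \<Phi> \<Psi> :: "'i \<Rightarrow> ('s, 'i) jet \<Rightarrow> real"
  assumes control: "control_system S f p" and trafo: "input_transformation S p \<Phi> \<Psi>"
begin

lemma finite_states: "finite S"
  using control by (simp add: control_system_def)

lemma jet_fn_\<Phi>: "jet_fn S p (\<Phi> j)"
  by (rule jet_fn_input_transformation[OF finite_states])
    (use trafo in \<open>simp add: input_transformation_def local_diffeo_def\<close>)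

lemma eventually_\<Psi>_\<Phi>: "\<forall>\<^sub>F q in nhds p. \<forall>c\<in>xu_coords S. with_inputs \<Psi> c (jet_map S f \<Phi> q) = q c"
proof -
  have "\<forall>\<^sub>F q in nhds p. \<forall>c\<in>xu_coords S. with_inputs \<Psi> c (\<lambda>b. with_inputs \<Phi> b q) = q c"
    using trafo by (simp add: input_transformation_def local_diffeo_def)
  then show ?thesis
  proof (rule eventually_mono, intro ballI)
    fix q :: "('s, 'i) jet" and c :: "('s, 'i) coord"
    assume c: "c \<in> xu_coords S"
      and q: "\<forall>c\<in>xu_coords S. with_inputs \<Psi> c (\<lambda>b. with_inputs \<Phi> b q) = q c"
    have "depends_only (xu_coords S) UNIV (with_inputs \<Psi> c)"
      using c trafo smooth_fn_depends_only by (fastforce simp: input_transformation_def local_diffeo_def)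
    then have "with_inputs \<Psi> c (jet_map S f \<Phi> q) = with_inputs \<Psi> c (\<lambda>b. with_inputs \<Phi> b q)"
      by (rule depends_onlyD) (rule jet_map_eq_with_inputs)
    then show "with_inputs \<Psi> c (jet_map S f \<Phi> q) = q c" using q c by simp
  qed
qed

lemma smooth_fn_\<Psi>: "c \<in> xu_coords S \<Longrightarrow> smooth_fn (xu_coords S) (jet_map S f \<Phi> p) (with_inputs \<Psi> c)"
  using trafo smooth_fn_cong_point[OF _ finite_jet_coords[OF finite_states],
      of "\<lambda>_. 0" "\<lambda>b. with_inputs \<Phi> b p" "with_inputs \<Psi> c" "jet_map S f \<Phi> p"]
  by (simp add: input_transformation_def local_diffeo_def jet_map_eq_with_inputs)

lemma jet_fn_\<Psi>: "jet_fn S (jet_map S f \<Phi> p) (\<Psi> j)"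
  by (rule jet_fn_input_transformation[OF finite_states smooth_fn_\<Psi>]) simp

lemma f_depends_only: "s \<in> S \<Longrightarrow> depends_only (xu_coords S) UNIV (f s)"
  using control smooth_fn_depends_only by (fastforce simp: control_system_def)

lemma control_system_feedback: "control_system S (feedback f \<Psi>) (jet_map S f \<Phi> p)"
  unfolding control_system_def
proof (intro conjI ballI finite_states)
  fix s assume s: "s \<in> S"
  have "smooth_fn (xu_coords S) (jet_map S f \<Phi> p) (\<lambda>q. f s (\<lambda>c. with_inputs \<Psi> c q))"
  proof (rule smooth_fn_compose[where N="with_inputs \<Psi>" and h="f s"])
    show "smooth_fn (xu_coords S) (\<lambda>c. with_inputs \<Psi> c (jet_map S f \<Phi> p)) (f s)"
      by (rule smooth_fn_cong_point[of _ p])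
        (use control s eventually_nhds_x_imp_x[OF eventually_\<Psi>_\<Phi>] finite_jet_coords[OF finite_states] in
          \<open>auto simp: control_system_def\<close>)
  qed (use finite_jet_coords[OF finite_states] smooth_fn_\<Psi> in auto)
  moreover have "feedback f \<Psi> s = (\<lambda>q. f s (\<lambda>c. with_inputs \<Psi> c q))"
    by (simp add: feedback_def fun_eq_iff)
  ultimately show "smooth_fn (xu_coords S) (jet_map S f \<Phi> p) (feedback f \<Psi> s)" by simp
qed

lemma jet_morphism_feedback: "jet_morphism S f p S (feedback f \<Psi>) (jet_map S f \<Phi>)"
proof (rule jet_morphism_jet_map[OF control jet_fn_\<Phi>])
  fix s assume s: "s \<in> S"
  show "\<forall>\<^sub>F q in nhds p. feedback f \<Psi> s (jet_map S f \<Phi> q) = f s q"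
    using eventually_\<Psi>_\<Phi>
    by (rule eventually_mono) (auto simp: feedback_def intro!: depends_onlyD[OF f_depends_only[OF s]])
qed

lemma jet_morphism_feedback_back:
  "jet_morphism S (feedback f \<Psi>) (jet_map S f \<Phi> p) S f (jet_map S (feedback f \<Psi>) \<Psi>)"
proof (rule jet_morphism_jet_map[OF control_system_feedback jet_fn_\<Psi>])
  fix s assume s: "s \<in> S"
  have "f s (jet_map S (feedback f \<Psi>) \<Psi> q) = feedback f \<Psi> s q" for q
    unfolding feedback_def by (rule depends_onlyD[OF f_depends_only[OF s]]) (rule jet_map_eq_with_inputs)
  then show "\<forall>\<^sub>F q in nhds (jet_map S f \<Phi> p). f s (jet_map S (feedback f \<Psi>) \<Psi> q) = feedback f \<Psi> s q"
    by simp
qed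

text \<open>Order 0 is the given input transformation, and higher orders follow because morphisms
  commute with time derivatives. One coordinate is treated at a time, as the neighbourhood may
  shrink with the order.\<close>

lemma jet_map_feedback_inverse:
  "\<forall>\<^sub>F q in nhds p. jet_map S (feedback f \<Psi>) \<Psi> (jet_map S f \<Phi> q) c = q c"
proof (cases c)
  case (Input j \<alpha>)
  have "\<forall>\<^sub>F q in nhds p. \<Psi> j (jet_map S f \<Phi> q) = q (Input j 0)"
    using eventually_\<Psi>_\<Phi> by (rule eventually_mono) (force dest: bspec[of _ _ "Input j 0"])
  from time_deriv_cong_ev[OF this, of S f \<alpha>]
    jet_morphism_time_deriv[OF finite_states control_system_feedback jet_morphism_feedback jet_fn_\<Psi>, of \<alpha> j]
  show ?thesis by eventually_elim (simp add: Input time_deriv_input[OF finite_states])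
qed simp

lemma jet_map_feedback_inverse_point: "jet_map S (feedback f \<Psi>) \<Psi> (jet_map S f \<Phi> p) = p"
  by (rule ext) (rule eventually_nhds_x_imp_x[OF jet_map_feedback_inverse])

text \<open>The transformation is known near a point that carries the new inputs at every order,
  while the jet carries their derivatives. Both agree in state and undifferentiated input, which is
  all that \<open>\<Phi>\<close> and \<open>\<Psi>\<close> see.\<close>

lemma eventually_\<Phi>_\<Psi>:
  "\<forall>\<^sub>F r in nhds (jet_map S f \<Phi> p). \<Phi> j (jet_map S (feedback f \<Psi>) \<Psi> r) = r (Input j 0)"
proof -
  have dep: "depends_only (xu_coords S) UNIV (\<Phi> j)" and dep': "c \<in> xu_coords S \<Longrightarrow> depends_only (xu_coords S) UNIV (with_inputs \<Psi> c)" for c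
    using trafo smooth_fn_depends_only[of "xu_coords S" p "with_inputs \<Phi> (Input j 0)"]
      smooth_fn_depends_only[OF smooth_fn_\<Psi>]
    by (auto simp: input_transformation_def local_diffeo_def depends_only_def)
  have eq: "\<Phi> j (jet_map S (feedback f \<Psi>) \<Psi> r) = \<Phi> j (\<lambda>c. with_inputs \<Psi> c r)" for r
    by (rule depends_onlyD[OF dep]) (rule jet_map_eq_with_inputs)
  have "\<forall>\<^sub>F r in nhds (\<lambda>b. with_inputs \<Phi> b p). \<forall>b\<in>xu_coords S. with_inputs \<Phi> b (\<lambda>a. with_inputs \<Psi> a r) = r b"
    using trafo by (simp add: input_transformation_def local_diffeo_def)
  then have "\<forall>\<^sub>F r in nhds (\<lambda>b. with_inputs \<Phi> b p). \<Phi> j (\<lambda>a. with_inputs \<Psi> a r) = r (Input j 0)"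
    by (rule eventually_mono) (force dest: bspec[of _ _ "Input j 0"])
  then show ?thesis unfolding eq
  proof (rule eventually_nhds_agree[where C="xu_coords S"])
    show "\<forall>c\<in>xu_coords S. with_inputs \<Phi> c p = jet_map S f \<Phi> p c"
      by (simp add: jet_map_eq_with_inputs)
    fix q q' :: "('s, 'i) jet"
    assume q: "\<And>c. c \<in> xu_coords S \<Longrightarrow> q c = q' c" "\<Phi> j (\<lambda>c. with_inputs \<Psi> c q) = q (Input j 0)"
    have "\<Phi> j (\<lambda>c. with_inputs \<Psi> c q) = \<Phi> j (\<lambda>c. with_inputs \<Psi> c q')"
      by (rule depends_onlyD[OF dep]) (rule depends_onlyD[OF dep' q(1)])
    then show "\<Phi> j (\<lambda>c. with_inputs \<Psi> c q') = q' (Input j 0)" using q by simp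
  qed
qed

lemma jet_map_feedback_inverse':
  "\<forall>\<^sub>F r in nhds (jet_map S f \<Phi> p). jet_map S f \<Phi> (jet_map S (feedback f \<Psi>) \<Psi> r) c = r c"
proof (cases c)
  case (Input j \<alpha>)
  have *: "control_system S f (jet_map S (feedback f \<Psi>) \<Psi> (jet_map S f \<Phi> p))"
    "jet_fn S (jet_map S (feedback f \<Psi>) \<Psi> (jet_map S f \<Phi> p)) (\<Phi> j)"
    by (simp_all add: jet_map_feedback_inverse_point control jet_fn_\<Phi>)
  from time_deriv_cong_ev[OF eventually_\<Phi>_\<Psi>, of S "feedback f \<Psi>" \<alpha> j]
    jet_morphism_time_deriv[OF finite_states *(1) jet_morphism_feedback_back *(2), of \<alpha>]
  show ?thesis by eventually_elim (simp add: Input time_deriv_input[OF finite_states])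
qed simp

end

section \<open>Prolongation as a renaming of jet coordinates\<close>

lemma finite_prolonged_states:
  fixes S :: "'s set" and D :: "'i::finite \<Rightarrow> nat"
  assumes "finite S"
  shows "finite (prolonged_states S D)"
  unfolding prolonged_states_def
  by (rule finite_subset[OF _ finite_jet_coords[OF assms, of D]]) (auto simp: jet_coords_def)

lemma prolonged_states_simps [simp]:
  "State s \<in> prolonged_states S D \<longleftrightarrow> s \<in> S" "Input j \<alpha> \<in> prolonged_states S D \<longleftrightarrow> \<alpha> < D j"
  by (auto simp: prolonged_states_def)

lemma from_prolonged_simps [simp]:
  "from_prolonged D e (State s) = e (State (State s))"
  "\<alpha> < D j \<Longrightarrow> from_prolonged D e (Input j \<alpha>) = e (State (Input j \<alpha>))"
  "D j \<le> \<alpha> \<Longrightarrow> from_prolonged D e (Input j \<alpha>) = e (Input j (\<alpha> - D j))"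
  by (simp_all add: from_prolonged_def)

lemma from_to_prolonged: "from_prolonged D (to_prolonged D q) = q"
proof
  fix c show "from_prolonged D (to_prolonged D q) c = q c"
    by (cases c) (simp_all add: from_prolonged_def to_prolonged_def)
qed

lemma to_from_prolonged:
  "c \<in> jet_names (prolonged_states S D) \<Longrightarrow> to_prolonged D (from_prolonged D e) c = e c"
  by (cases c) (auto simp: to_prolonged_def prolonged_states_def from_prolonged_def)

text \<open>Shows each component of \<open>from_prolonged\<close> to be a single coordinate, which
  reduces its smoothness and its time derivative to those of coordinates.\<close>

definition prolonged_name :: "('i \<Rightarrow> nat) \<Rightarrow> ('s, 'i) coord \<Rightarrow> (('s, 'i) coord, 'i) coord" where
  "prolonged_name D c = (case c of State s \<Rightarrow> State (State s)
     | Input j \<alpha> \<Rightarrow> if \<alpha> < D j then State (Input j \<alpha>) else Input j (\<alpha> - D j))"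

lemma from_prolonged_eq: "from_prolonged D e c = e (prolonged_name D c)"
  by (simp add: prolonged_name_def from_prolonged_def split: coord.split)

lemma prolonged_name_mem:
  "c \<in> jet_names S \<Longrightarrow> prolonged_name D c \<in> jet_names (prolonged_states S D)"
  "c \<in> xu_coords S \<Longrightarrow> prolonged_name D c \<in> xu_coords (prolonged_states S D)"
  by (cases c; auto simp: prolonged_name_def)+

lemma jet_velocity_prolonged_name:
  assumes "c \<in> jet_names S"
  shows "jet_velocity (prolonged_states S D) (prolonged_dynamics g D) (prolonged_name D c) q =
    jet_velocity S g c (from_prolonged D q)"
  using assms
  by (cases c) (auto simp: jet_velocity_def prolonged_name_def prolonged_dynamics_def Suc_diff_le)

lemma control_system_prolonged:
  fixes g :: "'s \<Rightarrow> ('s, 'i::finite) jet \<Rightarrow> real"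
  assumes "control_system S g (from_prolonged D e)"
  shows "control_system (prolonged_states S D) (prolonged_dynamics g D) e"
  unfolding control_system_def
proof (intro conjI ballI)
  have fin: "finite S" using assms by (simp add: control_system_def)
  then show "finite (prolonged_states S D)" by (rule finite_prolonged_states)
  fix c assume c: "c \<in> prolonged_states S D"
  have coord: "smooth_fn (xu_coords (prolonged_states S D)) e (\<lambda>e. from_prolonged D e c)"
    if "c \<in> xu_coords S" for c
    unfolding from_prolonged_eq by (rule smooth_fn_coord[OF prolonged_name_mem(2)[OF that]])
  show "smooth_fn (xu_coords (prolonged_states S D)) e (prolonged_dynamics g D c)"
  proof (cases c)
    case (State s)
    have "smooth_fn (xu_coords (prolonged_states S D)) e (\<lambda>e. g s (\<lambda>c. from_prolonged D e c))"
    proof (rule smooth_fn_compose[where N="\<lambda>c e. from_prolonged D e c" and C="xu_coords S"])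
      show "smooth_fn (xu_coords S) (\<lambda>c. from_prolonged D e c) (g s)"
        using assms c by (simp add: control_system_def State)
    qed (use finite_jet_coords[OF fin] coord in auto)
    moreover have "prolonged_dynamics g D c = (\<lambda>e. g s (from_prolonged D e))"
      by (simp add: prolonged_dynamics_def State fun_eq_iff)
    ultimately show ?thesis by simp
  next
    case (Input j \<alpha>)
    have "prolonged_dynamics g D c = (\<lambda>e. from_prolonged D e (Input j (Suc \<alpha>)))"
      by (simp add: prolonged_dynamics_def Input fun_eq_iff)
    \<comment> \<open>The last integrator, with \<open>Suc \<alpha> = D j\<close>, is driven by the
      new input; all earlier ones by the next state.\<close>
    also have "\<dots> = (\<lambda>e. e (if Suc \<alpha> < D j then State (Input j (Suc \<alpha>)) else Input j 0))"
      using c by (auto simp: Input fun_eq_iff not_less)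
    finally show ?thesis by (auto intro!: smooth_fn_coord)
  qed
qed

lemma jet_morphism_from_prolonged:
  fixes g :: "'s \<Rightarrow> ('s, 'i::finite) jet \<Rightarrow> real"
  assumes "finite S"
  shows "jet_morphism (prolonged_states S D) (prolonged_dynamics g D) e S g (from_prolonged D)"
  unfolding jet_morphism_def
proof (intro conjI ballI)
  show "(from_prolonged D \<longlongrightarrow> from_prolonged D e) (nhds e)"
    unfolding tendsto_fun_iff
  proof
    fix c :: "('s, 'i) coord"
    show "((\<lambda>q. from_prolonged D q c) \<longlongrightarrow> from_prolonged D e c) (nhds e)"
      unfolding from_prolonged_eq by (rule tendsto_fun_coord)
  qed
  fix c :: "('s, 'i) coord" assume c: "c \<in> jet_names S"
  show "jet_fn (prolonged_states S D) e (\<lambda>q. from_prolonged D q c)"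
    unfolding from_prolonged_eq by (rule jet_fn_coord[OF prolonged_name_mem(1)[OF c]])
  have "total_deriv (prolonged_states S D) (prolonged_dynamics g D) (\<lambda>q. from_prolonged D q c) q =
      jet_velocity S g c (from_prolonged D q)" for q
    unfolding from_prolonged_eq[of D _ c] total_deriv_coord[OF finite_prolonged_states[OF assms]]
    by (rule jet_velocity_prolonged_name[OF c])
  then show "\<forall>\<^sub>F q in nhds e. total_deriv (prolonged_states S D) (prolonged_dynamics g D)
      (\<lambda>q. from_prolonged D q c) q = jet_velocity S g c (from_prolonged D q)" by simp
qed

section \<open>Linearization of the extended system\<close>

lemma local_diffeo_smooth:
  assumes "local_diffeo A B T X p" "finite A" "finite B" "\<And>b. b \<in> B \<Longrightarrow> T b p = q b" "a \<in> A"
  shows "smooth_fn B q (X a)"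
  using assms smooth_fn_cong_point[of B "\<lambda>b. T b p" "X a" q] by (simp add: local_diffeo_def)

lemma local_diffeo_inverse:
  assumes TX: "local_diffeo A B T X p" and fin: "finite A" "finite B" and q: "\<And>b. b \<in> B \<Longrightarrow> T b p = q b"
  shows "local_diffeo B A X T q"
proof -
  have T: "smooth_fn A p (T b)" if "b \<in> B" for b using TX that by (simp add: local_diffeo_def)
  have X: "smooth_fn B q (X a)" if "a \<in> A" for a by (rule local_diffeo_smooth[OF TX fin q that])
  note depT = depends_onlyD[OF smooth_fn_depends_only[OF T]]
  note depX = depends_onlyD[OF smooth_fn_depends_only[OF X]]
  have XT: "\<forall>\<^sub>F r in nhds p. \<forall>a\<in>A. X a (\<lambda>b. T b r) = r a"
    and TX': "\<forall>\<^sub>F r in nhds (\<lambda>b. T b p). \<forall>b\<in>B. T b (\<lambda>a. X a r) = r b"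
    using TX by (simp_all add: local_diffeo_def)
  have Xq: "X a q = p a" if "a \<in> A" for a
    using eventually_nhds_x_imp_x[OF XT] that depX[OF that, of "\<lambda>b. T b p" q] q by simp
  show ?thesis
    unfolding local_diffeo_def
  proof (intro conjI ballI)
    show "smooth_fn B q (X a)" if "a \<in> A" for a by (rule X[OF that])
    show "smooth_fn A (\<lambda>a. X a q) (T b)" if "b \<in> B" for b
      by (rule smooth_fn_cong_point[OF T[OF that] fin(1)]) (simp add: Xq)
    show "\<forall>\<^sub>F r in nhds q. \<forall>b\<in>B. T b (\<lambda>a. X a r) = r b"
    proof (rule eventually_nhds_agree[OF TX', of B])
      show "\<forall>b\<in>B. T b p = q b" using q by simp
      fix r r' assume r: "\<And>b. b \<in> B \<Longrightarrow> r b = r' b" "\<forall>b\<in>B. T b (\<lambda>a. X a r) = r b"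
      have "T b (\<lambda>a. X a r) = T b (\<lambda>a. X a r')" if "b \<in> B" for b
        by (rule depT[OF that]) (rule depX[OF _ r(1)])
      then show "\<forall>b\<in>B. T b (\<lambda>a. X a r') = r' b" using r by simp
    qed
    show "\<forall>\<^sub>F r in nhds (\<lambda>a. X a q). \<forall>a\<in>A. X a (\<lambda>b. T b r) = r a"
    proof (rule eventually_nhds_agree[OF XT, of A])
      show "\<forall>a\<in>A. p a = X a q" using Xq by simp
      fix r r' assume r: "\<And>b. b \<in> A \<Longrightarrow> r b = r' b" "\<forall>a\<in>A. X a (\<lambda>b. T b r) = r a"
      have "X a (\<lambda>b. T b r) = X a (\<lambda>b. T b r')" if "a \<in> A" for a
        by (rule depX[OF that]) (rule depT[OF _ r(1)])
      then show "\<forall>a\<in>A. X a (\<lambda>b. T b r') = r' a" using r by simp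
    qed
  qed
qed

section \<open>Diffeomorphisms from right inverses\<close>

text \<open>Differentiating \<open>H c (Z e) = e c\<close> shows that the Jacobian of
  \<open>H\<close> times that of \<open>Z\<close> is the identity on \<open>C\<close>; multiplying a
  relation among the rows of the first by the second leaves its coefficients.\<close>

lemma independent_of_right_inverse:
  fixes Z :: "('c \<Rightarrow> real) \<Rightarrow> 'b \<Rightarrow> real"
  assumes "finite B" "finite C"
    and H: "\<And>c. c \<in> C \<Longrightarrow> smooth_fn B (Z p) (H c)"
    and Z: "\<And>b. b \<in> B \<Longrightarrow> smooth_at p (\<lambda>e. Z e b)"
    and HZ: "\<And>c. c \<in> C \<Longrightarrow> \<forall>\<^sub>F e in nhds p. H c (Z e) = e c"
    and l: "\<And>b. b \<in> B \<Longrightarrow> (\<Sum>c\<in>C. l c * partial_deriv b (H c) (Z p)) = 0"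
  shows "\<forall>c\<in>C. l c = 0"
proof
  fix d assume d: "d \<in> C"
  have *: "(\<Sum>b\<in>B. partial_deriv b (H c) (Z p) * partial_deriv d (\<lambda>e. Z e b) p) = (if d = c then 1 else 0)"
    if c: "c \<in> C" for c
  proof -
    have "smooth_fn B (\<lambda>b. Z p b) (H c)" using H[OF c] by simp
    from eventually_nhds_x_imp_x[OF partial_deriv_compose_ev[where N="\<lambda>b e. Z e b", OF this assms(1) Z]]
    have "partial_deriv d (\<lambda>e. H c (Z e)) p =
        (\<Sum>b\<in>B. partial_deriv b (H c) (Z p) * partial_deriv d (\<lambda>e. Z e b) p)" by simp
    moreover have "partial_deriv d (\<lambda>e. H c (Z e)) p = (if d = c then 1 else 0)"
      by (subst partial_deriv_cong_ev[OF HZ[OF c]]) (rule partial_deriv_coord)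
    ultimately show ?thesis by simp
  qed
  have "(\<Sum>c\<in>C. l c * (if d = c then 1 else 0)) = (\<Sum>c\<in>C. if c = d then l c else 0)"
    by (intro sum.cong) auto
  then have "l d = (\<Sum>c\<in>C. l c * (if d = c then 1 else 0))"
    using assms(2) d by (simp add: sum.delta)
  also have "\<dots> = (\<Sum>c\<in>C. l c * (\<Sum>b\<in>B. partial_deriv b (H c) (Z p) * partial_deriv d (\<lambda>e. Z e b) p))"
    using * by (intro sum.cong) auto
  also have "\<dots> = (\<Sum>c\<in>C. \<Sum>b\<in>B. (l c * partial_deriv b (H c) (Z p)) * partial_deriv d (\<lambda>e. Z e b) p)"
    by (simp add: sum_distrib_left mult.assoc)
  also have "\<dots> = (\<Sum>b\<in>B. (\<Sum>c\<in>C. l c * partial_deriv b (H c) (Z p)) * partial_deriv d (\<lambda>e. Z e b) p)"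
    by (subst sum.swap) (simp add: sum_distrib_right)
  also have "\<dots> = 0" using l by simp
  finally show "l d = 0" .
qed

text \<open>The right inverse \<open>Z\<close> is allowed to depend on coordinates outside \<open>C\<close>.\<close>

lemma local_diffeo_of_right_inverse:
  fixes Z :: "('c \<Rightarrow> real) \<Rightarrow> 'b \<Rightarrow> real"
  assumes "finite B" "finite C" "card B = card C"
    and H: "\<And>c. c \<in> C \<Longrightarrow> smooth_fn B (Z p) (H c)"
    and Z: "\<And>b. smooth_at p (\<lambda>e. Z e b)"
    and HZ: "\<And>c. c \<in> C \<Longrightarrow> \<forall>\<^sub>F e in nhds p. H c (Z e) = e c"
  obtains T where "local_diffeo B C H T (Z p)" "local_diffeo C B T H p"
    "\<forall>\<^sub>F e in nhds p. \<forall>b\<in>B. T b e = Z e b"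
proof -
  have indep: "\<forall>c\<in>C. l c = 0"
    if "\<And>b. b \<in> B \<Longrightarrow> (\<Sum>c\<in>C. l c * partial_deriv b (H c) (Z p)) = 0" for l
    by (rule independent_of_right_inverse[OF assms(1,2) H Z HZ that])
  obtain T where T: "local_diffeo B C H T (Z p)"
    by (rule inverse_function[OF assms(1-3) H indep])
  have Hp: "H c (Z p) = p c" if "c \<in> C" for c using eventually_nhds_x_imp_x[OF HZ[OF that]] .
  have T': "local_diffeo C B T H p" by (rule local_diffeo_inverse[OF T]) (use assms Hp in auto)
  have "\<forall>\<^sub>F y in nhds (Z p). \<forall>b\<in>B. T b (\<lambda>c. H c y) = y b"
    using T by (simp add: local_diffeo_def)
  moreover have "(Z \<longlongrightarrow> Z p) (nhds p)"
    unfolding tendsto_fun_iff using smooth_at_tendsto[OF Z] by blast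
  ultimately have "\<forall>\<^sub>F e in nhds p. \<forall>b\<in>B. T b (\<lambda>c. H c (Z e)) = Z e b"
    by (rule eventually_compose_filterlim)
  moreover have "\<forall>\<^sub>F e in nhds p. \<forall>c\<in>C. H c (Z e) = e c"
    using HZ by (intro eventually_ball_finite assms(2)) blast
  \<comment> \<open>\<open>T\<close> undoes \<open>H\<close>, and it sees only coordinates in
    \<open>C\<close>, where \<open>H\<close> after \<open>Z\<close> is the identity. Hence
    \<open>Z\<close> locally has no dependence outside \<open>C\<close>.\<close>
  ultimately have "\<forall>\<^sub>F e in nhds p. \<forall>b\<in>B. T b e = Z e b"
  proof eventually_elim
    case (elim e)
    show ?case
    proof
      fix b assume b: "b \<in> B"
      have "depends_only C UNIV (T b)"
        using T' b smooth_fn_depends_only[of C p "T b"] by (simp add: local_diffeo_def)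
      then have "T b (\<lambda>c. H c (Z e)) = T b e" by (rule depends_onlyD) (use elim(2) in simp)
      then show "T b e = Z e b" using elim(1) b by simp
    qed
  qed
  then show thesis by (rule that[OF T T'])
qed

definition unprolonged_name :: "('i \<Rightarrow> nat) \<Rightarrow> (('s, 'i) coord, 'i) coord \<Rightarrow> ('s, 'i) coord" where
  "unprolonged_name D c = (case c of State c' \<Rightarrow> c' | Input j \<alpha> \<Rightarrow> Input j (D j + \<alpha>))"

lemma to_prolonged_eq: "to_prolonged D q c = q (unprolonged_name D c)"
  by (simp add: to_prolonged_def unprolonged_name_def split: coord.split)

section \<open>Dimension counts\<close>

lemma card_output_names:
  fixes R :: "'i::finite \<Rightarrow> nat"
  shows "finite {(j, \<alpha>). \<alpha> < R j}" "card {(j, \<alpha>). \<alpha> < R j} = (\<Sum>j\<in>UNIV. R j)"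
    "finite {(j, \<alpha>). \<alpha> \<le> R j}" "card {(j, \<alpha>). \<alpha> \<le> R j} = (\<Sum>j\<in>UNIV. R j) + CARD('i)"
proof -
  have *: "{(j, \<alpha>). \<alpha> < R j} = (SIGMA j:UNIV. {..<R j})" "{(j, \<alpha>). \<alpha> \<le> R j} = (SIGMA j:UNIV. {..R j})"
    by auto
  show "finite {(j, \<alpha>). \<alpha> < R j}" "card {(j, \<alpha>). \<alpha> < R j} = (\<Sum>j\<in>UNIV. R j)"
    "finite {(j, \<alpha>). \<alpha> \<le> R j}" "card {(j, \<alpha>). \<alpha> \<le> R j} = (\<Sum>j\<in>UNIV. R j) + CARD('i)"
    unfolding * by (auto simp: sum.distrib sum_Suc simp del: sum_constant) 
qed

lemma card_prolonged_states:
  fixes S :: "'s set" and D :: "'i::finite \<Rightarrow> nat"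
  assumes "finite S"
  shows "card (prolonged_states S D) = card S + (\<Sum>j\<in>UNIV. D j)"
proof -
  have "{Input j \<alpha> |j \<alpha>. \<alpha> < D j} = (\<lambda>(j, \<alpha>). Input j \<alpha> :: ('s, 'i) coord) ` {(j, \<alpha>). \<alpha> < D j}"
    by auto
  moreover have "inj_on (\<lambda>(j, \<alpha>). Input j \<alpha> :: ('s, 'i) coord) {(j, \<alpha>). \<alpha> < D j}"
    by (auto simp: inj_on_def)
  ultimately have "card ({Input j \<alpha> |j \<alpha>. \<alpha> < D j} :: ('s, 'i) coord set) = (\<Sum>j\<in>UNIV. D j)"
    "finite ({Input j \<alpha> |j \<alpha>. \<alpha> < D j} :: ('s, 'i) coord set)"
    by (simp_all add: card_image card_output_names)
  moreover have "card (State ` S :: ('s, 'i) coord set) = card S" by (simp add: card_image inj_on_def)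
  ultimately show ?thesis
    unfolding prolonged_states_def using assms by (subst card_Un_disjoint) auto
qed

lemma card_state_coords: "card (state_coords S) = card S"
  by (simp add: state_coords_def card_image inj_on_def)

lemma card_xu_coords:
  fixes S :: "'s set"
  assumes "finite S"
  shows "card (xu_coords S :: ('s, 'i::finite) coord set) = card S + CARD('i)"
proof -
  have "xu_coords S = (State ` S \<union> range (\<lambda>j. Input j 0) :: ('s, 'i) coord set)"
    by (auto simp: jet_coords_def)
  moreover have "card (State ` S :: ('s, 'i) coord set) = card S" by (simp add: card_image inj_on_def)
  moreover have "card (range (\<lambda>j. Input j 0 :: ('s, 'i) coord)) = CARD('i)"
    by (simp add: card_image inj_on_def)
  moreover have "(State ` S :: ('s, 'i) coord set) \<inter> range (\<lambda>j. Input j 0) = {}" by auto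
  ultimately show ?thesis using assms by (simp add: card_Un_disjoint)
qed

lemma output_jet_apply: "output_jet S f \<phi> q (j, \<alpha>) = time_deriv S f \<alpha> (\<phi> j) q"
  by (simp add: output_jet_def)

text \<open>The hypothesis \<open>card\<close> says that the extended state has as many components
  as there are outputs of order below \<open>R\<close>. Adding one input and one top derivative per
  output keeps the count balanced, so the right-inverse argument applies both to the state alone and
  to state and input together.\<close>

lemma SFL_after_prolonging_of_flat:
  fixes f :: "'s \<Rightarrow> ('s, 'i::finite) jet \<Rightarrow> real"
  assumes control: "control_system S f p"
    and flat: "flat_output S f p Q \<phi> R"
    and RK: "\<And>j. j \<in> M \<Longrightarrow> K j < R j"
    and card: "(\<Sum>j\<in>M. R j - K j) + card S = (\<Sum>j\<in>UNIV. R j)"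
    and trafo: "input_transformation S p \<Phi> \<Psi>"
    and \<Phi>: "\<And>j. j \<in> M \<Longrightarrow> \<forall>\<^sub>F q in nhds p. \<Phi> j q = time_deriv S f (K j) (\<phi> j) q"
  shows "SFL_after_prolonging S f p \<phi> \<Phi> \<Psi> (\<lambda>j. if j \<in> M then R j - K j else 0)"
proof -
  define D where "D j = (if j \<in> M then R j - K j else 0)" for j
  define g where "g = feedback f \<Psi>"
  \<comment> \<open>The numbers label systems: 0 the original, 1 after the input transformation, 2
    after prolongation, 3 after the final feedback. \<open>M20\<close> and \<open>M32\<close>
    translate jets from the first number to the second.\<close>
  define p1 where "p1 = jet_map S f \<Phi> p"
  define p2 where "p2 = to_prolonged D p1"
  define S2 where "S2 = prolonged_states S D"
  define f2 where "f2 = prolonged_dynamics g D"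
  define M20 where "M20 e = jet_map S g \<Psi> (from_prolonged D e)" for e :: "(('s, 'i) coord, 'i) jet"
  define Y where "Y = output_jet S f \<phi>"
  define Z where "Z e = Y (M20 e)" for e
  define A where "A = {(j, \<alpha>). \<alpha> < R j}"
  define B where "B = {(j, \<alpha>). \<alpha> \<le> R j}"
  have finS: "finite S" using control by (simp add: control_system_def)
  have finS2: "finite S2" using finS by (simp add: S2_def finite_prolonged_states)
  have finA: "finite A" and finB: "finite B" by (simp_all add: A_def B_def card_output_names)
  have AB: "A \<subseteq> B" by (auto simp: A_def B_def)
  have "(\<Sum>j\<in>UNIV. D j) = (\<Sum>j\<in>M. R j - K j)" by (simp add: D_def sum.If_cases)
  then have cardS2: "card S2 = (\<Sum>j\<in>UNIV. R j)"
    using card by (simp add: S2_def card_prolonged_states[OF finS])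
  have cardA: "card A = card (state_coords S2)"
    by (simp add: A_def card_output_names card_state_coords cardS2)
  have cardB: "card B = card (xu_coords S2 :: (('s, 'i) coord, 'i) coord set)"
    by (simp add: B_def card_output_names card_xu_coords[OF finS2] cardS2)
  have finxu: "finite (xu_coords S2 :: (('s, 'i) coord, 'i) coord set)"
    and finxuS: "finite (xu_coords S :: ('s, 'i) coord set)"
    by (simp_all add: finite_jet_coords finS finS2)
  have finst: "finite (state_coords S2 :: (('s, 'i) coord, 'i) coord set)"
    by (simp add: state_coords_def finS2)
  have stxu: "(state_coords S2 :: (('s, 'i) coord, 'i) coord set) \<subseteq> xu_coords S2"
    by (auto simp: state_coords_def)

  have p12: "from_prolonged D p2 = p1" by (simp add: p2_def from_to_prolonged)
  have M20p2: "M20 p2 = p"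
    by (simp add: M20_def p12 p1_def g_def jet_map_feedback_inverse_point[OF control trafo])
  have cs2: "control_system S2 f2 p2"
    unfolding S2_def f2_def
    by (rule control_system_prolonged)
      (simp add: p12 p1_def g_def control_system_feedback[OF control trafo])
  have mor20: "jet_morphism S2 f2 p2 S f M20"
    unfolding M20_def
    by (rule jet_morphism_compose[OF finS2 finS, of f2 p2 g "from_prolonged D"])
      (simp_all add: S2_def f2_def jet_morphism_from_prolonged[OF finS] p12 p1_def g_def
        jet_morphism_feedback_back[OF control trafo])
  have cont20: "(M20 \<longlongrightarrow> p) (nhds p2)" using mor20 by (simp add: jet_morphism_def M20p2)

  have smooth_\<phi>: "jet_fn S p (\<phi> j)" for j
    using flat by (intro jet_fnI[of "jet_coords S Q"] finite_jet_coords finS jet_coords_subset)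
      (simp add: flat_output_def)
  have jet_Y: "jet_fn S p (\<lambda>q. Y q b)" for b
    using jet_fn_time_deriv[OF control smooth_\<phi>] by (cases b) (simp add: Y_def output_jet_apply)
  have "jet_fn S2 p2 (\<lambda>e. Z e b)" for b
    unfolding Z_def
    by (rule jet_fn_compose[where M=M20 and p=p2 and h="\<lambda>q. Y q b" and S'=S])
      (use jet_Y mor20 in \<open>simp_all add: M20p2 jet_morphism_def\<close>)
  then have smooth_Z: "smooth_at p2 (\<lambda>e. Z e b)" for b by (rule jet_fn_smooth_at)
  define y0 where "y0 = Y p"
  have Zp2: "Z p2 = y0" by (simp add: Z_def y0_def M20p2)

  obtain Fx Fu where
    Fx: "\<And>s. s \<in> S \<Longrightarrow> smooth_fn A y0 (Fx s)" and Fu: "\<And>i. smooth_fn B y0 (Fu i)"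
    and F: "\<forall>\<^sub>F q in nhds p. (\<forall>s\<in>S. q (State s) = Fx s (Y q)) \<and> (\<forall>i. q (Input i 0) = Fu i (Y q))"
    using flat unfolding flat_output_def A_def B_def y0_def Y_def by blast
  define W where "W c y = (case c of State s \<Rightarrow> Fx s y | Input i \<alpha> \<Rightarrow> Fu i y)" for c y
  have WY: "\<forall>\<^sub>F q in nhds p. \<forall>c\<in>xu_coords S. W c (Y q) = q c"
    using F
  proof (rule eventually_mono, intro ballI)
    fix q :: "('s, 'i) jet" and c :: "('s, 'i) coord"
    assume "c \<in> xu_coords S" "(\<forall>s\<in>S. q (State s) = Fx s (Y q)) \<and> (\<forall>i. q (Input i 0) = Fu i (Y q))"
    then show "W c (Y q) = q c" by (cases c) (auto simp: W_def)
  qed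
  have smooth_W: "smooth_fn B y0 (W c)" if "c \<in> xu_coords S" for c
  proof (cases c)
    case (State s)
    then have "W c = Fx s" by (simp add: W_def fun_eq_iff)
    then show ?thesis using that State smooth_fn_mono[OF Fx AB] by simp
  next
    case (Input i \<alpha>)
    then have "W c = Fu i" by (simp add: W_def fun_eq_iff)
    then show ?thesis using Fu by simp
  qed
  have smooth_\<Phi>: "smooth_fn (xu_coords S) p (\<Phi> j)" for j
  proof -
    have "smooth_fn (xu_coords S) p (with_inputs \<Phi> (Input j 0))"
      using trafo by (simp add: input_transformation_def local_diffeo_def)
    moreover have "with_inputs \<Phi> (Input j 0) = \<Phi> j" by (simp add: fun_eq_iff)
    ultimately show ?thesis by simp
  qed
  \<comment> \<open>A prolonged input has order \<open>D j\<close> at the top, hence equals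
    \<open>y\<close> of order \<open>K j + D j = R j\<close>. Any other input is
    \<open>\<Phi> j\<close> at the flat parameterization of state and input. States use orders below
    \<open>R\<close> only.\<close>
  define H where "H c y = (case c of
      State c' \<Rightarrow> (case c' of State s \<Rightarrow> Fx s y | Input j \<alpha> \<Rightarrow> y (j, K j + \<alpha>))
    | Input j \<alpha> \<Rightarrow> if j \<in> M then y (j, R j) else \<Phi> j (\<lambda>c. W c y))"
    for c :: "(('s, 'i) coord, 'i) coord" and y
  have smooth_H_state: "smooth_fn A y0 (H c)" if st: "c \<in> state_coords S2" for c
  proof -
    obtain c' where c: "c = State c'" "c' \<in> S2" using st by (cases c) auto
    show ?thesis
    proof (cases c')
      case (State s)
      then have "H c = Fx s" "s \<in> S" using c by (auto simp: H_def S2_def fun_eq_iff)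
      then show ?thesis using Fx by simp
    next
      case (Input j \<alpha>)
      then have "\<alpha> < D j" using c by (simp add: S2_def)
      then have "(j, K j + \<alpha>) \<in> A" by (auto simp: A_def D_def split: if_splits)
      moreover have "H c = (\<lambda>y. y (j, K j + \<alpha>))" by (simp add: H_def c Input fun_eq_iff)
      ultimately show ?thesis by (simp add: smooth_fn_coord)
    qed
  qed
  have smooth_H: "smooth_fn B y0 (H c)" if "c \<in> xu_coords S2" for c
  proof (cases c)
    case (State c')
    then show ?thesis using that smooth_fn_mono[OF smooth_H_state AB] by simp
  next
    case (Input j \<alpha>)
    show ?thesis
    proof (cases "j \<in> M")
      case True
      then have "H c = (\<lambda>y. y (j, R j))" by (simp add: H_def Input fun_eq_iff)
      then show ?thesis by (simp add: smooth_fn_coord B_def)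
    next
      case False
      have "smooth_fn (xu_coords S) (\<lambda>c. W c y0) (\<Phi> j)"
        by (rule smooth_fn_cong_point[OF smooth_\<Phi> finxuS])
          (use eventually_nhds_x_imp_x[OF WY] in \<open>simp add: y0_def\<close>)
      from smooth_fn_compose[where N=W, OF this finxuS smooth_W]
      have "smooth_fn B y0 (\<lambda>y. \<Phi> j (\<lambda>c. W c y))" .
      moreover have "H c = (\<lambda>y. \<Phi> j (\<lambda>c. W c y))" by (simp add: H_def Input False fun_eq_iff)
      ultimately show ?thesis by simp
    qed
  qed
  \<comment> \<open>The transformed input is the derivative of order \<open>K j\<close> of the
    output near \<open>p\<close>, so its own derivatives are the higher ones.\<close>
  have prolonged_input: "\<forall>\<^sub>F q in nhds p. Y q (j, K j + \<alpha>) = time_deriv S f \<alpha> (\<Phi> j) q"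
    if "j \<in> M" for j \<alpha>
    using time_deriv_cong_ev[OF \<Phi>[OF that], of S f \<alpha>]
    by eventually_elim (simp add: Y_def output_jet_apply time_deriv_add)
  have HY: "\<forall>\<^sub>F q in nhds p. H c (Y q) = jet_map S f \<Phi> q (unprolonged_name D c)" if c: "c \<in> xu_coords S2" for c
  proof (cases c)
    case (State c')
    show ?thesis
    proof (cases c')
      case (State s)
      then have "s \<in> S" using c \<open>c = State c'\<close> by (simp add: S2_def)
      then show ?thesis using F
        by (auto simp: H_def \<open>c = State c'\<close> State unprolonged_name_def elim: eventually_mono)
    next
      case (Input j \<alpha>)
      then have "j \<in> M" using c \<open>c = State c'\<close> by (auto simp: S2_def D_def split: if_splits)
      then show ?thesis using prolonged_input[of j \<alpha>]
        by (simp add: H_def \<open>c = State c'\<close> Input unprolonged_name_def)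
    qed
  next
    case (Input j \<alpha>)
    then have \<alpha>: "\<alpha> = 0" using c by simp
    show ?thesis
    proof (cases "j \<in> M")
      case True
      then show ?thesis using prolonged_input[of j "D j"] RK[OF True]
        by (simp add: H_def Input \<alpha> unprolonged_name_def D_def)
    next
      case False
      show ?thesis using WY
      proof eventually_elim
        case (elim q)
        have "\<Phi> j (\<lambda>c. W c (Y q)) = \<Phi> j q"
          by (rule depends_onlyD[OF smooth_fn_depends_only[OF smooth_\<Phi>]]) (use elim in blast)
        then show ?case by (simp add: H_def Input \<alpha> False unprolonged_name_def D_def)
      qed
    qed
  qed
  have from_cont: "(from_prolonged D \<longlongrightarrow> p1) (nhds p2)"
    using jet_morphism_from_prolonged[OF finS, of D g p2] by (simp add: jet_morphism_def p12)
  have HZ: "\<forall>\<^sub>F e in nhds p2. H c (Z e) = e c" if c: "c \<in> xu_coords S2" for c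
    using eventually_compose_filterlim[OF HY[OF c] cont20]
      eventually_compose_filterlim[OF jet_map_feedback_inverse'[OF control trafo, of "unprolonged_name D c", folded p1_def g_def] from_cont]
  proof eventually_elim
    case (elim e)
    have "c \<in> jet_names (prolonged_states S D)" using c jet_coords_subset by (auto simp: S2_def)
    from to_from_prolonged[OF this, of e] show ?case
      using elim by (simp add: Z_def M20_def to_prolonged_eq)
  qed

  \<comment> \<open>Besides inverting \<open>H\<close>, this yields that the outputs of order below
    \<open>R\<close>, expressed through the whole jet, are functions of the extended state.\<close>
  obtain T where T: "local_diffeo A (state_coords S2) H T y0" "local_diffeo (state_coords S2) A T H p2"
    and TZ: "\<forall>\<^sub>F e in nhds p2. \<forall>b\<in>A. T b e = Z e b"
  proof (rule local_diffeo_of_right_inverse[where Z=Z and p=p2, OF finA finst cardA _ smooth_Z, unfolded Zp2])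
    show "smooth_fn A y0 (H c)" if "c \<in> state_coords S2" for c by (rule smooth_H_state[OF that])
    show "\<forall>\<^sub>F e in nhds p2. H c (Z e) = e c" if "c \<in> state_coords S2" for c
      by (rule HZ) (use that stxu in blast)
  qed
  \<comment> \<open>With inputs included, the outputs of order \<open>R\<close> become functions of
    extended state and input: the future linearizing inputs.\<close>
  obtain V where V: "local_diffeo B (xu_coords S2) H V y0" "local_diffeo (xu_coords S2) B V H p2"
    and VZ: "\<forall>\<^sub>F e in nhds p2. \<forall>b\<in>B. V b e = Z e b"
    by (rule local_diffeo_of_right_inverse[where Z=Z and p=p2, OF finB finxu cardB _ smooth_Z, unfolded Zp2, OF smooth_H HZ])

  have smooth_T: "smooth_fn (state_coords S2) p2 (T a)" if "a \<in> A" for a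
    using T(2) that by (simp add: local_diffeo_def)
  have smooth_V: "smooth_fn (xu_coords S2) p2 (V b)" if "b \<in> B" for b
    using V(2) that by (simp add: local_diffeo_def)
  have T_state: "T a r = T a r'" if "a \<in> A" "\<And>c. r (State c) = r' (State c)" for a r r'
    by (rule depends_onlyD[OF smooth_fn_depends_only[OF smooth_T[OF that(1)]]])
      (use that(2) in \<open>auto simp: state_coords_def\<close>)
  note dep_V = depends_onlyD[OF smooth_fn_depends_only[OF smooth_V]]
  note dep_H = depends_onlyD[OF smooth_fn_depends_only[OF smooth_H]]
  note dep_H_state = depends_onlyD[OF smooth_fn_depends_only[OF smooth_H_state]]
  have Tp2: "T a p2 = y0 a" if "a \<in> A" for a
    using eventually_nhds_x_imp_x[OF TZ] that by (simp add: Zp2)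
  have Vp2: "V b p2 = y0 b" if "b \<in> B" for b
    using eventually_nhds_x_imp_x[OF VZ] that by (simp add: Zp2)
  have top: "(j, R j) \<in> B" for j by (simp add: B_def)

  define \<Phi>' where "\<Phi>' j = V (j, R j)" for j
  \<comment> \<open>Assembles all outputs up to order \<open>R\<close> from the state and the new
    inputs. The lower orders come from \<open>T\<close> rather than \<open>V\<close>, since
    \<open>T\<close> does not look at the inputs.\<close>
  define G where "G b e = (case b of (i, \<alpha>) \<Rightarrow> if \<alpha> < R i then T (i, \<alpha>) e else e (Input i 0))" for b e
  define \<Psi>' where "\<Psi>' j e = H (Input j 0) (\<lambda>b. G b e)" for j e
  have G_A: "G b e = T b e" if "b \<in> A" for b e using that by (auto simp: G_def A_def)
  have G_top: "G (j, R j) e = e (Input j 0)" for j e by (simp add: G_def)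
  have B_cases: "b \<in> A \<or> (\<exists>j. b = (j, R j))" if "b \<in> B" for b
    using that by (auto simp: A_def B_def)
  define p2' where "p2' = (\<lambda>c. with_inputs \<Phi>' c p2)"
  have p2'_simps: "p2' (State c) = p2 (State c)" "p2' (Input j 0) = y0 (j, R j)" for c j
    by (simp_all add: p2'_def \<Phi>'_def Vp2[OF top])
  have Gp2': "G b p2' = y0 b" if "b \<in> B" for b
    using B_cases[OF that] T_state[of b p2' p2] Tp2[of b] by (auto simp: G_A G_top p2'_simps)
  have smooth_G: "smooth_fn (xu_coords S2) p2' (G b)" if "b \<in> B" for b
    using B_cases[OF that]
  proof
    assume b: "b \<in> A"
    have "smooth_fn (state_coords S2) p2' (T b)"
      by (rule smooth_fn_cong_point[OF smooth_T[OF b] finst]) (auto simp: state_coords_def p2'_simps)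
    moreover have "G b = T b" using b by (simp add: G_A fun_eq_iff)
    ultimately show ?thesis using smooth_fn_mono[OF _ stxu] by simp
  next
    assume "\<exists>j. b = (j, R j)"
    then obtain j where "b = (j, R j)" by blast
    then have "G b = (\<lambda>e. e (Input j 0))" by (simp add: G_top fun_eq_iff)
    then show ?thesis by (simp add: smooth_fn_coord)
  qed
  have trafo2: "input_transformation S2 p2 \<Phi>' \<Psi>'"
    unfolding input_transformation_def local_diffeo_def p2'_def[symmetric]
  proof (intro conjI ballI)
    fix c :: "(('s, 'i) coord, 'i) coord" assume c: "c \<in> xu_coords S2"
    show "smooth_fn (xu_coords S2) p2 (with_inputs \<Phi>' c)"
    proof (cases c)
      case (State s)
      then have "with_inputs \<Phi>' c = (\<lambda>e. e (State s))" by (simp add: fun_eq_iff)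
      then show ?thesis using c State by (simp add: smooth_fn_coord)
    next
      case (Input j \<alpha>)
      then have "with_inputs \<Phi>' c = V (j, R j)" by (simp add: fun_eq_iff \<Phi>'_def)
      then show ?thesis by (simp add: smooth_V[OF top])
    qed
    show "smooth_fn (xu_coords S2) p2' (with_inputs \<Psi>' c)"
    proof (cases c)
      case (State s)
      then have "with_inputs \<Psi>' c = (\<lambda>e. e (State s))" by (simp add: fun_eq_iff)
      then show ?thesis using c State by (simp add: smooth_fn_coord)
    next
      case (Input j \<alpha>)
      have "smooth_fn B y0 (H (Input j 0))" by (rule smooth_H) simp
      then have "smooth_fn B (\<lambda>b. G b p2') (H (Input j 0))"
        by (rule smooth_fn_cong_point[OF _ finB]) (simp add: Gp2')
      from smooth_fn_compose[where N=G, OF this finB smooth_G]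
      have "smooth_fn (xu_coords S2) p2' (\<lambda>e. H (Input j 0) (\<lambda>b. G b e))" .
      moreover have "with_inputs \<Psi>' c = (\<lambda>e. H (Input j 0) (\<lambda>b. G b e))"
        using Input by (simp add: fun_eq_iff \<Psi>'_def)
      ultimately show ?thesis by simp
    qed
  next
    have "\<forall>\<^sub>F e in nhds p2. \<forall>c\<in>xu_coords S2. H c (Z e) = e c"
      using HZ by (intro eventually_ball_finite finxu) blast
    with TZ VZ
    show "\<forall>\<^sub>F e in nhds p2. \<forall>a\<in>xu_coords S2. with_inputs \<Psi>' a (\<lambda>b. with_inputs \<Phi>' b e) = e a"
    proof eventually_elim
      case (elim e)
      have G: "G b (\<lambda>c. with_inputs \<Phi>' c e) = Z e b" if "b \<in> B" for b
        using B_cases[OF that]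
      proof
        assume b: "b \<in> A"
        have "T b (\<lambda>c. with_inputs \<Phi>' c e) = T b e" by (rule T_state[OF b]) simp
        then show ?thesis using elim(1) b by (simp add: G_A)
      next
        assume "\<exists>j. b = (j, R j)"
        then show ?thesis using elim(2) that by (auto simp: G_top \<Phi>'_def)
      qed
      show ?case
      proof
        fix c :: "(('s, 'i) coord, 'i) coord" assume c: "c \<in> xu_coords S2"
        show "with_inputs \<Psi>' c (\<lambda>b. with_inputs \<Phi>' b e) = e c"
        proof (cases c)
          case (Input j \<alpha>)
          then have "c = Input j 0" using c by simp
          moreover have "H (Input j 0) (\<lambda>b. G b (\<lambda>c. with_inputs \<Phi>' c e)) = H (Input j 0) (Z e)"
            by (rule dep_H) (simp_all add: G)
          ultimately show ?thesis using elim(3) c by (simp add: \<Psi>'_def)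
        qed simp
      qed
    qed
    have "\<forall>\<^sub>F y in nhds y0. \<forall>b\<in>B. V b (\<lambda>c. H c y) = y b"
      using V(1) by (simp add: local_diffeo_def)
    \<comment> \<open>Its components at \<open>(j, R j)\<close> will say that the new input is
      recovered after solving for the old one.\<close>
    then have VHG: "\<forall>\<^sub>F r in nhds p2'. \<forall>b\<in>B. V b (\<lambda>c. H c (\<lambda>b. G b r)) = G b r"
    proof (rule eventually_nhds_compose_on[where C=B])
      show "(G b \<longlongrightarrow> y0 b) (nhds p2')" if "b \<in> B" for b
        using smooth_at_tendsto[OF smooth_fn_smooth_at[OF smooth_G[OF that]]] by (simp add: Gp2'[OF that])
      fix y y' :: "'i \<times> nat \<Rightarrow> real"
      assume y: "\<And>b. b \<in> B \<Longrightarrow> y b = y' b" "\<forall>b\<in>B. V b (\<lambda>c. H c y) = y b"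
      have "V b (\<lambda>c. H c y) = V b (\<lambda>c. H c y')" if "b \<in> B" for b
        by (rule dep_V[OF that]) (rule dep_H[OF _ y(1)])
      then show "\<forall>b\<in>B. V b (\<lambda>c. H c y') = y' b" using y by simp
    qed
    have "\<forall>\<^sub>F e in nhds p2. \<forall>c\<in>state_coords S2. H c (\<lambda>a. T a e) = e c"
      using T(2) by (simp add: local_diffeo_def)
    \<comment> \<open>\<open>p2\<close> and \<open>p2'\<close> have the same state and
      \<open>T\<close> sees nothing else, so the local inverse property moves to the new base
      point.\<close>
    then have "\<forall>\<^sub>F e in nhds p2'. \<forall>c\<in>state_coords S2. H c (\<lambda>a. T a e) = e c"
    proof (rule eventually_nhds_agree[where C="range State"])
      show "\<forall>c\<in>range State. p2 c = p2' c" by (auto simp: p2'_simps)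
      fix r r' :: "(('s, 'i) coord, 'i) jet"
      assume r: "\<And>c. c \<in> range State \<Longrightarrow> r c = r' c" "\<forall>c\<in>state_coords S2. H c (\<lambda>a. T a r) = r c"
      have "H c (\<lambda>a. T a r) = H c (\<lambda>a. T a r')" if "c \<in> state_coords S2" for c
        by (rule dep_H_state[OF that]) (rule T_state, assumption, use r(1) in simp)
      moreover have "r c = r' c" if "c \<in> state_coords S2" for c
        by (rule r(1)) (use that in \<open>auto simp: state_coords_def\<close>)
      ultimately show "\<forall>c\<in>state_coords S2. H c (\<lambda>a. T a r') = r' c"
        using r(2) by simp
    qed
    then show "\<forall>\<^sub>F r in nhds p2'. \<forall>b\<in>xu_coords S2. with_inputs \<Phi>' b (\<lambda>a. with_inputs \<Psi>' a r) = r b"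
      using VHG
    proof eventually_elim
      case (elim r)
      show ?case
      proof
        fix c :: "(('s, 'i) coord, 'i) coord" assume c: "c \<in> xu_coords S2"
        show "with_inputs \<Phi>' c (\<lambda>a. with_inputs \<Psi>' a r) = r c"
        proof (cases c)
          case (Input j \<alpha>)
          have "V (j, R j) (\<lambda>a. with_inputs \<Psi>' a r) = V (j, R j) (\<lambda>c. H c (\<lambda>b. G b r))"
          proof (rule dep_V[OF top])
            fix d :: "(('s, 'i) coord, 'i) coord" assume d: "d \<in> xu_coords S2"
            show "with_inputs \<Psi>' d r = H d (\<lambda>b. G b r)"
            proof (cases d)
              case (State s)
              then have ds: "d \<in> state_coords S2" using d by simp
              have "H d (\<lambda>b. G b r) = H d (\<lambda>b. T b r)" by (rule dep_H_state[OF ds]) (simp add: G_A)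
              then show ?thesis using elim(1) ds State by simp
            next
              case (Input i \<alpha>)
              then show ?thesis using d by (simp add: \<Psi>'_def)
            qed
          qed
          then show ?thesis using elim(2) top[of j] c Input by (simp add: \<Phi>'_def G_top)
        qed simp
      qed
    qed
  qed

  define p3 where "p3 = jet_map S2 f2 \<Phi>' p2"
  define f3 where "f3 = feedback f2 \<Psi>'"
  define M32 where "M32 = jet_map S2 f3 \<Psi>'"
  have M32p3: "M32 p3 = p2"
    unfolding M32_def p3_def f3_def by (rule jet_map_feedback_inverse_point[OF cs2 trafo2])
  have mor32: "jet_morphism S2 f3 p3 S2 f2 M32"
    unfolding M32_def p3_def f3_def by (rule jet_morphism_feedback_back[OF cs2 trafo2])
  have mor30: "jet_morphism S2 f3 p3 S f (\<lambda>r. M20 (M32 r))"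
    by (rule jet_morphism_compose[OF finS2 finS2 mor32]) (simp add: M32p3 mor20)
  have cont32: "(M32 \<longlongrightarrow> p2) (nhds p3)" using mor32 by (simp add: jet_morphism_def M32p3)
  have TY: "\<forall>\<^sub>F r in nhds p3. \<forall>a\<in>A. T a r = Y (M20 (M32 r)) a"
    using eventually_compose_filterlim[OF TZ cont32]
  proof eventually_elim
    case (elim r)
    have "T a r = T a (M32 r)" if "a \<in> A" for a by (rule T_state[OF that]) (simp add: M32_def)
    then show ?case using elim by (simp add: Z_def)
  qed
  have \<Phi>Y: "\<forall>\<^sub>F r in nhds p3. r (Input j 0) = Y (M20 (M32 r)) (j, R j)" for j
    using eventually_compose_filterlim[OF VZ cont32]
      eventually_\<Phi>_\<Psi>[OF cs2 trafo2, of j, folded p3_def f3_def, folded M32_def]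
    by eventually_elim (use top in \<open>auto simp: \<Phi>'_def Z_def\<close>)
  have \<Phi>Y_all: "\<forall>\<^sub>F r in nhds p3. \<forall>j\<in>UNIV. r (Input j 0) = Y (M20 (M32 r)) (j, R j)"
    using \<Phi>Y by (intro eventually_ball_finite) auto
  \<comment> \<open>Near \<open>p3\<close> the component \<open>T (j, k)\<close> is the derivative
    of order \<open>k\<close> of the output pulled back by a morphism, so differentiating it raises
    the order by one.\<close>
  have LT: "\<forall>\<^sub>F r in nhds p3. total_deriv S2 f3 (T (j, k)) r = Y (M20 (M32 r)) (j, Suc k)"
    if k: "k < R j" for j k
  proof -
    have "\<forall>\<^sub>F r in nhds p3. T (j, k) r = time_deriv S f k (\<phi> j) (M20 (M32 r))"
      using TY by (rule eventually_mono) (use k in \<open>simp add: A_def Y_def output_jet_apply\<close>)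
    from total_deriv_cong_ev[OF this, of S2 f3]
    have "\<forall>\<^sub>F r in nhds p3. total_deriv S2 f3 (T (j, k)) r =
        total_deriv S2 f3 (\<lambda>r. time_deriv S f k (\<phi> j) (M20 (M32 r))) r" .
    moreover have "jet_fn S (M20 (M32 p3)) (time_deriv S f k (\<phi> j))"
      by (simp add: M32p3 M20p2 jet_fn_time_deriv[OF control smooth_\<phi>])
    from jet_morphism_total_deriv[OF finS2 finS mor30 this]
    have "\<forall>\<^sub>F r in nhds p3. total_deriv S2 f3 (\<lambda>r. time_deriv S f k (\<phi> j) (M20 (M32 r))) r =
        total_deriv S f (time_deriv S f k (\<phi> j)) (M20 (M32 r))" .
    ultimately show ?thesis
      by eventually_elim (simp add: Y_def output_jet_apply time_deriv_Suc)
  qed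
  then have LT_all: "\<forall>\<^sub>F r in nhds p3. \<forall>a\<in>A. total_deriv S2 f3 (T a) r = Y (M20 (M32 r)) (fst a, Suc (snd a))"
    by (intro eventually_ball_finite finA) (auto simp: A_def)
  have chains: "\<forall>\<^sub>F r in nhds p3.
      (\<forall>j k. k < R j \<longrightarrow> total_deriv S2 f3 (T (j, k)) r =
        (if Suc k < R j then T (j, Suc k) r else r (Input j 0))) \<and>
      (\<forall>j. \<phi> j (M20 (M32 r)) = (if 0 < R j then T (j, 0) r else r (Input j 0)))"
    using TY \<Phi>Y_all LT_all
  proof eventually_elim
    case (elim r)
    \<comment> \<open>State and input are one family here: order \<open>R j\<close> is the input.
      This also covers \<open>R j = 0\<close>, where the output itself is the input.\<close>
    have t: "(if k < R j then T (j, k) r else r (Input j 0)) = Y (M20 (M32 r)) (j, k)" if "k \<le> R j" for j k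
      using elim(1,2) that by (cases "k = R j") (auto simp: A_def)
    have "total_deriv S2 f3 (T (j, k)) r = Y (M20 (M32 r)) (j, Suc k)" if "k < R j" for j k
      using elim(3) that by (auto simp: A_def)
    then show ?case using t[of "Suc _"] t[of 0] by (simp add: Y_def output_jet_apply)
  qed
  \<comment> \<open>The chain lengths are the orders \<open>R\<close>.\<close>
  have "SFL S2 f2 p2 (\<lambda>j e. \<phi> j (M20 e))"
    unfolding SFL_def
    using T(2) trafo2 chains unfolding A_def p3_def f3_def M32_def by blast
  then show ?thesis
    unfolding SFL_after_prolonging_def S2_def f2_def g_def p2_def p1_def M20_def D_def .
qed

section \<open>Completing the given components to an input transformation\<close>

text \<open>The zero rows outside \<open>M\<close> do not affect the row space, so the rank
  condition says that the rows in \<open>M\<close> are distinct and independent. A basis containing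
  them has exactly enough further vectors for the remaining indices.\<close>

lemma complete_to_basis:
  fixes a :: "'m::finite \<Rightarrow> real ^ 'm"
  assumes rank: "rank ((\<chi> j i. if j \<in> M then a j $ i else 0) :: real ^ 'm ^ 'm) = card M"
  obtains w where "\<And>j. j \<in> M \<Longrightarrow> w j = a j" "\<And>l. (\<Sum>j\<in>UNIV. l j *\<^sub>R w j) = 0 \<Longrightarrow> \<forall>j. l j = 0"
proof -
  define N :: "real ^ 'm ^ 'm" where "N = (\<chi> j i. if j \<in> M then a j $ i else 0)"
  have "row j N = (if j \<in> M then a j else 0)" for j
    by (simp add: row_def N_def vec_eq_iff)
  then have "rows N \<subseteq> insert 0 (a ` M)" by (auto simp: rows_def)
  then have "dim (rows N) \<le> dim (insert 0 (a ` M))" by (rule dim_subset)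
  also have "\<dots> = dim (a ` M)" by (simp add: dim_insert span_0)
  finally have dim: "card M \<le> dim (a ` M)"
    using rank by (simp add: N_def row_rank_def)
  have "dim (a ` M) \<le> card (a ` M)" by (rule dim_le_card') simp
  \<comment> \<open>Dimension and cardinality squeeze the image between \<open>card M\<close> on
    both sides, which forces \<open>a\<close> to be injective on \<open>M\<close>.\<close>
  with dim have "card M \<le> card (a ` M)" by simp
  with card_image_le[of M a] have cardM: "card (a ` M) = card M" by simp
  then have inj: "inj_on a M" by (intro eq_card_imp_inj_on) simp_all
  have "independent (a ` M)"
    by (rule card_le_dim_spanning[of _ "a ` M"]) (use dim cardM in \<open>auto simp: span_base\<close>)
  then obtain B where B: "a ` M \<subseteq> B" "independent B" "UNIV \<subseteq> span B"
    using maximal_independent_subset_extend[of "a ` M" UNIV] by auto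
  have finB: "finite B" using independent_bound[OF B(2)] by simp
  have "card B = dim (UNIV :: (real ^ 'm) set)" by (rule basis_card_eq_dim) (use B in auto)
  then have "card B = CARD('m)" by simp
  then have "card (B - a ` M) = card (- M)"
    using B(1) cardM finB by (simp add: card_Diff_subset Compl_eq_Diff_UNIV)
  then obtain \<beta> where \<beta>: "bij_betw \<beta> (- M) (B - a ` M)"
    using finite_same_card_bij[of "- M" "B - a ` M"] finB by auto
  define w where "w j = (if j \<in> M then a j else \<beta> j)" for j
  have "bij_betw w M (a ` M)" using inj by (auto simp: bij_betw_def w_def inj_on_def)
  moreover have "bij_betw w (- M) (B - a ` M)" using \<beta> by (rule bij_betw_cong[THEN iffD1, rotated]) (simp add: w_def)
  ultimately have "bij_betw w (M \<union> - M) (a ` M \<union> (B - a ` M))" by (rule bij_betw_combine) auto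
  then have w: "bij_betw w UNIV B" using B(1) by (simp add: Un_absorb1 Un_Diff_cancel)
  show thesis
  proof (rule that)
    show "w j = a j" if "j \<in> M" for j using that by (simp add: w_def)
    fix l :: "'m \<Rightarrow> real" assume l: "(\<Sum>j\<in>UNIV. l j *\<^sub>R w j) = 0"
    have injw: "inj w" using w by (simp add: bij_betw_def)
    have "(\<Sum>v\<in>B. l (inv w v) *\<^sub>R v) = (\<Sum>j\<in>UNIV. l (inv w (w j)) *\<^sub>R w j)"
      by (rule sum.reindex_bij_betw[OF w, symmetric])
    then have "(\<Sum>v\<in>B. l (inv w v) *\<^sub>R v) = 0" using l injw by simp
    from independentD[OF B(2) finB subset_refl this] have "l (inv w v) = 0" if "v \<in> B" for v using that by blast
    then show "\<forall>j. l j = 0"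
      using w injw by (metis UNIV_I bij_betwE inv_f_f)
  qed
qed

lemma sum_xu_coords:
  fixes S :: "'s set" and F :: "('s, 'i::finite) coord \<Rightarrow> real"
  assumes "finite S"
  shows "(\<Sum>c\<in>xu_coords S. F c) = (\<Sum>s\<in>S. F (State s)) + (\<Sum>j\<in>UNIV. F (Input j 0))"
proof -
  have "xu_coords S = (State ` S \<union> range (\<lambda>j. Input j 0) :: ('s, 'i) coord set)"
    by (auto simp: jet_coords_def)
  then have "(\<Sum>c\<in>xu_coords S. F c) = (\<Sum>c\<in>State ` S. F c) + (\<Sum>c\<in>range (\<lambda>j. Input j 0). F c)"
    using assms sum.union_disjoint[of "State ` S" "range (\<lambda>j. Input j 0)" F] by auto
  then show ?thesis by (simp add: sum.reindex inj_on_def)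
qed

text \<open>The missing components are linear in the inputs, with the completing basis vectors as
  coefficients. Together with the unchanged state the Jacobian is block triangular, so only its
  input block has to be invertible.\<close>

lemma input_transformation_completion:
  fixes h :: "'i::finite \<Rightarrow> ('s, 'i) jet \<Rightarrow> real"
  assumes "finite S" and h: "\<And>j. j \<in> M \<Longrightarrow> smooth_fn (xu_coords S) p (h j)"
    and rank: "rank ((\<chi> j i. if j \<in> M then partial_deriv (Input i 0) (h j) p else 0) :: real ^ 'i ^ 'i) = card M"
  obtains \<Phi> \<Psi> where "input_transformation S p \<Phi> \<Psi>" "\<And>j. j \<in> M \<Longrightarrow> \<Phi> j = h j"
proof -
  obtain w where w: "\<And>j. j \<in> M \<Longrightarrow> w j = (\<chi> i. partial_deriv (Input i 0) (h j) p)"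
    "\<And>l. (\<Sum>j\<in>UNIV. l j *\<^sub>R w j) = 0 \<Longrightarrow> \<forall>j. l j = 0"
    by (rule complete_to_basis[of M "\<lambda>j. \<chi> i. partial_deriv (Input i 0) (h j) p"]) (use rank in \<open>auto cong: if_cong\<close>)
  define \<Phi> where "\<Phi> j = (if j \<in> M then h j else (\<lambda>q. \<Sum>i\<in>UNIV. w j $ i * q (Input i 0)))" for j
  have fin: "finite (xu_coords S :: ('s, 'i) coord set)" by (rule finite_jet_coords[OF assms(1)])
  have smooth_\<Phi>: "smooth_fn (xu_coords S) p (\<Phi> j)" for j
  proof (cases "j \<in> M")
    case False
    have "smooth_fn (xu_coords S) p (\<lambda>q. \<Sum>i\<in>UNIV. w j $ i * q (Input i 0))"
      by (intro smooth_fn_sum smooth_fn_mult smooth_fn_coord)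
        (simp_all add: smooth_fn_iff smooth_at_const depends_only_def)
    then show ?thesis using False by (simp add: \<Phi>_def)
  qed (simp add: \<Phi>_def h)
  have with_eq: "with_inputs \<Phi> (Input j \<alpha>) = \<Phi> j" "with_inputs \<Phi> (State s) = (\<lambda>q. q (State s))"
    for \<Phi> :: "'i \<Rightarrow> ('s, 'i) jet \<Rightarrow> real" and j \<alpha> s by (simp_all add: fun_eq_iff)
  have smooth_T: "smooth_fn (xu_coords S) p (with_inputs \<Phi> c)" if "c \<in> xu_coords S" for c
    using that smooth_\<Phi> by (cases c) (simp_all add: with_eq smooth_fn_coord)
  have d\<Phi>: "partial_deriv (Input i 0) (\<Phi> j) p = w j $ i" for i j
  proof (cases "j \<in> M")
    case False
    have "((\<lambda>t. w j $ k * (p(Input i 0 := t)) (Input k 0)) has_real_derivative (if k = i then w j $ k else 0))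
        (at (p (Input i 0)))" for k
      by (cases "k = i") (auto intro!: derivative_eq_intros)
    then have "((\<lambda>t. \<Sum>k\<in>UNIV. w j $ k * (p(Input i 0 := t)) (Input k 0)) has_real_derivative
        (\<Sum>k\<in>UNIV. if k = i then w j $ k else 0)) (at (p (Input i 0)))"
      by (intro DERIV_sum)
    from partial_derivI[OF this] show ?thesis using False by (simp add: \<Phi>_def)
  qed (simp add: \<Phi>_def w)
  have indep: "\<forall>c\<in>xu_coords S. l c = 0"
    if l: "\<And>d. d \<in> xu_coords S \<Longrightarrow> (\<Sum>c\<in>xu_coords S. l c * partial_deriv d (with_inputs \<Phi> c) p) = 0"
    for l :: "('s, 'i) coord \<Rightarrow> real"
  proof -
    \<comment> \<open>Derivatives by inputs do not see the state rows, so the coefficients of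
      \<open>\<Phi>\<close> vanish first; derivatives by states then dispose of the rest.\<close>
    have "(\<Sum>j\<in>UNIV. l (Input j 0) *\<^sub>R w j) = 0"
      using l[of "Input _ 0"]
      by (simp add: sum_xu_coords[OF assms(1)] with_eq partial_deriv_coord d\<Phi> vec_eq_iff)
    from w(2)[OF this] have input: "l (Input j 0) = 0" for j by blast
    have "l (State s) = 0" if "s \<in> S" for s
      using l[of "State s"] that assms(1)
      by (simp add: sum_xu_coords[OF assms(1)] with_eq partial_deriv_coord input if_distrib cong: if_cong)
    with input show ?thesis by (auto simp: jet_coords_def)
  qed
  obtain X where X: "local_diffeo (xu_coords S) (xu_coords S) (with_inputs \<Phi>) X p"
    by (rule inverse_function[OF fin fin refl smooth_T indep])
  define \<Psi> where "\<Psi> j = X (Input j 0)" for j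
  have "input_transformation S p \<Phi> \<Psi>"
    unfolding input_transformation_def local_diffeo_def
  proof (intro conjI ballI)
    show "smooth_fn (xu_coords S) p (with_inputs \<Phi> c)" if "c \<in> xu_coords S" for c by (rule smooth_T[OF that])
    show "smooth_fn (xu_coords S) (\<lambda>b. with_inputs \<Phi> b p) (with_inputs \<Psi> c)" if "c \<in> xu_coords S" for c
      using that X by (cases c) (simp_all add: with_eq smooth_fn_coord \<Psi>_def local_diffeo_def)
    have "\<forall>\<^sub>F q in nhds p. \<forall>a\<in>xu_coords S. X a (\<lambda>b. with_inputs \<Phi> b q) = q a"
      using X by (simp add: local_diffeo_def)
    then show "\<forall>\<^sub>F q in nhds p. \<forall>a\<in>xu_coords S. with_inputs \<Psi> a (\<lambda>b. with_inputs \<Phi> b q) = q a"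
    proof (rule eventually_mono, intro ballI)
      fix q :: "('s, 'i) jet" and a :: "('s, 'i) coord"
      assume "\<forall>a\<in>xu_coords S. X a (\<lambda>b. with_inputs \<Phi> b q) = q a" "a \<in> xu_coords S"
      then show "with_inputs \<Psi> a (\<lambda>b. with_inputs \<Phi> b q) = q a"
        by (cases a) (auto simp: \<Psi>_def)
    qed
    have "\<forall>\<^sub>F r in nhds (\<lambda>b. with_inputs \<Phi> b p). \<forall>b\<in>xu_coords S. with_inputs \<Phi> b (\<lambda>a. X a r) = r b"
      using X by (simp add: local_diffeo_def)
    then show "\<forall>\<^sub>F r in nhds (\<lambda>b. with_inputs \<Phi> b p).
        \<forall>b\<in>xu_coords S. with_inputs \<Phi> b (\<lambda>a. with_inputs \<Psi> a r) = r b"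
    proof (rule eventually_mono)
      fix r :: "('s, 'i) jet"
      assume r: "\<forall>b\<in>xu_coords S. with_inputs \<Phi> b (\<lambda>a. X a r) = r b"
      \<comment> \<open>The state rows of \<open>with_inputs \<Phi>\<close> are coordinates, so the
        equation \<open>r\<close> forces \<open>X\<close> to return the state unchanged.\<close>
      have eq: "with_inputs \<Psi> a r = X a r" if "a \<in> xu_coords S" for a
        using that bspec[OF r that] by (cases a) (simp_all add: \<Psi>_def)
      have "with_inputs \<Phi> b (\<lambda>a. with_inputs \<Psi> a r) = with_inputs \<Phi> b (\<lambda>a. X a r)"
        if "b \<in> xu_coords S" for b
        by (rule depends_onlyD[OF smooth_fn_depends_only[OF smooth_T[OF that]]]) (rule eq)
      then show "\<forall>b\<in>xu_coords S. with_inputs \<Phi> b (\<lambda>a. with_inputs \<Psi> a r) = r b" using r by simp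
    qed
  qed
  then show thesis by (rule that) (simp add: \<Phi>_def)
qed

section \<open>From local to global dependence, and the theorem\<close>

lemma locally_depends_only_freeze:
  assumes "locally_depends_only C p h"
  shows "\<forall>\<^sub>F q in nhds p. h (freeze C p q) = h q"
proof -
  obtain U where U: "open U" "p \<in> U" "depends_only C U h"
    using assms unfolding locally_depends_only_def by blast
  have ev: "\<forall>\<^sub>F q in nhds p. q \<in> U" by (rule eventually_eq_open[OF U(1,2)])
  have "(freeze C p \<longlongrightarrow> p) (nhds p)" by (rule tendsto_freeze) simp
  from ev eventually_compose_filterlim[OF ev this] show ?thesis
  proof eventually_elim
    case (elim q)
    have "\<forall>c\<in>C. freeze C p q c = q c" by (simp add: freeze_def)
    then show ?case using U(3) elim unfolding depends_only_def by metis
  qed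
qed

lemma smooth_fn_freeze:
  assumes "locally_depends_only C p h" "smooth_at p h"
  shows "smooth_fn C p (\<lambda>q. h (freeze C p q))"
  unfolding smooth_fn_iff
proof
  have "freeze C p q = freeze C p q'" if "\<forall>c\<in>C. q c = q' c" for q q'
    using that by (auto simp: freeze_def)
  then show "depends_only C UNIV (\<lambda>q. h (freeze C p q))" unfolding depends_only_def by metis
  show "smooth_at p (\<lambda>q. h (freeze C p q))"
    by (rule smooth_at_cong_ev[OF _ assms(2)])
      (use locally_depends_only_freeze[OF assms(1)] in \<open>simp add: eq_commute\<close>)
qed

theorem theorem1:
  fixes f :: "'n::finite \<Rightarrow> ('n, 'm::finite) jet \<Rightarrow> real"
    and \<phi> :: "'m \<Rightarrow> ('n, 'm) jet \<Rightarrow> real"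
    and p :: "('n, 'm) jet"
    and Q R K :: "'m \<Rightarrow> nat"
    and M\<^sub>1 :: "'m set"
  assumes "control_system UNIV f p"
    and "flat_output UNIV f p Q \<phi> R"
    and "\<forall>j\<in>M\<^sub>1. smooth_fn (xu_coords UNIV) p (\<phi> j)"
    and "\<forall>j\<in>M\<^sub>1. relative_degree UNIV f p (\<phi> j) (K j)"
    and "rank ((\<chi> j i. if j \<in> M\<^sub>1
                 then partial_deriv (Input i 0) (time_deriv UNIV f (K j) (\<phi> j)) p
                 else 0) :: real ^ 'm ^ 'm) = card M\<^sub>1"
    and "\<forall>j\<in>M\<^sub>1. R j > K j"
    and "int (\<Sum>j\<in>M\<^sub>1. R j) - int (\<Sum>j\<in>M\<^sub>1. K j) = diff_difference (UNIV :: 'n set) R"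
  shows "SFL_via_minimal_prolongations UNIV f p \<phi> \<and>
    (\<forall>\<Phi> \<Psi>.
       input_transformation UNIV p \<Phi> \<Psi> \<and>
       (\<forall>j\<in>M\<^sub>1. \<forall>\<^sub>F q in nhds p. \<Phi> j q = time_deriv UNIV f (K j) (\<phi> j) q) \<longrightarrow>
       SFL_after_prolonging UNIV f p \<phi> \<Phi> \<Psi> (\<lambda>j. if j \<in> M\<^sub>1 then R j - K j else 0))"
proof -
  define D where "D j = (if j \<in> M\<^sub>1 then R j - K j else 0)" for j
  have "int (\<Sum>j\<in>M\<^sub>1. R j - K j) = int (\<Sum>j\<in>M\<^sub>1. R j) - int (\<Sum>j\<in>M\<^sub>1. K j)"
    using assms(6) by (simp add: sum_subtractf[symmetric] of_nat_diff less_imp_le)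
  then have diff: "int (\<Sum>j\<in>M\<^sub>1. R j - K j) = diff_difference (UNIV :: 'n set) R"
    using assms(7) by simp
  \<comment> \<open>The difference \<open>|R| - n\<close> equals the total order of prolongation;
    this is the equality of dimensions on which the inversion rests.\<close>
  then have card: "(\<Sum>j\<in>M\<^sub>1. R j - K j) + card (UNIV :: 'n set) = (\<Sum>j\<in>UNIV. R j)"
    unfolding diff_difference_def by linarith
  have linearizes: "SFL_after_prolonging UNIV f p \<phi> \<Phi> \<Psi> D"
    if trafo: "input_transformation UNIV p \<Phi> \<Psi>"
      and \<Phi>: "\<And>j. j \<in> M\<^sub>1 \<Longrightarrow> \<forall>\<^sub>F q in nhds p. \<Phi> j q = time_deriv UNIV f (K j) (\<phi> j) q" for \<Phi> \<Psi>
    unfolding D_def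
    by (rule SFL_after_prolonging_of_flat[OF assms(1,2) _ card trafo \<Phi>]) (use assms(6) in auto)

  \<comment> \<open>The relative degree makes this derivative a function of state and input only
    near \<open>p\<close>, whereas an input transformation must be one everywhere; freezing supplies
    a representative with the same germ.\<close>
  define h where "h j q = time_deriv UNIV f (K j) (\<phi> j) (freeze (xu_coords UNIV) p q)" for j q
  have dep: "locally_depends_only (xu_coords UNIV) p (time_deriv UNIV f (K j) (\<phi> j))" if "j \<in> M\<^sub>1" for j
    using assms(4) that by (simp add: relative_degree_def)
  have h_ev: "\<forall>\<^sub>F q in nhds p. h j q = time_deriv UNIV f (K j) (\<phi> j) q" if "j \<in> M\<^sub>1" for j
    unfolding h_def by (rule locally_depends_only_freeze[OF dep[OF that]])
  have "jet_fn UNIV p (\<phi> j)" for j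
    using assms(2) by (intro jet_fnI[of "jet_coords UNIV Q"] finite_jet_coords) (simp_all add: flat_output_def)
  from jet_fn_smooth_at[OF jet_fn_time_deriv[OF assms(1) this]]
  have h_smooth: "smooth_fn (xu_coords UNIV) p (h j)" if "j \<in> M\<^sub>1" for j
    unfolding h_def by (rule smooth_fn_freeze[OF dep[OF that]])
  have "((\<chi> j i. if j \<in> M\<^sub>1 then partial_deriv (Input i 0) (h j) p else 0) :: real ^ 'm ^ 'm) =
      (\<chi> j i. if j \<in> M\<^sub>1 then partial_deriv (Input i 0) (time_deriv UNIV f (K j) (\<phi> j)) p else 0)"
    using partial_deriv_cong_ev[OF h_ev] by (simp add: vec_eq_iff)
  then have rank: "rank ((\<chi> j i. if j \<in> M\<^sub>1 then partial_deriv (Input i 0) (h j) p else 0) :: real ^ 'm ^ 'm) =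
      card M\<^sub>1"
    using assms(5) by simp
  obtain \<Phi> \<Psi> where trafo: "input_transformation UNIV p \<Phi> \<Psi>" "\<And>j. j \<in> M\<^sub>1 \<Longrightarrow> \<Phi> j = h j"
    by (rule input_transformation_completion[OF finite h_smooth rank]) blast+
  have "SFL_after_prolonging UNIV f p \<phi> \<Phi> \<Psi> D"
    by (rule linearizes[OF trafo(1)]) (simp add: trafo(2) h_ev)
  moreover have "int (\<Sum>j\<in>UNIV. D j) = diff_difference (UNIV :: 'n set) R"
    using diff by (simp add: D_def sum.If_cases)
  ultimately have "SFL_via_minimal_prolongations UNIV f p \<phi>"
    unfolding SFL_via_minimal_prolongations_def using assms(2) trafo(1) by blast
  then show ?thesis using linearizes unfolding D_def by blast
qed

end
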